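(* Let $(X,.)$ be an $n$-space and $\pi\colon C^*(X,.)\to\mathcal{B}(\mathcal{H})$ a representation on a Hilbert space $\mathcal{H}$. There is a unique spectral $n$-measure $E\colon\mathcal{B}(X)\to M_n(\mathcal{B}(\mathcal{H}))$ such that $\pi(f)=\int f\,dE$ for all $f\in C^*(X,.)$. In particular, every representation of $C^*(X,.)$ admits an extension to a representation of $\mathcal{B}C^*(X,.)$.
   Context: $M_n$ = complex $n\times n$ matrices, $\mathcal{U}_n$ its unitary group, $\mathbb{U}_n=\mathcal{U}_n/(\mathbb{T}I)$; for $\mathfrak{u}\in\mathbb{U}_n$ and a matrix $A$ (entries in $\mathbb{C}$ or $\mathcal{B}(\mathcal{H})$), $\mathfrak{u}.A=UAU^{-1}$ with $U\in\mathcal{U}_n$ a representative. An $n$-space is a locally compact Hausdorff space $X$ with a continuous free action of $\mathbb{U}_n$. $C^*(X,.)$: continuous $f\colon X\to M_n$ vanishing at infinity with $f(\mathfrak{u}.x)=\mathfrak{u}.f(x)$; $\mathcal{B}C^*(X,.)$: bounded Borel $f\colon X\to M_n$ with the same equivariance. Representations are $*$-homomorphisms into $\mathcal{B}(\mathcal{H})$ (not necessarily nondegenerate or unital). $\mathcal{B}(X)$ is the Borel $\sigma$-algebra. An operator-valued $n$-measure is $E=[E_{jk}]\colon\mathcal{B}(X)\to M_n(\mathcal{B}(\mathcal{H}))$ with each $A\mapsto\langle E_{jk}(A)h,w\rangle$ a complex measure and $E(\mathfrak{u}.A)=\mathfrak{u}.E(A)$; regular if all these measures are regular. $\int f\,dE=\sum_{j,k}\int_X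 f_{jk}\,dE_{kj}$ (scalar integrals against operator-valued measures defined weakly). A spectral $n$-measure is a regular operator-valued $n$-measure with $(\int f\,dE)^*=\int f^*\,dE$ and $\int fg\,dE=\int f\,dE\int g\,dE$ for all $f,g\in\mathcal{B}C^*(X,.)$. *)

theory Defs
  imports "HOL-Analysis.Analysis"
begin

definition cadj :: "complex^'n^'n \<Rightarrow> complex^'n^'n" where
  "cadj A = (\<chi> i j. cnj (A $ j $ i))"

definition unitaries :: "(complex^'n^'n) set" where
  "unitaries = {U. cadj U ** U = mat 1}"

text \<open>An action of the projective unitary group U_n / (T I) is encoded as an action
  of U_n (given on unitary matrices) that is trivial on the scalar unitaries.
  Freeness of the PU_n action: U.x = x only for scalar U.\<close>
definition n_space :: "(complex^'n::finite^'n \<Rightarrow> 'x::t2_space \<Rightarrow> 'x) \<Rightarrow> bool" where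
  "n_space act \<longleftrightarrow>
     locally_compact_space (euclidean :: 'x topology) \<and>
     continuous_on (unitaries \<times> UNIV) (\<lambda>p. act (fst p) (snd p)) \<and>
     (\<forall>x. act (mat 1) x = x) \<and>
     (\<forall>U\<in>unitaries. \<forall>V\<in>unitaries. \<forall>x. act (U ** V) x = act U (act V x)) \<and>
     (\<forall>c x. cmod c = 1 \<longrightarrow> act (mat c) x = x) \<and>
     (\<forall>U\<in>unitaries. \<forall>x. act U x = x \<longrightarrow> (\<exists>c. cmod c = 1 \<and> U = mat c))"

definition equivariant ::
  "(complex^'n::finite^'n \<Rightarrow> 'x \<Rightarrow> 'x) \<Rightarrow> ('x \<Rightarrow> complex^'n^'n) \<Rightarrow> bool" where
  "equivariant act f \<longleftrightarrow> (\<forall>U\<in>unitaries. \<forall>x. f (act U x) = U ** f x ** cadj U)"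

definition Cstar ::
  "(complex^'n::finite^'n \<Rightarrow> 'x::topological_space \<Rightarrow> 'x) \<Rightarrow> ('x \<Rightarrow> complex^'n^'n) set" where
  "Cstar act = {f. continuous_on UNIV f \<and> (\<forall>e>0. compact {x. e \<le> norm (f x)}) \<and> equivariant act f}"

definition BCstar ::
  "(complex^'n::finite^'n \<Rightarrow> 'x::topological_space \<Rightarrow> 'x) \<Rightarrow> ('x \<Rightarrow> complex^'n^'n) set" where
  "BCstar act = {f. f \<in> borel_measurable borel \<and> bounded (range f) \<and> equivariant act f}"

definition fmult :: "('x \<Rightarrow> complex^'n::finite^'n) \<Rightarrow> ('x \<Rightarrow> complex^'n^'n) \<Rightarrow> 'x \<Rightarrow> complex^'n^'n" where
  "fmult f g = (\<lambda>x. f x ** g x)"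

definition fadj :: "('x \<Rightarrow> complex^'n::finite^'n) \<Rightarrow> 'x \<Rightarrow> complex^'n^'n" where
  "fadj f = (\<lambda>x. cadj (f x))"

definition fscale :: "complex \<Rightarrow> ('x \<Rightarrow> complex^'n::finite^'n) \<Rightarrow> 'x \<Rightarrow> complex^'n^'n" where
  "fscale c f = (\<lambda>x. (\<chi> i j. c * f x $ i $ j))"

definition hnorm :: "('h \<Rightarrow> 'h \<Rightarrow> complex) \<Rightarrow> 'h \<Rightarrow> real" where
  "hnorm ip x = sqrt (Re (ip x x))"

definition hilbert_space :: "(complex \<Rightarrow> 'h::ab_group_add \<Rightarrow> 'h) \<Rightarrow> ('h \<Rightarrow> 'h \<Rightarrow> complex) \<Rightarrow> bool" where
  "hilbert_space sc ip \<longleftrightarrow>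
     (\<forall>a x y. sc a (x + y) = sc a x + sc a y) \<and>
     (\<forall>a b x. sc (a + b) x = sc a x + sc b x) \<and>
     (\<forall>a b x. sc a (sc b x) = sc (a * b) x) \<and>
     (\<forall>x. sc 1 x = x) \<and>
     (\<forall>x y z. ip (x + y) z = ip x z + ip y z) \<and>
     (\<forall>a x y. ip (sc a x) y = a * ip x y) \<and>
     (\<forall>x y. ip y x = cnj (ip x y)) \<and>
     (\<forall>x. Im (ip x x) = 0 \<and> 0 \<le> Re (ip x x)) \<and>
     (\<forall>x. ip x x = 0 \<longrightarrow> x = 0) \<and>
     (\<forall>s::nat \<Rightarrow> 'h. (\<forall>e>0. \<exists>N. \<forall>m\<ge>N. \<forall>k\<ge>N. hnorm ip (s m - s k) < e) \<longrightarrow>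
        (\<exists>l. \<forall>e>0. \<exists>N. \<forall>k\<ge>N. hnorm ip (s k - l) < e))"

definition bop :: "(complex \<Rightarrow> 'h::ab_group_add \<Rightarrow> 'h) \<Rightarrow> ('h \<Rightarrow> 'h \<Rightarrow> complex) \<Rightarrow> ('h \<Rightarrow> 'h) \<Rightarrow> bool" where
  "bop sc ip T \<longleftrightarrow>
     (\<forall>x y. T (x + y) = T x + T y) \<and> (\<forall>c x. T (sc c x) = sc c (T x)) \<and>
     (\<exists>K. \<forall>x. hnorm ip (T x) \<le> K * hnorm ip x)"

definition is_adj :: "('h \<Rightarrow> 'h \<Rightarrow> complex) \<Rightarrow> ('h \<Rightarrow> 'h) \<Rightarrow> ('h \<Rightarrow> 'h) \<Rightarrow> bool" where
  "is_adj ip T S \<longleftrightarrow> (\<forall>x y. ip (T x) y = ip x (S y))"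

text \<open>A representation (*-homomorphism, not necessarily unital/nondegenerate) of the
  *-algebra A (of matrix-valued functions, pointwise operations) into B(H).\<close>
definition star_rep ::
  "(complex \<Rightarrow> 'h::ab_group_add \<Rightarrow> 'h) \<Rightarrow> ('h \<Rightarrow> 'h \<Rightarrow> complex) \<Rightarrow>
   ('x \<Rightarrow> complex^'n::finite^'n) set \<Rightarrow> (('x \<Rightarrow> complex^'n^'n) \<Rightarrow> 'h \<Rightarrow> 'h) \<Rightarrow> bool" where
  "star_rep sc ip A \<pi> \<longleftrightarrow>
     (\<forall>f\<in>A. bop sc ip (\<pi> f)) \<and>
     (\<forall>f\<in>A. \<forall>g\<in>A. \<pi> (\<lambda>x. f x + g x) = (\<lambda>h. \<pi> f h + \<pi> g h)) \<and>
     (\<forall>c. \<forall>f\<in>A. \<pi> (fscale c f) = (\<lambda>h. sc c (\<pi> f h))) \<and>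
     (\<forall>f\<in>A. \<forall>g\<in>A. \<pi> (fmult f g) = \<pi> f \<circ> \<pi> g) \<and>
     (\<forall>f\<in>A. is_adj ip (\<pi> f) (\<pi> (fadj f)))"

definition complex_measure :: "('x::topological_space set \<Rightarrow> complex) \<Rightarrow> bool" where
  "complex_measure \<mu> \<longleftrightarrow> \<mu> {} = 0 \<and>
     (\<forall>A. range A \<subseteq> sets borel \<longrightarrow> disjoint_family A \<longrightarrow> (\<lambda>i. \<mu> (A i)) sums \<mu> (\<Union>i. A i))"

definition tvar :: "('x::topological_space set \<Rightarrow> complex) \<Rightarrow> 'x set \<Rightarrow> ennreal" where
  "tvar \<mu> A = (SUP P\<in>{P::nat \<Rightarrow> 'x set. range P \<subseteq> sets borel \<and> disjoint_family P \<and> (\<Union>i. P i) = A}.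
                 (\<Sum>i. ennreal (cmod (\<mu> (P i)))))"

definition regular_cm :: "('x::topological_space set \<Rightarrow> complex) \<Rightarrow> bool" where
  "regular_cm \<mu> \<longleftrightarrow> (\<forall>A\<in>sets borel.
      tvar \<mu> A = (INF V\<in>{V. open V \<and> A \<subseteq> V}. tvar \<mu> V) \<and>
      tvar \<mu> A = (SUP K\<in>{K. compact K \<and> K \<subseteq> A}. tvar \<mu> K))"

definition pos_var :: "('x::topological_space set \<Rightarrow> real) \<Rightarrow> 'x set \<Rightarrow> real" where
  "pos_var \<nu> A = (SUP B\<in>{B. B \<subseteq> A \<and> B \<in> sets borel}. \<nu> B)"

definition pos_meas :: "('x::topological_space set \<Rightarrow> real) \<Rightarrow> 'x measure" where
  "pos_meas \<nu> = measure_of UNIV (sets borel) (\<lambda>A. ennreal (pos_var \<nu> A))"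

text \<open>Integral of a complex function against a complex measure, via the Jordan
  decomposition mu = (nu1 - nu2) + i (nu3 - nu4).\<close>
definition cint :: "('x::topological_space set \<Rightarrow> complex) \<Rightarrow> ('x \<Rightarrow> complex) \<Rightarrow> complex" where
  "cint \<mu> g =
     ((LINT x|pos_meas (\<lambda>A. Re (\<mu> A)). g x) - (LINT x|pos_meas (\<lambda>A. - Re (\<mu> A)). g x)) +
     \<i> * ((LINT x|pos_meas (\<lambda>A. Im (\<mu> A)). g x) - (LINT x|pos_meas (\<lambda>A. - Im (\<mu> A)). g x))"

text \<open>u.M = U M U^{-1} for an n x n matrix M of operators (U^{-1} = U^*).\<close>
definition opconj ::
  "(complex \<Rightarrow> 'h::ab_group_add \<Rightarrow> 'h) \<Rightarrow> complex^'n::finite^'n \<Rightarrow> ('n \<Rightarrow> 'n \<Rightarrow> 'h \<Rightarrow> 'h) \<Rightarrow> 'n \<Rightarrow> 'n \<Rightarrow> 'h \<Rightarrow> 'h" where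
  "opconj sc U M = (\<lambda>j k h. \<Sum>l\<in>UNIV. \<Sum>m\<in>UNIV. sc (U $ j $ l * cnj (U $ k $ m)) (M l m h))"

definition op_n_measure ::
  "(complex^'n::finite^'n \<Rightarrow> 'x::topological_space \<Rightarrow> 'x) \<Rightarrow> (complex \<Rightarrow> 'h::ab_group_add \<Rightarrow> 'h) \<Rightarrow>
   ('h \<Rightarrow> 'h \<Rightarrow> complex) \<Rightarrow> ('x set \<Rightarrow> 'n \<Rightarrow> 'n \<Rightarrow> 'h \<Rightarrow> 'h) \<Rightarrow> bool" where
  "op_n_measure act sc ip E \<longleftrightarrow>
     (\<forall>A\<in>sets borel. \<forall>j k. bop sc ip (E A j k)) \<and>
     (\<forall>j k h w. complex_measure (\<lambda>A. ip (E A j k h) w)) \<and>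
     (\<forall>U\<in>unitaries. \<forall>A\<in>sets borel. E (act U ` A) = opconj sc U (E A))"

definition regular_op_n_measure where
  "regular_op_n_measure act sc ip E \<longleftrightarrow> op_n_measure act sc ip E \<and>
     (\<forall>j k h w. regular_cm (\<lambda>A. ip (E A j k h) w))"

definition opint ::
  "(complex \<Rightarrow> 'h::ab_group_add \<Rightarrow> 'h) \<Rightarrow> ('h \<Rightarrow> 'h \<Rightarrow> complex) \<Rightarrow>
   ('x::topological_space set \<Rightarrow> 'n::finite \<Rightarrow> 'n \<Rightarrow> 'h \<Rightarrow> 'h) \<Rightarrow> ('x \<Rightarrow> complex^'n^'n) \<Rightarrow> 'h \<Rightarrow> 'h" where
  "opint sc ip E f = (THE T. bop sc ip T \<and>
     (\<forall>h w. ip (T h) w = (\<Sum>j\<in>UNIV. \<Sum>k\<in>UNIV. cint (\<lambda>A. ip (E A k j h) w) (\<lambda>x. f x $ j $ k))))"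

definition spectral_n_measure where
  "spectral_n_measure act sc ip E \<longleftrightarrow> regular_op_n_measure act sc ip E \<and>
     (\<forall>f\<in>BCstar act. \<forall>g\<in>BCstar act.
        is_adj ip (opint sc ip E f) (opint sc ip E (fadj f)) \<and>
        opint sc ip E (fmult f g) = opint sc ip E f \<circ> opint sc ip E g)"

end

(* Fix h, w in H. The functional f |-> <pi(f)h, w> on C*(X,.) is bounded, because 1 - pi(a) is positive for
   small self-adjoint a. Composing it with averaging over the unitary group (F |-> int U* F(U x) U dU, a
   projection of C_0(X, M_n) onto C*(X,.)) and applying the Riesz representation theorem entrywise extends it to
   a functional on all bounded Borel matrix functions that is invariant under twisting by unitaries and given by
   regular measures; E_kj(A) is read off at 1_A e_jk. An invariant functional of this kind is determined by its
   restriction to C*(X,.), since a function and its average have the same value. This one uniqueness principle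
   yields sesquilinearity in (h, w), the adjoint rule, multiplicativity (first with one factor Borel, then both)
   and the uniqueness of E.
   Haar measure is the image of Lebesgue measure, restricted to a bi-invariant neighbourhood of the unitary
   group, under the polar decomposition. *)
theory Submission
  imports Defs
begin

section \<open>Signed and complex Borel measures\<close>

text \<open>The function \<open>1_A e_jk\<close> is not equivariant, so it lies outside the Borel
  algebra to which \<open>\<pi>\<close> is to be extended, and \<open>E A\<close> is not simply the
  image of an element under such an extension. Invariance under twists bridges the gap: it ties the
  values on all bounded Borel matrix functions to those on the equivariant ones. Continuity of
  \<open>\<pi>\<close> is not assumed and has to be proved inside an algebra that may have no unit.
  The tool is a small \<open>r\<close> with \<open>(1 + r)(1 - a)(1 + r) = 1\<close>, an equation
  that expands to one free of the unit. The same \<open>r\<close> gives the polar decomposition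
  behind Haar measure. The space need not be second countable, so continuity is not accessible
  through sequences and measures have to be controlled by compact and open sets. For that reason
  measures are mostly carried as functionals on bounded Borel functions dominated by a Radon
  measure: this form survives sums, twists and multiplication by bounded functions, whereas the
  Jordan parts behind \<open>cint\<close> are not even additive in the measure.\<close>

definition bounded_borel :: "('x::topological_space \<Rightarrow> 'b::real_normed_vector) set" where
  "bounded_borel = {f. f \<in> borel_measurable borel \<and> bounded (range f)}"

definition C0 :: "('x::topological_space \<Rightarrow> 'b::real_normed_vector) set" where
  "C0 = {f. continuous_on UNIV f \<and> (\<forall>e>0. compact {x. e \<le> norm (f x)})}"

lemma bounded_borelI:
  "f \<in> borel_measurable borel \<Longrightarrow> (\<And>x. norm (f x) \<le> B) \<Longrightarrow> f \<in> bounded_borel"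
  by (auto simp: bounded_borel_def bounded_iff)

lemma bounded_borelE:
  assumes "f \<in> bounded_borel"
  obtains B where "B > 0" "\<And>x. norm (f x) \<le> B"
proof -
  have "bounded (range f)" using assms by (simp add: bounded_borel_def)
  then obtain B where "B > 0" "\<And>x. norm (f x) \<le> B" by (auto simp: bounded_pos)
  then show ?thesis using that by blast
qed

lemma bounded_borel_measurable: "f \<in> bounded_borel \<Longrightarrow> f \<in> borel_measurable borel"
  by (simp add: bounded_borel_def)

lemma bounded_borel_add:
  fixes f g :: "'x::topological_space \<Rightarrow> 'b::{second_countable_topology, real_normed_vector}"
  assumes f: "f \<in> bounded_borel" and g: "g \<in> bounded_borel"
  shows "(\<lambda>x. f x + g x) \<in> bounded_borel"
proof -
  obtain B where B: "\<And>x. norm (f x) \<le> B" using bounded_borelE[OF f] by metis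
  obtain D where D: "\<And>x. norm (g x) \<le> D" using bounded_borelE[OF g] by metis
  have "norm (f x + g x) \<le> B + D" for x using B[of x] D[of x] norm_triangle_ineq[of "f x" "g x"] by linarith
  then show ?thesis using f g by (intro bounded_borelI[where B="B+D"]) (auto simp: bounded_borel_def)
qed

lemma bounded_borel_continuous_comp:
  fixes f :: "'x::topological_space \<Rightarrow> 'b::real_normed_vector"
    and F :: "'b \<Rightarrow> 'c::real_normed_vector"
  assumes f: "f \<in> bounded_borel" and F: "continuous_on UNIV F"
    and le: "\<And>y. norm (F y) \<le> K * norm y" and K: "K \<ge> 0"
  shows "(\<lambda>x. F (f x)) \<in> bounded_borel"
proof -
  obtain B where B: "\<And>x. norm (f x) \<le> B" using bounded_borelE[OF f] by metis
  have m: "f \<in> borel_measurable borel" using f by (simp add: bounded_borel_def)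
  show ?thesis
  proof (rule bounded_borelI[where B="K*B"])
    show "(\<lambda>x. F (f x)) \<in> borel_measurable borel"
      using measurable_compose[OF m borel_measurable_continuous_onI[OF F]] .
    show "norm (F (f x)) \<le> K * B" for x
      using le[of "f x"] B[of x] K by (meson mult_left_mono order_trans)
  qed
qed

lemma bounded_borel_cmult:
  fixes f :: "'x::topological_space \<Rightarrow> complex"
  assumes "f \<in> bounded_borel" shows "(\<lambda>x. c * f x) \<in> bounded_borel"
  by (rule bounded_borel_continuous_comp[OF assms, where K="cmod c"])
     (auto intro!: continuous_intros simp: norm_mult)

lemma bounded_borel_indicator:
  "A \<in> sets borel \<Longrightarrow> (indicator A :: 'x::topological_space \<Rightarrow> complex) \<in> bounded_borel"
  by (rule bounded_borelI[where B=1]) (auto simp: indicator_def)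

lemma bounded_borel_sum:
  fixes f :: "'i \<Rightarrow> 'x::topological_space \<Rightarrow> 'b::{second_countable_topology, real_normed_vector}"
  assumes "finite I" "\<And>i. i \<in> I \<Longrightarrow> f i \<in> bounded_borel"
  shows "(\<lambda>x. \<Sum>i\<in>I. f i x) \<in> bounded_borel"
  using assms
proof (induction I)
  case empty
  then show ?case by (auto intro!: bounded_borelI[where B=0])
next
  case (insert i I)
  then show ?case by (auto intro!: bounded_borel_add)
qed

lemma bounded_borel_integrable:
  fixes f :: "'x::topological_space \<Rightarrow> 'b::{second_countable_topology, banach}"
  assumes "f \<in> bounded_borel" "finite_measure N" "sets N = sets borel"
  shows "integrable N f"
proof -
  interpret finite_measure N by fact
  obtain B where B: "\<And>x. norm (f x) \<le> B" using bounded_borelE[OF assms(1)] by metis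
  have "f \<in> borel_measurable N"
    using assms(1,3) by (simp add: bounded_borel_def cong: measurable_cong_sets)
  then show ?thesis using B by (intro integrable_const_bound[where B=B]) auto
qed

section \<open>Linear functionals on bounded Borel functions\<close>

definition linear_on_bb :: "(('x::topological_space \<Rightarrow> complex) \<Rightarrow> complex) \<Rightarrow> bool" where
  "linear_on_bb L \<longleftrightarrow>
     (\<forall>f\<in>bounded_borel. \<forall>g\<in>bounded_borel. L (\<lambda>x. f x + g x) = L f + L g) \<and>
     (\<forall>c. \<forall>f\<in>bounded_borel. L (\<lambda>x. c * f x) = c * L f)"

lemma linear_on_bb_add:
  "linear_on_bb L \<Longrightarrow> f \<in> bounded_borel \<Longrightarrow> g \<in> bounded_borel \<Longrightarrow> L (\<lambda>x. f x + g x) = L f + L g"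
  by (simp add: linear_on_bb_def)

lemma linear_on_bb_cmult:
  "linear_on_bb L \<Longrightarrow> f \<in> bounded_borel \<Longrightarrow> L (\<lambda>x. c * f x) = c * L f"
  by (simp add: linear_on_bb_def)

lemma linear_on_bb_sum:
  assumes L: "linear_on_bb L" and "finite I" "\<And>i. i \<in> I \<Longrightarrow> f i \<in> bounded_borel"
  shows "L (\<lambda>x. \<Sum>i\<in>I. f i x) = (\<Sum>i\<in>I. L (f i))"
  using assms(2,3)
proof (induction I)
  case empty
  have "(\<lambda>x. 0) \<in> (bounded_borel :: ('a \<Rightarrow> complex) set)" by (auto intro!: bounded_borelI[where B=0])
  then have "L (\<lambda>x. 0 * 0) = 0 * L (\<lambda>x. 0)" by (rule linear_on_bb_cmult[OF L])
  then show ?case by simp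
next
  case (insert i I)
  then have "(\<lambda>x. \<Sum>i\<in>I. f i x) \<in> bounded_borel" by (auto intro!: bounded_borel_sum)
  then show ?case using insert L by (simp add: linear_on_bb_def)
qed

lemma linear_on_bb_diff:
  assumes L: "linear_on_bb L" and f: "f \<in> bounded_borel" and g: "g \<in> bounded_borel"
  shows "L (\<lambda>x. f x - g x) = L f - L g"
proof -
  have "(\<lambda>x. (-1) * g x) \<in> bounded_borel" using bounded_borel_cmult[OF g, of "-1"] .
  then have "L (\<lambda>x. f x + (-1) * g x) = L f + L (\<lambda>x. (-1) * g x)"
    by (rule linear_on_bb_add[OF L f])
  also have "L (\<lambda>x. (-1) * g x) = (-1) * L g" by (rule linear_on_bb_cmult[OF L g])
  finally show ?thesis by simp
qed

text \<open>Rounding real and imaginary parts to the grid of width \<open>1/n\<close> gives uniform approximation by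
  functions with finitely many values.\<close>
lemma linear_on_bb_eq_0:
  fixes L :: "('x::topological_space \<Rightarrow> complex) \<Rightarrow> complex"
  assumes L: "linear_on_bb L"
    and C: "\<And>f B. f \<in> bounded_borel \<Longrightarrow> (\<And>x. cmod (f x) \<le> B) \<Longrightarrow> cmod (L f) \<le> C * B"
    and ind: "\<And>A. A \<in> sets borel \<Longrightarrow> L (indicator A) = 0"
    and g: "g \<in> bounded_borel"
  shows "L g = 0"
proof -
  have gm: "g \<in> borel_measurable borel" using g by (simp add: bounded_borel_def)
  obtain B where B: "\<And>x. cmod (g x) \<le> B" "B > 0" using bounded_borelE[OF g] by metis
  \<comment> \<open>The sign of \<open>C\<close> is not assumed, hence the absolute value. The
    factor 2 accounts for rounding two coordinates.\<close>
  have key: "cmod (L g) \<le> \<bar>C\<bar> * (2 / real n)" if n: "n > 0" for n :: nat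
  proof -
    define r where "r = (\<lambda>t::real. real_of_int \<lfloor>real n * t\<rfloor> / real n)"
    have r: "\<bar>t - r t\<bar> \<le> 1 / real n" for t
    proof -
      have "\<bar>real n * t - real_of_int \<lfloor>real n * t\<rfloor>\<bar> \<le> 1" by linarith
      then have "\<bar>real n * t - real_of_int \<lfloor>real n * t\<rfloor>\<bar> / real n \<le> 1 / real n"
        using n by (simp add: divide_right_mono)
      moreover have "t - r t = (real n * t - real_of_int \<lfloor>real n * t\<rfloor>) / real n"
        using n by (simp add: r_def field_simps)
      ultimately show ?thesis using n by (simp add: abs_divide)
    qed
    define h where "h = (\<lambda>x. Complex (r (Re (g x))) (r (Im (g x))))"
    have rm: "r \<in> borel_measurable borel" unfolding r_def by measurable
    have hm: "h \<in> borel_measurable borel"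
    proof -
      have "h = (\<lambda>x. complex_of_real (r (Re (g x))) + \<i> * complex_of_real (r (Im (g x))))"
        by (auto simp: h_def complex_eq_iff)
      moreover have "\<dots> \<in> borel_measurable borel"
        using rm gm by measurable
      ultimately show ?thesis by simp
    qed
    have hg: "cmod (g x - h x) \<le> 2 / real n" for x
    proof -
      have "cmod (g x - h x) \<le> \<bar>Re (g x - h x)\<bar> + \<bar>Im (g x - h x)\<bar>" by (rule cmod_le)
      also have "\<dots> \<le> 1 / real n + 1 / real n" using add_mono[OF r r] by (simp add: h_def)
      finally show ?thesis by simp
    qed
    have "finite (range h)"
    proof -
      \<comment> \<open>The grid is padded by one step at each end, so that rounding a negative
        value down does not leave it.\<close>
      define S where "S = (\<lambda>k::int. real_of_int k / real n) ` {-\<lceil>real n * B\<rceil>-1..\<lceil>real n * B\<rceil>+1}"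
      have S: "r t \<in> S" if "\<bar>t\<bar> \<le> B" for t
      proof -
        have "\<bar>real n * t\<bar> \<le> real n * B" using that n by (simp add: abs_mult mult_left_mono)
        then have "\<lfloor>real n * t\<rfloor> \<in> {-\<lceil>real n * B\<rceil>-1..\<lceil>real n * B\<rceil>+1}"
          by (simp; linarith)
        then show ?thesis unfolding S_def r_def by blast
      qed
      have "finite S" unfolding S_def by simp
      have "h x \<in> case_prod Complex ` (S \<times> S)" for x
      proof -
        have "\<bar>Re (g x)\<bar> \<le> B" "\<bar>Im (g x)\<bar> \<le> B"
          using B(1)[of x] abs_Re_le_cmod[of "g x"] abs_Im_le_cmod[of "g x"] by linarith+
        then show ?thesis using S unfolding h_def by auto
      qed
      then have "range h \<subseteq> case_prod Complex ` (S \<times> S)" by blast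
      then show ?thesis using \<open>finite S\<close> by (meson finite_SigmaI finite_imageI finite_subset)
    qed
    have hsum: "h = (\<lambda>x. \<Sum>v\<in>range h. v * indicator (h -` {v}) x)"
    proof
      fix x
      have "(\<Sum>v\<in>range h. v * indicator (h -` {v}) x) = (\<Sum>v\<in>range h. if v = h x then v else 0)"
        by (intro sum.cong) (auto simp: indicator_def)
      also have "\<dots> = h x" using \<open>finite (range h)\<close> by simp
      finally show "h x = (\<Sum>v\<in>range h. v * indicator (h -` {v}) x)" by simp
    qed
    have hs: "h -` {v} \<in> sets borel" for v
      using measurable_sets[OF hm, of "{v}"] by simp
    have "L h = (\<Sum>v\<in>range h. L (\<lambda>x. v * indicator (h -` {v}) x))"
      by (subst hsum, rule linear_on_bb_sum[OF L \<open>finite (range h)\<close>])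
         (auto intro!: bounded_borel_cmult bounded_borel_indicator hs)
    also have "\<dots> = (\<Sum>v\<in>range h. v * L (indicator (h -` {v})))"
      using L bounded_borel_indicator[OF hs] unfolding linear_on_bb_def by (auto intro!: sum.cong)
    also have "\<dots> = 0" using ind hs by simp
    finally have "L h = 0" .
    have hb: "h \<in> bounded_borel"
    proof (rule bounded_borelI[OF hm])
      show "norm (h x) \<le> B + 2 / real n" for x
        using hg[of x] B(1)[of x] norm_triangle_ineq3[of "g x" "h x"] by linarith
    qed
    then have "L g = L (\<lambda>x. g x - h x)" using linear_on_bb_diff[OF L g hb] \<open>L h = 0\<close> by simp
    moreover have "(\<lambda>x. g x - h x) \<in> bounded_borel"
      using bounded_borel_add[OF g bounded_borel_cmult[OF hb, of "-1"]] by simp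
    ultimately have "cmod (L g) \<le> C * (2 / real n)" using C[of "\<lambda>x. g x - h x" "2 / real n"] hg by simp
    also have "\<dots> \<le> \<bar>C\<bar> * (2 / real n)" by (intro mult_right_mono) auto
    finally show ?thesis .
  qed
  have "(\<lambda>n. \<bar>C\<bar> * (2 / real n)) \<longlonglongrightarrow> \<bar>C\<bar> * 0"
    by (intro tendsto_mult tendsto_const) (rule lim_const_over_n)
  moreover have "\<forall>\<^sub>F n in sequentially. cmod (L g) \<le> \<bar>C\<bar> * (2 / real n)"
    using key by (auto simp: eventually_sequentially intro!: exI[of _ 1])
  ultimately have "cmod (L g) \<le> \<bar>C\<bar> * 0"
    by (intro tendsto_le[OF trivial_limit_sequentially _ tendsto_const]) auto
  then show ?thesis by simp
qed

section \<open>Jordan decomposition of a signed measure\<close>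

definition signed_measure :: "('x::topological_space set \<Rightarrow> real) \<Rightarrow> bool" where
  "signed_measure \<nu> \<longleftrightarrow> \<nu> {} = 0 \<and>
     (\<forall>A. range A \<subseteq> sets borel \<longrightarrow> disjoint_family A \<longrightarrow> (\<lambda>i. \<nu> (A i)) sums \<nu> (\<Union>i. A i))"

lemma signed_measure_sums:
  "signed_measure \<nu> \<Longrightarrow> range A \<subseteq> sets borel \<Longrightarrow> disjoint_family A \<Longrightarrow>
     (\<lambda>i. \<nu> (A i)) sums \<nu> (\<Union>i. A i)"
  by (simp add: signed_measure_def)

lemma signed_measure_uminus: "signed_measure \<nu> \<Longrightarrow> signed_measure (\<lambda>A. - \<nu> A)"
  by (auto simp: signed_measure_def intro!: sums_minus)

lemma signed_measure_Re: "complex_measure \<mu> \<Longrightarrow> signed_measure (\<lambda>A. Re (\<mu> A))"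
  by (auto simp: signed_measure_def complex_measure_def intro!: sums_Re)

lemma signed_measure_Im: "complex_measure \<mu> \<Longrightarrow> signed_measure (\<lambda>A. Im (\<mu> A))"
  by (auto simp: signed_measure_def complex_measure_def intro!: sums_Im)

lemma signed_measure_Un:
  assumes s: "signed_measure \<nu>" and A: "A \<in> sets borel" "B \<in> sets borel" "A \<inter> B = {}"
  shows "\<nu> (A \<union> B) = \<nu> A + \<nu> B"
proof -
  have "range (binaryset A B) \<subseteq> sets borel" using A by (simp add: range_binaryset_eq)
  moreover have "disjoint_family (binaryset A B)"
    using A(3) by (auto simp: disjoint_family_on_def binaryset_def)
  ultimately have "(\<lambda>i. \<nu> (binaryset A B i)) sums \<nu> (\<Union>i. binaryset A B i)"
    using s by (simp add: signed_measure_def)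
  moreover have "(\<lambda>i. \<nu> (binaryset A B i)) sums (\<nu> A + \<nu> B)"
    by (rule binaryset_sums) (use s in \<open>simp add: signed_measure_def\<close>)
  ultimately show ?thesis by (simp add: UN_binaryset_eq sums_unique2)
qed

lemma signed_measure_Diff:
  assumes s: "signed_measure \<nu>" and A: "A \<in> sets borel" "B \<in> sets borel" "B \<subseteq> A"
  shows "\<nu> (A - B) = \<nu> A - \<nu> B"
proof -
  have "(A - B) \<inter> B = {}" "(A - B) \<union> B = A" using A by auto
  then show ?thesis using signed_measure_Un[OF s, of "A - B" B] A by auto
qed

text \<open>If \<open>\<nu>\<close> were unbounded one could split off disjoint sets of measure at least 1 in absolute value
  forever.\<close>
lemma signed_measure_bdd:
  assumes s: "signed_measure \<nu>"
  shows "bdd_above (\<nu> ` sets borel)"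
proof (rule ccontr)
  assume nb: "\<not> bdd_above (\<nu> ` sets borel)"
  define bad where "bad A \<longleftrightarrow> A \<in> sets borel \<and> \<not> bdd_above (\<nu> ` {B. B \<subseteq> A \<and> B \<in> sets borel})" for A
  have step: "\<exists>A'. bad A' \<and> A' \<subseteq> A \<and> \<bar>\<nu> (A - A')\<bar> \<ge> 1" if "bad A" for A
  proof -
    have A: "A \<in> sets borel" using that by (simp add: bad_def)
    \<comment> \<open>The excess over \<open>\<bar>\<nu> A\<bar> + 1\<close> makes both halves large
      at once: \<open>\<nu> B > 1\<close> and
      \<open>\<nu> (A - B) = \<nu> A - \<nu> B < - 1\<close>. Whichever half is kept, the other has
      absolute measure at least 1.\<close>
    have "\<exists>B. B \<subseteq> A \<and> B \<in> sets borel \<and> \<nu> B > \<bar>\<nu> A\<bar> + 1"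
    proof (rule ccontr)
      assume "\<not> ?thesis"
      then have "bdd_above (\<nu> ` {B. B \<subseteq> A \<and> B \<in> sets borel})"
        by (intro bdd_aboveI2[where M="\<bar>\<nu> A\<bar> + 1"]) (metis (mono_tags) mem_Collect_eq not_le)
      then show False using \<open>bad A\<close> by (simp add: bad_def)
    qed
    then obtain B where B: "B \<subseteq> A" "B \<in> sets borel" "\<nu> B > \<bar>\<nu> A\<bar> + 1" by blast
    have d: "\<nu> (A - B) = \<nu> A - \<nu> B" by (rule signed_measure_Diff[OF s A B(2,1)])
    have "bad B \<or> bad (A - B)"
    proof (rule ccontr)
      assume "\<not> (bad B \<or> bad (A - B))"
      then have "bdd_above (\<nu> ` {C. C \<subseteq> B \<and> C \<in> sets borel})"
          "bdd_above (\<nu> ` {C. C \<subseteq> A - B \<and> C \<in> sets borel})"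
        using A B by (simp_all add: bad_def sets.Diff)
      then obtain M1 M2 where M: "\<And>C. C \<subseteq> B \<Longrightarrow> C \<in> sets borel \<Longrightarrow> \<nu> C \<le> M1"
          "\<And>C. C \<subseteq> A - B \<Longrightarrow> C \<in> sets borel \<Longrightarrow> \<nu> C \<le> M2"
        unfolding bdd_above_def by (metis (mono_tags, lifting) image_eqI mem_Collect_eq)
      have "\<nu> C \<le> M1 + M2" if "C \<subseteq> A" "C \<in> sets borel" for C
      proof -
        have "\<nu> ((C \<inter> B) \<union> (C - B)) = \<nu> (C \<inter> B) + \<nu> (C - B)"
          by (rule signed_measure_Un[OF s]) (use that B in auto)
        moreover have "(C \<inter> B) \<union> (C - B) = C" by blast
        moreover have "\<nu> (C \<inter> B) \<le> M1" by (rule M(1)) (use that B in auto)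
        moreover have "\<nu> (C - B) \<le> M2" by (rule M(2)) (use that B in auto)
        ultimately show ?thesis by simp
      qed
      then have "bdd_above (\<nu> ` {B. B \<subseteq> A \<and> B \<in> sets borel})" 
        by (intro bdd_aboveI2[where M="M1 + M2"]) simp
      then show False using \<open>bad A\<close> by (simp add: bad_def)
    qed
    \<comment> \<open>The bad half is kept and the other one is split off.\<close>
    then show ?thesis
    proof
      assume "bad B" then show ?thesis using B d by (intro exI[of _ B]) auto
    next
      assume "bad (A - B)"
      moreover have "A - (A - B) = B" using B by blast
      ultimately show ?thesis using B by (intro exI[of _ "A - B"]) auto
    qed
  qed
  define F where "F = rec_nat (UNIV::'a set) (\<lambda>_ A. SOME A'. bad A' \<and> A' \<subseteq> A \<and> \<bar>\<nu> (A - A')\<bar> \<ge> 1)"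
  have F0: "F 0 = UNIV" and FS: "F (Suc n) = (SOME A'. bad A' \<and> A' \<subseteq> F n \<and> \<bar>\<nu> (F n - A')\<bar> \<ge> 1)" for n
    by (simp_all add: F_def)
  have "bad UNIV"
  proof -
    have "{B. B \<subseteq> UNIV \<and> B \<in> sets (borel::'a measure)} = sets borel" by auto
    then show ?thesis using nb unfolding bad_def by simp
  qed
  have badF: "bad (F n)" for n
  proof (induction n)
    case 0 then show ?case using \<open>bad UNIV\<close> F0 by simp
  next
    case (Suc n) then show ?case unfolding FS using someI_ex[OF step[OF Suc]] by blast
  qed
  have sub: "F (Suc n) \<subseteq> F n" and ge: "\<bar>\<nu> (F n - F (Suc n))\<bar> \<ge> 1" for n
    unfolding FS using someI_ex[OF step[OF badF[of n]]] by blast+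
  have mono: "m \<le> n \<Longrightarrow> F n \<subseteq> F m" for m n using sub by (rule lift_Suc_antimono_le)
  define D where "D n = F n - F (Suc n)" for n
  have "disjoint_family D"
  proof -
    have "D m \<inter> D n = {}" if "m < n" for m n
    proof -
      have "F n \<subseteq> F (Suc m)" using that by (intro mono) simp
      then show ?thesis unfolding D_def by blast
    qed
    then show ?thesis unfolding disjoint_family_on_def by (metis Int_commute nat_neq_iff)
  qed
  moreover have "range D \<subseteq> sets borel" using badF unfolding D_def bad_def by auto
  \<comment> \<open>The terms of a convergent series tend to 0, whereas every
    \<open>\<nu> (D i)\<close> has absolute value at least 1.\<close>
  ultimately have "(\<lambda>i. \<nu> (D i)) sums \<nu> (\<Union>i. D i)" using s by (simp add: signed_measure_def)
  then have "(\<lambda>i. \<nu> (D i)) \<longlonglongrightarrow> 0" by (intro summable_LIMSEQ_zero sums_summable)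
  then obtain n where "\<bar>\<nu> (D n)\<bar> < 1" 
    by (metis (mono_tags, lifting) LIMSEQ_iff diff_zero le_refl real_norm_def zero_less_one)
  then show False using ge[of n] by (simp add: D_def)
qed

text \<open>Boundedness enters here: without it the real supremum in \<open>pos_var\<close> would
  carry no information.\<close>

lemma pos_var_upper:
  assumes s: "signed_measure \<nu>" and B: "B \<in> sets borel" "B \<subseteq> A"
  shows "\<nu> B \<le> pos_var \<nu> A"
  unfolding pos_var_def
proof (rule cSUP_upper)
  show "bdd_above (\<nu> ` {B. B \<subseteq> A \<and> B \<in> sets borel})"
    by (rule bdd_above_mono[OF signed_measure_bdd[OF s]]) auto
qed (use B in auto)

lemma pos_var_least:
  assumes "\<And>B. B \<in> sets borel \<Longrightarrow> B \<subseteq> A \<Longrightarrow> \<nu> B \<le> c"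
  shows "pos_var \<nu> A \<le> c"
  unfolding pos_var_def
proof (rule cSUP_least)
  show "{B. B \<subseteq> A \<and> B \<in> sets borel} \<noteq> {}" by (auto intro: exI[of _ "{}"])
qed (use assms in auto)

lemma pos_var_nonneg: "signed_measure \<nu> \<Longrightarrow> 0 \<le> pos_var \<nu> A"
  using pos_var_upper[of \<nu> "{}" A] by (auto simp: signed_measure_def)

lemma pos_var_mono: "signed_measure \<nu> \<Longrightarrow> A \<subseteq> B \<Longrightarrow> pos_var \<nu> A \<le> pos_var \<nu> B"
  by (rule pos_var_least) (auto intro: pos_var_upper)

text \<open>Competitors for \<open>A\<close> and \<open>B\<close> are disjoint, so their union
  competes for \<open>A \<union> B\<close>. Only the competitors have to be Borel.\<close>

lemma pos_var_Un_ge: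
  assumes s: "signed_measure \<nu>" and AB: "A \<inter> B = {}"
  shows "pos_var \<nu> A + pos_var \<nu> B \<le> pos_var \<nu> (A \<union> B)"
proof -
  have "pos_var \<nu> A \<le> pos_var \<nu> (A \<union> B) - pos_var \<nu> B"
  proof (rule pos_var_least)
    fix C assume C: "C \<in> sets borel" "C \<subseteq> A"
    have "pos_var \<nu> B \<le> pos_var \<nu> (A \<union> B) - \<nu> C"
    proof (rule pos_var_least)
      fix D assume D: "D \<in> sets borel" "D \<subseteq> B"
      have "\<nu> (C \<union> D) \<le> pos_var \<nu> (A \<union> B)" using s C D by (intro pos_var_upper) auto
      moreover have "\<nu> (C \<union> D) = \<nu> C + \<nu> D"
        by (rule signed_measure_Un[OF s]) (use C D AB in auto)
      ultimately show "\<nu> D \<le> pos_var \<nu> (A \<union> B) - \<nu> C" by simp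
    qed
    then show "\<nu> C \<le> pos_var \<nu> (A \<union> B) - pos_var \<nu> B" by simp
  qed
  then show ?thesis by simp
qed

text \<open>One inequality is finite superadditivity passed to the limit. For the other, a Borel
  subset of the union is cut by the \<open>A i\<close> and countable additivity of
  \<open>\<nu>\<close> is applied to the pieces.\<close>

lemma pos_var_sums:
  assumes s: "signed_measure \<nu>" and A: "range A \<subseteq> sets borel" "disjoint_family A"
  shows "(\<lambda>i. pos_var \<nu> (A i)) sums pos_var \<nu> (\<Union>i. A i)"
proof -
  have fin: "(\<Sum>i<n. pos_var \<nu> (A i)) \<le> pos_var \<nu> (\<Union>i<n. A i)" for n :: nat
  proof (induction n)
    case 0 show ?case using pos_var_nonneg[OF s] by simp
  next
    case (Suc n)
    have "(\<Union>i<n. A i) \<inter> A n = {}" 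
    proof -
      have "A i \<inter> A n = {}" if "i < n" for i using A(2) that by (simp add: disjoint_family_on_def)
      then show ?thesis by blast
    qed
    then show ?case using Suc pos_var_Un_ge[OF s, of "\<Union>i<n. A i" "A n"]
      by (simp add: lessThan_Suc Un_commute)
  qed
  have le: "(\<Sum>i<n. pos_var \<nu> (A i)) \<le> pos_var \<nu> (\<Union>i. A i)" for n :: nat
    using fin[of n] pos_var_mono[OF s, of "\<Union>i<n. A i" "\<Union>i. A i"]
    by (meson UN_mono order_trans subset_UNIV subset_refl)
  have sm: "summable (\<lambda>i. pos_var \<nu> (A i))"
    by (rule summableI_nonneg_bounded[OF pos_var_nonneg[OF s] le])
  have "pos_var \<nu> (\<Union>i. A i) \<le> (\<Sum>i. pos_var \<nu> (A i))"
  proof (rule pos_var_least)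
    fix B assume B: "B \<in> sets borel" "B \<subseteq> (\<Union>i. A i)"
    have "(\<lambda>i. \<nu> (B \<inter> A i)) sums \<nu> (\<Union>i. B \<inter> A i)"
    proof -
      have "range (\<lambda>i. B \<inter> A i) \<subseteq> sets borel" using A B by auto
      moreover have "disjoint_family (\<lambda>i. B \<inter> A i)" using A(2) by (auto simp: disjoint_family_on_def)
      ultimately show ?thesis by (rule signed_measure_sums[OF s])
    qed
    moreover have "(\<Union>i. B \<inter> A i) = B" using B by auto
    ultimately have "(\<lambda>i. \<nu> (B \<inter> A i)) sums \<nu> B" by simp
    then show "\<nu> B \<le> (\<Sum>i. pos_var \<nu> (A i))"
      by (rule sums_le[rotated, OF _ summable_sums[OF sm]])
         (use A B in \<open>auto intro!: pos_var_upper[OF s]\<close>)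
  qed
  moreover have "(\<Sum>i. pos_var \<nu> (A i)) \<le> pos_var \<nu> (\<Union>i. A i)" by (rule suminf_le_const[OF sm le])
  ultimately have "(\<Sum>i. pos_var \<nu> (A i)) = pos_var \<nu> (\<Union>i. A i)" by simp
  then show ?thesis using summable_sums[OF sm] by metis
qed

text \<open>For Borel \<open>B \<subseteq> A\<close> one has
  \<open>\<nu> B = \<nu> A - \<nu> (A - B)\<close>. A supremum over \<open>B\<close> gives one
  inequality, and the same argument for \<open>- \<nu>\<close> gives the other. This justifies the
  decomposition that \<open>cint\<close> integrates.\<close>

lemma pos_var_diff:
  assumes s: "signed_measure \<nu>" and A: "A \<in> sets borel"
  shows "pos_var \<nu> A - pos_var (\<lambda>B. - \<nu> B) A = \<nu> A"
proof -
  have *: "pos_var \<nu> A \<le> \<nu> A + pos_var (\<lambda>B. - \<nu> B) A" if s: "signed_measure \<nu>" for \<nu>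
  proof (rule pos_var_least)
    fix B assume B: "B \<in> sets borel" "B \<subseteq> A"
    have "- \<nu> (A - B) \<le> pos_var (\<lambda>B. - \<nu> B) A"
      by (rule pos_var_upper[OF signed_measure_uminus[OF s], of "A - B"]) (use A B in auto)
    then show "\<nu> B \<le> \<nu> A + pos_var (\<lambda>B. - \<nu> B) A" using signed_measure_Diff[OF s A B] by simp
  qed
  show ?thesis using *[OF s] *[OF signed_measure_uminus[OF s]] by simp
qed

lemma sets_pos_meas [simp, measurable_cong]: "sets (pos_meas \<nu>) = sets borel"
  and space_pos_meas [simp]: "space (pos_meas \<nu>) = UNIV"
  unfolding pos_meas_def
  using sets.sigma_sets_eq[of "borel::'a measure"] by (simp_all add: sets_measure_of_conv space_measure_of_conv)

text \<open>\<open>measure_of\<close> silently returns the zero measure unless the given set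
  function is a measure, so positivity and countable additivity are verified here once.\<close>

lemma emeasure_pos_meas:
  assumes s: "signed_measure \<nu>" and A: "A \<in> sets borel"
  shows "emeasure (pos_meas \<nu>) A = ennreal (pos_var \<nu> A)"
proof (rule emeasure_measure_of[OF pos_meas_def])
  show "positive (sets (pos_meas \<nu>)) (\<lambda>A. ennreal (pos_var \<nu> A))"
    using pos_var_least[of "{}" \<nu> 0] s by (auto simp: positive_def signed_measure_def ennreal_eq_0_iff)
  show "countably_additive (sets (pos_meas \<nu>)) (\<lambda>A. ennreal (pos_var \<nu> A))"
    unfolding countably_additive_def
  proof (intro allI impI)
    fix A :: "nat \<Rightarrow> 'a set"
    assume "range A \<subseteq> sets (pos_meas \<nu>)" "disjoint_family A"
    then have "(\<lambda>i. pos_var \<nu> (A i)) sums pos_var \<nu> (\<Union>i. A i)" using pos_var_sums[OF s] by simp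
    then show "(\<Sum>i. ennreal (pos_var \<nu> (A i))) = ennreal (pos_var \<nu> (\<Union>i. A i))"
      using suminf_ennreal_eq[OF pos_var_nonneg[OF s]] by blast
  qed
qed (use A in auto)

lemma finite_pos_meas:
  assumes "signed_measure \<nu>" shows "finite_measure (pos_meas \<nu>)"
  by (rule finite_measureI) (simp add: emeasure_pos_meas[OF assms])

lemma measure_pos_meas:
  "signed_measure \<nu> \<Longrightarrow> A \<in> sets borel \<Longrightarrow> measure (pos_meas \<nu>) A = pos_var \<nu> A"
  by (simp add: measure_def emeasure_pos_meas pos_var_nonneg)

section \<open>Sums of measures and Radon measures\<close>

definition add_measure :: "'x::topological_space measure \<Rightarrow> 'x measure \<Rightarrow> 'x measure" where
  "add_measure M N = measure_of UNIV (sets borel) (\<lambda>A. emeasure M A + emeasure N A)"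

lemma sets_add_measure [simp, measurable_cong]: "sets (add_measure M N) = sets borel"
  and space_add_measure [simp]: "space (add_measure M N) = UNIV"
  unfolding add_measure_def
  using sets.sigma_sets_eq[of "borel::'a measure"] by (simp_all add: sets_measure_of_conv space_measure_of_conv)

lemma emeasure_add_measure:
  assumes M: "sets M = sets borel" and N: "sets N = sets borel" and A: "A \<in> sets borel"
  shows "emeasure (add_measure M N) A = emeasure M A + emeasure N A"
proof (rule emeasure_measure_of[OF add_measure_def])
  show "countably_additive (sets (add_measure M N)) (\<lambda>A. emeasure M A + emeasure N A)"
    unfolding countably_additive_def
  proof (intro allI impI)
    fix A :: "nat \<Rightarrow> 'a set"
    assume "range A \<subseteq> sets (add_measure M N)" "disjoint_family A"
    then show "(\<Sum>i. emeasure M (A i) + emeasure N (A i)) = emeasure M (\<Union>i. A i) + emeasure N (\<Union>i. A i)"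
      using M N by (subst suminf_add[symmetric]) (auto simp: suminf_emeasure)
  qed
qed (use A in \<open>auto simp: positive_def\<close>)

lemma nn_integral_add_measure:
  assumes M: "sets M = sets borel" and N: "sets N = sets borel" and f: "f \<in> borel_measurable borel"
  shows "(\<integral>\<^sup>+x. f x \<partial>add_measure M N) = (\<integral>\<^sup>+x. f x \<partial>M) + (\<integral>\<^sup>+x. f x \<partial>N)"
  using f
proof (induction rule: borel_measurable_induct)
  case (cong f g)
  then have "f = g" by auto
  then show ?case using cong by simp
next
  case (set A)
  then show ?case using emeasure_add_measure[OF M N] M N by simp
next
  case (mult u c)
  note [measurable_cong] = M N
  have [measurable]: "u \<in> borel_measurable borel" by fact
  show ?case using mult by (simp add: nn_integral_cmult distrib_left)
next
  case (add u v)
  note [measurable_cong] = M N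
  have [measurable]: "u \<in> borel_measurable borel" "v \<in> borel_measurable borel" by fact+
  show ?case using add by (simp add: nn_integral_add ac_simps)
next
  case (seq U)
  note [measurable_cong] = M N
  have [measurable]: "U i \<in> borel_measurable borel" for i by fact
  have S: "(SUP i. U i) = (\<lambda>x. SUP i. U i x)" by (auto simp: image_comp)
  have inc: "incseq U" by fact
  have i: "incseq (\<lambda>i. \<integral>\<^sup>+x. U i x \<partial>K)" for K
    using inc by (auto simp: incseq_def le_fun_def intro!: nn_integral_mono)
  have IH: "(\<integral>\<^sup>+x. U i x \<partial>add_measure M N) = (\<integral>\<^sup>+x. U i x \<partial>M) + (\<integral>\<^sup>+x. U i x \<partial>N)" for i
    by fact
  show ?case unfolding S
    using inc by (simp add: nn_integral_monotone_convergence_SUP IH ennreal_SUP_add[OF i i])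
qed

text \<open>For a finite measure this single sandwich contains inner regularity by compact sets and
  outer regularity by open sets. It passes to sums by uniting the compact sets and intersecting the
  open ones.\<close>

definition radon :: "'x::topological_space measure \<Rightarrow> bool" where
  "radon N \<longleftrightarrow> sets N = sets borel \<and> finite_measure N \<and>
     (\<forall>A\<in>sets borel. \<forall>e>0. \<exists>K V. compact K \<and> open V \<and> K \<subseteq> A \<and> A \<subseteq> V \<and> measure N (V - K) < e)"

lemma radonE:
  assumes "radon N" "A \<in> sets borel" "e > 0"
  obtains K V where "compact K" "open V" "K \<subseteq> A" "A \<subseteq> V" "measure N (V - K) < e"
  using assms unfolding radon_def by meson

lemma borel_compact_t2: "compact (K :: 'x::t2_space set) \<Longrightarrow> K \<in> sets borel"
  by (simp add: compact_imp_closed)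

lemma finite_add_measure:
  assumes "finite_measure M" "finite_measure N" "sets M = sets borel" "sets N = sets borel"
  shows "finite_measure (add_measure M N)"
proof (rule finite_measureI)
  have "emeasure M UNIV \<noteq> \<infinity>" "emeasure N UNIV \<noteq> \<infinity>"
    using assms(1,2) by (simp_all add: finite_measure.emeasure_finite)
  then show "emeasure (add_measure M N) (space (add_measure M N)) \<noteq> \<infinity>"
    using emeasure_add_measure[OF assms(3,4), of UNIV] by simp
qed

lemma measure_add_measure:
  assumes "finite_measure M" "finite_measure N" "sets M = sets borel" "sets N = sets borel" "A \<in> sets borel"
  shows "measure (add_measure M N) A = measure M A + measure N A"
  using emeasure_add_measure[OF assms(3-5)] assms
  by (simp add: measure_def finite_measure.emeasure_finite enn2real_plus less_top[symmetric])

lemma integral_add_measure: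
  fixes f :: "'x::topological_space \<Rightarrow> real"
  assumes M: "finite_measure M" "sets M = sets borel" and N: "finite_measure N" "sets N = sets borel"
    and f: "f \<in> bounded_borel" and nn: "\<And>x. 0 \<le> f x"
  shows "(\<integral>x. f x \<partial>add_measure M N) = (\<integral>x. f x \<partial>M) + (\<integral>x. f x \<partial>N)"
proof -
  have fm: "f \<in> borel_measurable borel" using f by (simp add: bounded_borel_def)
  have i: "(\<integral>\<^sup>+x. ennreal (f x) \<partial>K) = ennreal (\<integral>x. f x \<partial>K)"
    if "finite_measure K" "sets K = sets borel" for K
    by (rule nn_integral_eq_integral[OF bounded_borel_integrable[OF f that]]) (use nn in auto)
  have "ennreal (\<integral>x. f x \<partial>add_measure M N) = ennreal (\<integral>x. f x \<partial>M) + ennreal (\<integral>x. f x \<partial>N)"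
    using nn_integral_add_measure[OF M(2) N(2), of "\<lambda>x. ennreal (f x)"] fm
      i[OF M] i[OF N] i[OF finite_add_measure[OF M(1) N(1) M(2) N(2)]] by simp
  then show ?thesis
    by (simp add: nn integral_nonneg flip: ennreal_plus)
qed

lemma radon_add_measure:
  fixes M N :: "'x::t2_space measure"
  assumes M: "radon M" and N: "radon N"
  shows "radon (add_measure M N)"
proof -
  have f: "finite_measure M" "sets M = sets borel" "finite_measure N" "sets N = sets borel"
    using assms by (simp_all add: radon_def)
  interpret M: finite_measure M by fact
  interpret N: finite_measure N by fact
  have "\<exists>K V. compact K \<and> open V \<and> K \<subseteq> A \<and> A \<subseteq> V \<and> measure (add_measure M N) (V - K) < e"
    if A: "A \<in> sets borel" and e: "e > 0" for A e
  proof -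
    obtain K V where K: "compact K" "open V" "K \<subseteq> A" "A \<subseteq> V" "measure M (V - K) < e/2"
      using radonE[OF M A, of "e/2"] e by auto
    obtain K' V' where K': "compact K'" "open V'" "K' \<subseteq> A" "A \<subseteq> V'" "measure N (V' - K') < e/2"
      using radonE[OF N A, of "e/2"] e by auto
    have s: "K \<in> sets borel" "K' \<in> sets borel" "V \<in> sets borel" "V' \<in> sets borel"
      using K K' by (auto intro: borel_compact_t2)
    have "measure M (V \<inter> V' - (K \<union> K')) \<le> measure M (V - K)"
      by (rule M.finite_measure_mono) (use s f in auto)
    moreover have "measure N (V \<inter> V' - (K \<union> K')) \<le> measure N (V' - K')"
      by (rule N.finite_measure_mono) (use s f in auto)
    ultimately have "measure (add_measure M N) (V \<inter> V' - (K \<union> K')) < e"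
      using K K' s f by (subst measure_add_measure) auto
    then show ?thesis
      by (intro exI[of _ "K \<union> K'"] exI[of _ "V \<inter> V'"]) (use K K' in auto)
  qed
  then show ?thesis using f by (auto simp: radon_def finite_add_measure)
qed

text \<open>Domination by a Radon measure encodes countable additivity and regularity of \<open>A \<mapsto> L (indicator A)\<close>
  at once.\<close>
definition dominated :: "(('x::topological_space \<Rightarrow> complex) \<Rightarrow> complex) \<Rightarrow> 'x measure \<Rightarrow> bool" where
  "dominated L N \<longleftrightarrow> linear_on_bb L \<and> radon N \<and>
     (\<forall>f\<in>bounded_borel. cmod (L f) \<le> (\<integral>x. cmod (f x) \<partial>N))"

lemma dominatedD:
  assumes "dominated L N"
  shows "linear_on_bb L" "radon N" "sets N = sets borel" "finite_measure N"
    "f \<in> bounded_borel \<Longrightarrow> cmod (L f) \<le> (\<integral>x. cmod (f x) \<partial>N)"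
  using assms by (auto simp: dominated_def radon_def)

lemma bounded_borel_cmod:
  fixes f :: "'x::topological_space \<Rightarrow> 'b::real_normed_vector"
  shows "f \<in> bounded_borel \<Longrightarrow> (\<lambda>x. norm (f x)) \<in> bounded_borel"
  by (rule bounded_borel_continuous_comp[where K=1]) (auto intro: continuous_intros)

lemma dominated_bound:
  assumes d: "dominated L N" and f: "f \<in> bounded_borel" and B: "\<And>x. cmod (f x) \<le> B"
  shows "cmod (L f) \<le> measure N UNIV * B"
proof -
  interpret finite_measure N by (rule dominatedD[OF d])
  have sp: "space N = UNIV" using dominatedD(3)[OF d] sets_eq_imp_space_eq by fastforce
  have "(\<integral>x. cmod (f x) \<partial>N) \<le> (\<integral>x. B \<partial>N)"
    by (rule integral_mono[OF bounded_borel_integrable[OF bounded_borel_cmod[OF f]]])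
       (use B dominatedD[OF d] in auto)
  then show ?thesis using dominatedD(5)[OF d f] sp by simp
qed

lemma dominated_indicator:
  assumes d: "dominated L N" and A: "A \<in> sets borel"
  shows "cmod (L (indicator A)) \<le> measure N A"
proof -
  have "(\<lambda>x. cmod (indicator A x)) = indicat_real A" by (auto simp: indicator_def)
  moreover have "A \<inter> space N = A" "A \<in> sets N"
    using dominatedD(3)[OF d] A sets_eq_imp_space_eq[of N borel] by auto
  ultimately show ?thesis using dominatedD(5)[OF d bounded_borel_indicator[OF A]] by simp
qed

text \<open>The error after \<open>n\<close> terms is \<open>L\<close> at the indicator of the tail,
  and the dominating finite measure of the tail decreases to 0.\<close>

lemma dominated_complex_measure:
  assumes d: "dominated L N"
  shows "complex_measure (\<lambda>A. L (indicator A))"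
  unfolding complex_measure_def
proof (intro conjI allI impI)
  note N = dominatedD[OF d]
  interpret finite_measure N by (rule N)
  show "L (indicator {}) = 0" using dominated_indicator[OF d, of "{}"] by simp
  fix A :: "nat \<Rightarrow> 'a set" assume A: "range A \<subseteq> sets borel" "disjoint_family A"
  have Am: "A i \<in> sets borel" for i using A by auto
  have part: "L (indicator (\<Union>i. A i)) - (\<Sum>i<n. L (indicator (A i))) = L (indicator ((\<Union>i. A i) - (\<Union>i<n. A i)))" for n
  proof -
    have "(\<Sum>i<n. L (indicator (A i))) = L (\<lambda>x. \<Sum>i<n. indicator (A i) x)"
      by (rule linear_on_bb_sum[OF N(1), symmetric]) (auto intro!: bounded_borel_indicator Am)
    also have "(\<lambda>x. \<Sum>i<n. indicator (A i) x :: complex) = indicator (\<Union>i<n. A i)"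
      using A(2) by (intro ext indicator_UN_disjoint[symmetric]) (auto simp: disjoint_family_on_def)
    finally have "L (indicator (\<Union>i. A i)) - (\<Sum>i<n. L (indicator (A i))) =
       L (\<lambda>x. indicator (\<Union>i. A i) x - indicator (\<Union>i<n. A i) x)"
      by (subst linear_on_bb_diff[OF N(1)]) (auto intro!: bounded_borel_indicator Am)
    also have "(\<lambda>x. indicator (\<Union>i. A i) x - indicator (\<Union>i<n. A i) x :: complex) =
       indicator ((\<Union>i. A i) - (\<Union>i<n. A i))"
      by (auto simp: indicator_def fun_eq_iff)
    finally show ?thesis .
  qed
  have "(\<lambda>n. measure N ((\<Union>i. A i) - (\<Union>i<n. A i))) \<longlonglongrightarrow> measure N (\<Inter>n. (\<Union>i. A i) - (\<Union>i<n. A i))"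
  proof (rule finite_Lim_measure_decseq)
    show "range (\<lambda>n. (\<Union>i. A i) - (\<Union>i<n. A i)) \<subseteq> sets N" using Am N by auto
    show "decseq (\<lambda>n. (\<Union>i. A i) - (\<Union>i<n. A i))" unfolding decseq_def by force
  qed
  moreover have E: "(\<Inter>n. (\<Union>i. A i) - (\<Union>i<n. A i)) = {}" by auto
  ultimately have lim: "(\<lambda>n. measure N ((\<Union>i. A i) - (\<Union>i<n. A i))) \<longlonglongrightarrow> 0"
    unfolding E by simp
  have "(\<lambda>n. L (indicator (\<Union>i. A i)) - (\<Sum>i<n. L (indicator (A i)))) \<longlonglongrightarrow> 0"
    by (rule Lim_null_comparison[OF always_eventually lim])
       (auto simp: part intro!: dominated_indicator[OF d] Am)
  then have "(\<lambda>n. (\<Sum>i<n. L (indicator (A i)))) \<longlonglongrightarrow> L (indicator (\<Union>i. A i))"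
    using tendsto_diff[OF tendsto_const[of "L (indicator (\<Union>i. A i))"]] by force
  then show "(\<lambda>i. L (indicator (A i))) sums L (indicator (\<Union>i. A i))" by (simp add: sums_def)
qed

text \<open>The sum of the four measures that \<open>cint\<close> integrates against. It takes the
  place of the total variation measure: it dominates the complex measure, and it is small on sets
  all of whose Borel subsets have small measure.\<close>

definition jordan_sum :: "('x::topological_space set \<Rightarrow> complex) \<Rightarrow> 'x measure" where
  "jordan_sum \<mu> = add_measure
     (add_measure (pos_meas (\<lambda>A. Re (\<mu> A))) (pos_meas (\<lambda>A. - Re (\<mu> A))))
     (add_measure (pos_meas (\<lambda>A. Im (\<mu> A))) (pos_meas (\<lambda>A. - Im (\<mu> A))))"

lemma sets_jordan_sum [simp]: "sets (jordan_sum \<mu>) = sets borel"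
  and space_jordan_sum [simp]: "space (jordan_sum \<mu>) = UNIV"
  by (simp_all add: jordan_sum_def)

section \<open>Integrals against a complex measure\<close>

context
  fixes \<mu> :: "'x::topological_space set \<Rightarrow> complex"
  assumes cm: "complex_measure \<mu>"
begin

lemma signed_parts:
  "signed_measure (\<lambda>A. Re (\<mu> A))" "signed_measure (\<lambda>A. - Re (\<mu> A))"
  "signed_measure (\<lambda>A. Im (\<mu> A))" "signed_measure (\<lambda>A. - Im (\<mu> A))"
  using signed_measure_Re[OF cm] signed_measure_Im[OF cm] signed_measure_uminus by blast+

lemma finite_jordan_sum: "finite_measure (jordan_sum \<mu>)"
  unfolding jordan_sum_def by (intro finite_add_measure finite_pos_meas signed_parts) simp_all

lemma linear_cint: "linear_on_bb (cint \<mu>)"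
proof -
  note i = bounded_borel_integrable[OF _ finite_pos_meas sets_pos_meas]
  show ?thesis
    unfolding linear_on_bb_def cint_def
    by (simp add: Bochner_Integration.integral_add i signed_parts algebra_simps)
qed

lemma cint_indicator:
  assumes "A \<in> sets borel" shows "cint \<mu> (indicator A) = \<mu> A"
proof -
  have "(LINT x|pos_meas \<nu>. indicator A x :: complex) = complex_of_real (pos_var \<nu> A)"
    if "signed_measure \<nu>" for \<nu>
  proof -
    interpret finite_measure "pos_meas \<nu>" by (rule finite_pos_meas[OF that])
    have "(LINT x|pos_meas \<nu>. complex_of_real (indicator A x)) = complex_of_real (measure (pos_meas \<nu>) A)"
      using assms by (subst integral_complex_of_real) simp
    moreover have "(\<lambda>x. complex_of_real (indicator A x)) = indicator A" by (auto simp: indicator_def)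
    ultimately show ?thesis using assms by (simp add: measure_pos_meas[OF that])
  qed
  then have "cint \<mu> (indicator A) =
     complex_of_real (pos_var (\<lambda>A. Re (\<mu> A)) A - pos_var (\<lambda>A. - Re (\<mu> A)) A) +
     \<i> * complex_of_real (pos_var (\<lambda>A. Im (\<mu> A)) A - pos_var (\<lambda>A. - Im (\<mu> A)) A)"
    unfolding cint_def by (simp add: signed_parts)
  also have "\<dots> = \<mu> A"
    using pos_var_diff[OF signed_parts(1) assms] pos_var_diff[OF signed_parts(3) assms]
    by (simp add: complex_eq_iff)
  finally show ?thesis .
qed

lemma cmod_cint_le:
  assumes g: "g \<in> bounded_borel"
  shows "cmod (cint \<mu> g) \<le> (\<integral>x. cmod (g x) \<partial>jordan_sum \<mu>)"
proof -
  let ?I = "\<lambda>\<nu>. \<integral>x. cmod (g x) \<partial>pos_meas \<nu>"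
  have *: "cmod (LINT x|M. g x) \<le> (\<integral>x. cmod (g x) \<partial>M)" for M by (rule integral_norm_bound)
  have "cmod (cint \<mu> g) \<le>
    (cmod (LINT x|pos_meas (\<lambda>A. Re (\<mu> A)). g x) + cmod (LINT x|pos_meas (\<lambda>A. - Re (\<mu> A)). g x)) +
    (cmod (LINT x|pos_meas (\<lambda>A. Im (\<mu> A)). g x) + cmod (LINT x|pos_meas (\<lambda>A. - Im (\<mu> A)). g x))"
    unfolding cint_def
    by (intro norm_triangle_le add_mono norm_triangle_ineq4) (simp add: norm_mult norm_triangle_ineq4)
  also have "\<dots> \<le> (?I (\<lambda>A. Re (\<mu> A)) + ?I (\<lambda>A. - Re (\<mu> A))) + (?I (\<lambda>A. Im (\<mu> A)) + ?I (\<lambda>A. - Im (\<mu> A)))"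
    by (intro add_mono *)
  also have "\<dots> = (\<integral>x. cmod (g x) \<partial>jordan_sum \<mu>)"
    unfolding jordan_sum_def
    by (simp add: integral_add_measure finite_add_measure finite_pos_meas signed_parts bounded_borel_cmod[OF g])
  finally show ?thesis .
qed

lemma cmod_cint_bound:
  assumes g: "g \<in> bounded_borel" and B: "\<And>x. cmod (g x) \<le> B"
  shows "cmod (cint \<mu> g) \<le> measure (jordan_sum \<mu>) UNIV * B"
proof -
  interpret finite_measure "jordan_sum \<mu>" by (rule finite_jordan_sum)
  have "(\<integral>x. cmod (g x) \<partial>jordan_sum \<mu>) \<le> (\<integral>x. B \<partial>jordan_sum \<mu>)"
    by (rule integral_mono[OF bounded_borel_integrable[OF bounded_borel_cmod[OF g] finite_jordan_sum]])
       (use B in auto)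
  then show ?thesis using cmod_cint_le[OF g] by simp
qed

lemma cmod_le_jordan_sum: "A \<in> sets borel \<Longrightarrow> cmod (\<mu> A) \<le> measure (jordan_sum \<mu>) A"
proof -
  assume A: "A \<in> sets borel"
  have "(\<lambda>x. cmod (indicator A x)) = indicat_real A" by (auto simp: indicator_def)
  then show ?thesis using cmod_cint_le[OF bounded_borel_indicator[OF A]] A by (simp add: cint_indicator)
qed

text \<open>The difference is linear, bounded and 0 on indicators, so it vanishes. Identities for
  \<open>cint\<close> can thus be proved without touching Jordan parts.\<close>

lemma cint_unique:
  assumes L: "linear_on_bb L"
    and C: "\<And>f B. f \<in> bounded_borel \<Longrightarrow> (\<And>x. cmod (f x) \<le> B) \<Longrightarrow> cmod (L f) \<le> C * B"
    and ind: "\<And>A. A \<in> sets borel \<Longrightarrow> L (indicator A) = \<mu> A"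
    and g: "g \<in> bounded_borel"
  shows "cint \<mu> g = L g"
proof -
  have "(\<lambda>f. cint \<mu> f - L f) g = 0"
  proof (rule linear_on_bb_eq_0[OF _ _ _ g])
    show "linear_on_bb (\<lambda>f. cint \<mu> f - L f)"
      using L linear_cint by (simp add: linear_on_bb_def algebra_simps)
    show "cmod (cint \<mu> f - L f) \<le> (measure (jordan_sum \<mu>) UNIV + C) * B"
      if "f \<in> bounded_borel" "\<And>x. cmod (f x) \<le> B" for f B
      using C[OF that] cmod_cint_bound[OF that] norm_triangle_ineq4[of "cint \<mu> f" "L f"]
      by (simp add: distrib_right)
  qed (simp add: ind cint_indicator)
  then show ?thesis by simp
qed

end

section \<open>Total variation and regularity\<close>

lemma tvar_upper:
  assumes "range P \<subseteq> sets borel" "disjoint_family P" "(\<Union>i. P i) = A"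
  shows "(\<Sum>i. ennreal (cmod (\<mu> (P i)))) \<le> tvar \<mu> A"
  unfolding tvar_def by (rule SUP_upper) (use assms in auto)

lemma tvar_least:
  assumes "\<And>P. range P \<subseteq> sets borel \<Longrightarrow> disjoint_family P \<Longrightarrow> (\<Union>i. P i) = A \<Longrightarrow>
     (\<Sum>i. ennreal (cmod (\<mu> (P i)))) \<le> c"
  shows "tvar \<mu> A \<le> c"
  unfolding tvar_def by (rule SUP_least) (use assms in auto)

lemma tvar_le_measure:
  assumes N: "sets N = sets borel" "finite_measure N"
    and le: "\<And>A. A \<in> sets borel \<Longrightarrow> cmod (\<mu> A) \<le> measure N A"
  shows "tvar \<mu> A \<le> ennreal (measure N A)"
proof (rule tvar_least)
  interpret finite_measure N by fact
  fix P :: "nat \<Rightarrow> 'a set" assume P: "range P \<subseteq> sets borel" "disjoint_family P" "(\<Union>i. P i) = A"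
  have "(\<Sum>i. ennreal (cmod (\<mu> (P i)))) \<le> (\<Sum>i. emeasure N (P i))"
    using P(1) le by (intro suminf_le) (auto simp: emeasure_eq_measure ennreal_leI)
  also have "\<dots> = emeasure N A" using P N by (subst suminf_emeasure) auto
  finally show "(\<Sum>i. ennreal (cmod (\<mu> (P i)))) \<le> ennreal (measure N A)"
    by (simp add: emeasure_eq_measure)
qed

text \<open>A partition of \<open>A\<close>, together with \<open>B\<close> and
  \<open>V - A - B\<close>, is a partition of \<open>V\<close>. The lemma serves to bound
  \<open>\<mu>\<close> on subsets of \<open>V - A\<close> by the excess of total variation.\<close>

lemma cmod_plus_tvar_le:
  assumes B: "B \<in> sets borel" "B \<subseteq> V - A" and A: "A \<in> sets borel" "V \<in> sets borel" "A \<subseteq> V"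
  shows "ennreal (cmod (\<mu> B)) + tvar \<mu> A \<le> tvar \<mu> V"
proof -
  have *: "(\<Sum>i. ennreal (cmod (\<mu> (P i)))) + ennreal (cmod (\<mu> B)) \<le> tvar \<mu> V"
    if P: "range P \<subseteq> sets borel" "disjoint_family P" "(\<Union>i. P i) = A" for P :: "nat \<Rightarrow> 'a set"
  proof -
    \<comment> \<open>The two new pieces occupy the indices 0 and 1, and \<open>P\<close> is shifted
      by 2.\<close>
    define Q where "Q n = (case n of 0 \<Rightarrow> B | Suc m \<Rightarrow> (case m of 0 \<Rightarrow> V - A - B | Suc k \<Rightarrow> P k))" for n
    have Q [simp]: "Q 0 = B" "Q (Suc 0) = V - A - B" "Q (Suc (Suc k)) = P k" for k
      by (simp_all add: Q_def)
    have Pk: "P k \<subseteq> A" for k using P(3) by auto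
    have "range Q \<subseteq> sets borel"
      using P(1) A B by (auto simp: Q_def split: nat.splits)
    moreover have "disjoint_family Q"
    proof -
      have "Q m \<inter> Q n = {}" if "m < n" for m n
      proof (cases "m = 0 \<or> m = 1")
        case True
        then show ?thesis using that B Pk by (auto simp: Q_def split: nat.splits)
      next
        case False
        define k l where "k = m - 2" and "l = n - 2"
        have "m = Suc (Suc k)" "n = Suc (Suc l)" "k < l"
          using that False unfolding k_def l_def by auto
        then show ?thesis using P(2) by (simp add: disjoint_family_on_def)
      qed
      then show ?thesis unfolding disjoint_family_on_def by (metis Int_commute nat_neq_iff)
    qed
    moreover have "(\<Union>i. Q i) = V"
    proof -
      have split0: "(\<Union>i. R i) = R 0 \<union> (\<Union>k. R (Suc k))" for R :: "nat \<Rightarrow> 'a set"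
        by (auto; metis not0_implies_Suc)
      have "(\<Union>i. Q i) = Q 0 \<union> (Q (Suc 0) \<union> (\<Union>k. Q (Suc (Suc k))))"
        by (simp only: split0[of Q] split0[of "\<lambda>k. Q (Suc k)"])
      also have "\<dots> = V" using P(3) A B by auto
      finally show ?thesis .
    qed
    ultimately have F1: "(\<Sum>i. ennreal (cmod (\<mu> (Q i)))) \<le> tvar \<mu> V" by (rule tvar_upper)
    have F2: "(\<Sum>i. ennreal (cmod (\<mu> (Q i)))) =
       (\<Sum>i. ennreal (cmod (\<mu> (P i)))) + (ennreal (cmod (\<mu> B)) + ennreal (cmod (\<mu> (V - A - B))))"
      using suminf_offset[OF summableI, of "\<lambda>i. ennreal (cmod (\<mu> (Q i)))" 2]
      by (simp add: numeral_2_eq_2 add.assoc)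
    have "(\<Sum>i. ennreal (cmod (\<mu> (P i)))) + (ennreal (cmod (\<mu> B)) + 0) \<le>
       (\<Sum>i. ennreal (cmod (\<mu> (P i)))) + (ennreal (cmod (\<mu> B)) + ennreal (cmod (\<mu> (V - A - B))))"
      by (intro add_left_mono) simp
    then show ?thesis using F1 unfolding F2 add_0_right by (rule order_trans)
  qed
  define S where "S = {P::nat \<Rightarrow> 'a set. range P \<subseteq> sets borel \<and> disjoint_family P \<and> (\<Union>i. P i) = A}"
  have "range (\<lambda>n::nat. if n = 0 then A else {}) \<subseteq> sets borel" using A(1) by auto
  moreover have "disjoint_family (\<lambda>n::nat. if n = 0 then A else {})"
    unfolding disjoint_family_on_def by simp
  moreover have "(\<Union>n::nat. if n = 0 then A else {}) = A" by auto
  ultimately have ne: "S \<noteq> {}" unfolding S_def by blast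
  have "tvar \<mu> A + ennreal (cmod (\<mu> B)) = (SUP P\<in>S. (\<Sum>i. ennreal (cmod (\<mu> (P i)))) + ennreal (cmod (\<mu> B)))"
    unfolding tvar_def S_def[symmetric] by (rule ennreal_SUP_add_left[OF ne, symmetric])
  also have "\<dots> \<le> tvar \<mu> V"
    by (rule SUP_least) (rule *, auto simp: S_def)
  finally have "tvar \<mu> A + ennreal (cmod (\<mu> B)) \<le> tvar \<mu> V" .
  then show ?thesis by (simp add: add.commute)
qed

lemma tvar_mono:
  assumes "A \<in> sets borel" "V \<in> sets borel" "A \<subseteq> V"
  shows "tvar \<mu> A \<le> tvar \<mu> V"
proof -
  have "ennreal (cmod (\<mu> {})) + tvar \<mu> A \<le> tvar \<mu> V"
    by (rule cmod_plus_tvar_le) (use assms in auto)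
  then show ?thesis by (metis add_increasing order_refl order_trans zero_le)
qed

lemma tvar_subadd:
  assumes cm: "complex_measure \<mu>" and A: "A \<in> sets borel" "A \<subseteq> V"
  shows "tvar \<mu> V \<le> tvar \<mu> A + tvar \<mu> (V - A)"
proof (rule tvar_least)
  fix P :: "nat \<Rightarrow> 'a set" assume P: "range P \<subseteq> sets borel" "disjoint_family P" "(\<Union>i. P i) = V"
  have Pm: "P i \<in> sets borel" for i using P by auto
  have "cmod (\<mu> (P i)) \<le> cmod (\<mu> (P i \<inter> A)) + cmod (\<mu> (P i - A))" for i
  proof -
    have e: "(P i \<inter> A) \<union> (P i - A) = P i" "(P i \<inter> A) \<inter> (P i - A) = {}" by auto
    have m: "P i \<inter> A \<in> sets borel" "P i - A \<in> sets borel" using Pm A by auto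
    have "\<mu> (P i) = \<mu> (P i \<inter> A) + \<mu> (P i - A)"
      using signed_measure_Un[OF signed_measure_Re[OF cm] m e(2)]
        signed_measure_Un[OF signed_measure_Im[OF cm] m e(2)] unfolding e(1)
      by (simp add: complex_eq_iff)
    then show ?thesis by (simp add: norm_triangle_ineq)
  qed
  then have "(\<Sum>i. ennreal (cmod (\<mu> (P i)))) \<le> (\<Sum>i. ennreal (cmod (\<mu> (P i \<inter> A))) + ennreal (cmod (\<mu> (P i - A))))"
    by (intro suminf_le) (auto simp: ennreal_leI simp flip: ennreal_plus)
  also have "\<dots> = (\<Sum>i. ennreal (cmod (\<mu> (P i \<inter> A)))) + (\<Sum>i. ennreal (cmod (\<mu> (P i - A))))"
    by (rule suminf_add[symmetric]) auto
  also have "\<dots> \<le> tvar \<mu> A + tvar \<mu> (V - A)"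
  proof (intro add_mono)
    have d: "disjoint_family (\<lambda>i. P i \<inter> A)" "disjoint_family (\<lambda>i. P i - A)"
      using P(2) unfolding disjoint_family_on_def by blast+
    have u: "(\<Union>i. P i \<inter> A) = A" "(\<Union>i. P i - A) = V - A" using P(3) A by auto
    show "(\<Sum>i. ennreal (cmod (\<mu> (P i \<inter> A)))) \<le> tvar \<mu> A"
      by (rule tvar_upper[OF _ d(1) u(1)]) (use Pm A in auto)
    show "(\<Sum>i. ennreal (cmod (\<mu> (P i - A)))) \<le> tvar \<mu> (V - A)"
      by (rule tvar_upper[OF _ d(2) u(2)]) (use Pm A in auto)
  qed
  finally show "(\<Sum>i. ennreal (cmod (\<mu> (P i)))) \<le> tvar \<mu> A + tvar \<mu> (V - A)" .
qed

text \<open>Total variation is subadditive and dominated by \<open>N\<close>, so both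
  \<open>V - A\<close> and \<open>A - K\<close> contribute at most \<open>N (V - K)\<close>.\<close>

lemma radon_imp_regular_cm:
  fixes \<mu> :: "'x::t2_space set \<Rightarrow> complex"
  assumes cm: "complex_measure \<mu>" and N: "radon N"
    and le: "\<And>A. A \<in> sets borel \<Longrightarrow> cmod (\<mu> A) \<le> measure N A"
  shows "regular_cm \<mu>"
  unfolding regular_cm_def
proof (intro ballI conjI)
  have Ns: "sets N = sets borel" and Nf: "finite_measure N" using N by (simp_all add: radon_def)
  interpret finite_measure N by fact
  note tle = tvar_le_measure[OF Ns Nf le]
  fix A :: "'x set" assume A: "A \<in> sets borel"
  show "tvar \<mu> A = (INF V\<in>{V. open V \<and> A \<subseteq> V}. tvar \<mu> V)"
  proof (rule antisym)
    show "tvar \<mu> A \<le> (INF V\<in>{V. open V \<and> A \<subseteq> V}. tvar \<mu> V)"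
      by (rule INF_greatest) (use A in \<open>auto intro: tvar_mono\<close>)
    show "(INF V\<in>{V. open V \<and> A \<subseteq> V}. tvar \<mu> V) \<le> tvar \<mu> A"
    proof (rule ennreal_le_epsilon)
      fix e :: real assume "0 < e"
      then obtain K V where K: "compact K" "open V" "K \<subseteq> A" "A \<subseteq> V" "measure N (V - K) < e"
        using radonE[OF N A] by metis
      have s: "V \<in> sets borel" "K \<in> sets borel" using K by (auto intro: borel_compact_t2)
      have "(INF V\<in>{V. open V \<and> A \<subseteq> V}. tvar \<mu> V) \<le> tvar \<mu> V"
        by (rule INF_lower) (use K in auto)
      also have "\<dots> \<le> tvar \<mu> A + tvar \<mu> (V - A)" by (rule tvar_subadd[OF cm A K(4)])
      also have "tvar \<mu> (V - A) \<le> ennreal e"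
      proof (rule order_trans[OF tle ennreal_leI])
        have "measure N (V - A) \<le> measure N (V - K)"
          by (rule finite_measure_mono) (use K s A Ns in auto)
        then show "measure N (V - A) \<le> e" using K by simp
      qed
      finally show "(INF V\<in>{V. open V \<and> A \<subseteq> V}. tvar \<mu> V) \<le> tvar \<mu> A + ennreal e"
        by (simp add: add_left_mono)
    qed
  qed
  show "tvar \<mu> A = (SUP K\<in>{K. compact K \<and> K \<subseteq> A}. tvar \<mu> K)"
  proof (rule antisym)
    show "(SUP K\<in>{K. compact K \<and> K \<subseteq> A}. tvar \<mu> K) \<le> tvar \<mu> A"
      by (rule SUP_least) (use A in \<open>auto intro!: tvar_mono borel_compact_t2\<close>)
    show "tvar \<mu> A \<le> (SUP K\<in>{K. compact K \<and> K \<subseteq> A}. tvar \<mu> K)"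
    proof (rule ennreal_le_epsilon)
      fix e :: real assume "0 < e"
      then obtain K V where K: "compact K" "open V" "K \<subseteq> A" "A \<subseteq> V" "measure N (V - K) < e"
        using radonE[OF N A] by metis
      have s: "V \<in> sets borel" "K \<in> sets borel" using K by (auto intro: borel_compact_t2)
      have "tvar \<mu> A \<le> tvar \<mu> K + tvar \<mu> (A - K)" by (rule tvar_subadd[OF cm s(2) K(3)])
      also have "tvar \<mu> (A - K) \<le> ennreal e"
      proof (rule order_trans[OF tle ennreal_leI])
        have "measure N (A - K) \<le> measure N (V - K)"
          by (rule finite_measure_mono) (use K s A Ns in auto)
        then show "measure N (A - K) \<le> e" using K by simp
      qed
      also have "tvar \<mu> K \<le> (SUP K\<in>{K. compact K \<and> K \<subseteq> A}. tvar \<mu> K)"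
        by (rule SUP_upper) (use K in auto)
      finally show "tvar \<mu> A \<le> (SUP K\<in>{K. compact K \<and> K \<subseteq> A}. tvar \<mu> K) + ennreal e"
        by (simp add: add_mono)
    qed
  qed
qed

text \<open>Each of the four Jordan parts is a supremum, over Borel subsets, of a real or imaginary
  part of \<open>\<mu>\<close> up to sign. Hence the factor 4.\<close>

lemma measure_jordan_sum_le:
  assumes cm: "complex_measure \<mu>" and A: "A \<in> sets borel"
    and le: "\<And>B. B \<in> sets borel \<Longrightarrow> B \<subseteq> A \<Longrightarrow> cmod (\<mu> B) \<le> e"
  shows "measure (jordan_sum \<mu>) A \<le> 4 * e"
proof -
  have *: "pos_var \<nu> A \<le> e" if "\<And>B. B \<in> sets borel \<Longrightarrow> \<bar>\<nu> B\<bar> \<le> cmod (\<mu> B)" for \<nu>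
  proof (rule pos_var_least)
    fix B assume "B \<in> sets borel" "B \<subseteq> A"
    then show "\<nu> B \<le> e" using that[of B] le[of B] by linarith
  qed
  have "measure (jordan_sum \<mu>) A =
     (pos_var (\<lambda>A. Re (\<mu> A)) A + pos_var (\<lambda>A. - Re (\<mu> A)) A) +
     (pos_var (\<lambda>A. Im (\<mu> A)) A + pos_var (\<lambda>A. - Im (\<mu> A)) A)"
    unfolding jordan_sum_def
    by (simp add: measure_add_measure finite_add_measure finite_pos_meas signed_parts[OF cm] A measure_pos_meas)
  also have "\<dots> \<le> (e + e) + (e + e)"
    by (intro add_mono *) (simp_all add: abs_Re_le_cmod abs_Im_le_cmod)
  finally show ?thesis by simp
qed

text \<open>Regularity speaks of total variation, \<open>radon\<close> of the Jordan sum. The link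
  is that a Borel set inside \<open>V - A\<close> has measure at most the excess of the variation of
  \<open>V\<close> over that of \<open>A\<close>.\<close>

lemma regular_cm_imp_radon:
  fixes \<mu> :: "'x::t2_space set \<Rightarrow> complex"
  assumes cm: "complex_measure \<mu>" and reg: "regular_cm \<mu>"
  shows "radon (jordan_sum \<mu>)"
proof -
  let ?N = "jordan_sum \<mu>"
  interpret finite_measure ?N by (rule finite_jordan_sum[OF cm])
  \<comment> \<open>Total variation takes values in \<open>ennreal\<close>; finiteness permits
    cancelling it.\<close>
  have fin: "tvar \<mu> A < top" for A
    using tvar_le_measure[OF sets_jordan_sum finite_jordan_sum[OF cm] cmod_le_jordan_sum[OF cm], of A]
    by (metis ennreal_less_top order_le_less_trans)
  have small: "measure ?N (V - A) \<le> 4 * e"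
    if "A \<in> sets borel" "V \<in> sets borel" "A \<subseteq> V" "tvar \<mu> V \<le> tvar \<mu> A + ennreal e" "e > 0" for A V e
  proof (rule measure_jordan_sum_le[OF cm])
    fix B assume "B \<in> sets borel" "B \<subseteq> V - A"
    then have "ennreal (cmod (\<mu> B)) + tvar \<mu> A \<le> ennreal e + tvar \<mu> A"
      using cmod_plus_tvar_le[of B V A \<mu>] that by (simp add: add.commute order_trans)
    then show "cmod (\<mu> B) \<le> e"
      using fin[of A, THEN less_imp_neq] that by (simp add: ennreal_add_left_cancel_le add.commute[of _ "tvar \<mu> A"] ennreal_le_iff)
  qed (use that in auto)
  have "\<exists>K V. compact K \<and> open V \<and> K \<subseteq> A \<and> A \<subseteq> V \<and> measure ?N (V - K) < e"
    if A: "A \<in> sets borel" and e: "e > 0" for A e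
  proof -
    \<comment> \<open>The two gaps \<open>V - A\<close> and \<open>A - K\<close> each cost a factor
      4, so errors of \<open>e/16\<close> add up to \<open>e/2\<close>.\<close>
    have "(INF V\<in>{V. open V \<and> A \<subseteq> V}. tvar \<mu> V) < tvar \<mu> A + ennreal (e/16)"
    proof -
      have "(INF V\<in>{V. open V \<and> A \<subseteq> V}. tvar \<mu> V) = tvar \<mu> A"
        using reg A unfolding regular_cm_def by metis
      moreover have "tvar \<mu> A + 0 < tvar \<mu> A + ennreal (e/16)"
        using fin[of A] e by (subst ennreal_add_left_cancel_less) auto
      ultimately show ?thesis by simp
    qed
    then obtain V where V: "open V" "A \<subseteq> V" "tvar \<mu> V < tvar \<mu> A + ennreal (e/16)"
      by (auto simp: INF_less_iff)
    have "\<exists>K. compact K \<and> K \<subseteq> A \<and> tvar \<mu> A \<le> tvar \<mu> K + ennreal (e/16)"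
    proof (rule ccontr)
      assume "\<not> ?thesis"
      then have *: "tvar \<mu> K + ennreal (e/16) \<le> tvar \<mu> A" if "compact K" "K \<subseteq> A" for K
        using that by (meson linear)
      have "(SUP K\<in>{K. compact K \<and> K \<subseteq> A}. tvar \<mu> K) + ennreal (e/16) \<le> tvar \<mu> A"
        by (subst ennreal_SUP_add_left[symmetric]) (auto intro!: SUP_least * intro: exI[of _ "{}"])
      then have "tvar \<mu> A + ennreal (e/16) \<le> tvar \<mu> A + 0"
        using bspec[OF reg[unfolded regular_cm_def] A, THEN conjunct2, symmetric] by simp
      then show False using fin[of A] e by (subst (asm) ennreal_add_left_cancel_le) auto
    qed
    then obtain K where K: "compact K" "K \<subseteq> A" "tvar \<mu> A \<le> tvar \<mu> K + ennreal (e/16)" by blast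
    have s: "K \<in> sets borel" "V \<in> sets borel" using K V by (auto intro: borel_compact_t2)
    have "V - K = (V - A) \<union> (A - K)" using K V by auto
    then have "measure ?N (V - K) \<le> measure ?N (V - A) + measure ?N (A - K)"
      using s A by (auto intro!: measure_Un_le)
    also have "\<dots> \<le> 4 * (e/16) + 4 * (e/16)"
      by (intro add_mono small) (use V K s A e in auto)
    also have "\<dots> < e" using e by simp
    finally show ?thesis using K V by blast
  qed
  then show ?thesis using finite_jordan_sum[OF cm] by (auto simp: radon_def)
qed

lemma regular_cm_dominated:
  fixes \<mu> :: "'x::t2_space set \<Rightarrow> complex"
  assumes "complex_measure \<mu>" "regular_cm \<mu>"
  shows "dominated (cint \<mu>) (jordan_sum \<mu>)"
  using linear_cint[OF assms(1)] cmod_cint_le[OF assms(1)] regular_cm_imp_radon[OF assms]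
  by (auto simp: dominated_def)

section \<open>The Riesz representation theorem\<close>

lemma compact_closed_subset:
  assumes "compact S" "closed T" "T \<subseteq> S" shows "compact T"
  using compact_Int_closed[OF assms(1,2)] assms(3) by (simp add: Int_absorb1)

text \<open>Level sets of \<open>h\<close> are closed subsets of compact level sets of
  \<open>f\<close>. Most membership proofs for \<open>C0\<close> below reduce to this.\<close>

lemma C0_dominated:
  fixes f :: "'x::topological_space \<Rightarrow> 'b::real_normed_vector" and h :: "'x \<Rightarrow> 'c::real_normed_vector"
  assumes f: "f \<in> C0" and h: "continuous_on UNIV h" and le: "\<And>x. norm (h x) \<le> K * norm (f x)"
  shows "h \<in> C0"
proof -
  have "compact {x. e \<le> norm (h x)}" if e: "e > 0" for e
  proof -
    \<comment> \<open>\<open>K\<close> may be 0 or negative, but a positive constant is needed to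
      divide by.\<close>
    define K' where "K' = \<bar>K\<bar> + 1"
    have K': "K' > 0" "K \<le> K'" by (auto simp: K'_def)
    have "compact {x. e / K' \<le> norm (f x)}" using f e K' by (simp add: C0_def)
    moreover have "closed {x. e \<le> norm (h x)}"
      by (intro closed_Collect_le continuous_intros h)
    moreover have "{x. e \<le> norm (h x)} \<subseteq> {x. e / K' \<le> norm (f x)}"
    proof
      fix x assume "x \<in> {x. e \<le> norm (h x)}"
      then have "e \<le> K * norm (f x)" using le[of x] by auto
      also have "\<dots> \<le> K' * norm (f x)" using K' by (intro mult_right_mono) auto
      finally show "x \<in> {x. e / K' \<le> norm (f x)}" using K' by (simp add: field_simps)
    qed
    ultimately show ?thesis by (rule compact_closed_subset)
  qed
  then show ?thesis using h by (auto simp: C0_def)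
qed

lemma C0_continuous: "f \<in> C0 \<Longrightarrow> continuous_on UNIV f"
  by (simp add: C0_def)

lemma C0_add:
  fixes f g :: "'x::topological_space \<Rightarrow> 'b::real_normed_vector"
  assumes f: "f \<in> C0" and g: "g \<in> C0"
  shows "(\<lambda>x. f x + g x) \<in> C0"
proof -
  have c: "continuous_on UNIV (\<lambda>x. f x + g x)"
    using assms by (intro continuous_intros C0_continuous)
  have "compact {x. e \<le> norm (f x + g x)}" if e: "e > 0" for e
  proof -
    have "compact ({x. e/2 \<le> norm (f x)} \<union> {x. e/2 \<le> norm (g x)})"
      using assms e half_gt_zero[OF e] unfolding C0_def by (intro compact_Un) blast+
    moreover have "closed {x. e \<le> norm (f x + g x)}"
      by (intro closed_Collect_le continuous_intros c)
    moreover have "{x. e \<le> norm (f x + g x)} \<subseteq> {x. e/2 \<le> norm (f x)} \<union> {x. e/2 \<le> norm (g x)}"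
      proof
      fix x assume "x \<in> {x. e \<le> norm (f x + g x)}"
      then show "x \<in> {x. e/2 \<le> norm (f x)} \<union> {x. e/2 \<le> norm (g x)}"
        using norm_triangle_ineq[of "f x" "g x"] by auto
    qed
    ultimately show ?thesis by (rule compact_closed_subset)
  qed
  then show ?thesis using c by (auto simp: C0_def)
qed

lemma C0_bounded_borel: 
  fixes f :: "'x::topological_space \<Rightarrow> 'b::real_normed_vector"
  assumes f: "f \<in> C0" shows "f \<in> bounded_borel"
proof -
  have "compact (f ` {x. 1 \<le> norm (f x)})"
    by (rule compact_continuous_image)
       (use f in \<open>auto simp: C0_def intro: continuous_on_subset\<close>)
  then have "bounded (f ` {x. 1 \<le> norm (f x)})" by (rule compact_imp_bounded)
  then obtain B where B: "\<And>x. 1 \<le> norm (f x) \<Longrightarrow> norm (f x) \<le> B"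
    unfolding bounded_iff by auto
  show ?thesis
  proof (rule bounded_borelI[where B="max 1 B"])
    show "f \<in> borel_measurable borel"
      using f by (intro borel_measurable_continuous_onI C0_continuous)
    show "norm (f x) \<le> max 1 B" for x using B[of x] by linarith
  qed
qed

lemma C0_diff:
  fixes f g :: "'x::topological_space \<Rightarrow> 'b::real_normed_vector"
  assumes f: "f \<in> C0" and g: "g \<in> C0"
  shows "(\<lambda>x. f x - g x) \<in> C0"
proof -
  have "(\<lambda>x. - g x) \<in> C0"
    by (rule C0_dominated[OF g continuous_on_minus[OF C0_continuous[OF g]], where K=1]) simp
  from C0_add[OF f this] show ?thesis by simp
qed

lemma C0_zero: "(\<lambda>x. 0) \<in> C0"
  by (auto simp: C0_def)

text \<open>Local compactness gives an open \<open>U\<close> with \<open>K \<subseteq> U\<close>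
  inside a compact \<open>L\<close>. The Urysohn function is made to vanish off
  \<open>U \<inter> V\<close> and not just off \<open>V\<close>, so that its level sets lie in
  \<open>L\<close>; truncation puts its values into the unit interval.\<close>

lemma Urysohn_C0:
  fixes K V :: "'x::t2_space set"
  assumes lc: "locally_compact_space (euclidean :: 'x topology)"
    and K: "compact K" and V: "open V" and KV: "K \<subseteq> V"
  obtains u :: "'x \<Rightarrow> real" where "u \<in> C0" "\<And>x. 0 \<le> u x" "\<And>x. u x \<le> 1"
    "\<And>x. x \<in> K \<Longrightarrow> u x = 1" "\<And>x. x \<notin> V \<Longrightarrow> u x = 0"
proof -
  have H: "Hausdorff_space (euclidean :: 'x topology)"
    unfolding Hausdorff_space_def by (simp add: disjnt_def) (meson hausdorff)
  then obtain U L where UL: "open U" "compact L" "closed L" "K \<subseteq> U" "U \<subseteq> L"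
    using lc K locally_compact_space_compact_closed_compact[of "euclidean :: 'x topology"]
    by (metis closed_closedin compactin_euclidean_iff open_openin)
  have "completely_regular_space (euclidean :: 'x topology)"
    using locally_compact_regular_imp_completely_regular_space[OF lc] H by blast
  moreover have "compactin euclidean K" "closedin euclidean (- (U \<inter> V))" "disjnt K (- (U \<inter> V))"
    using K V UL KV by (auto simp: closed_closedin[symmetric] disjnt_def)
  ultimately obtain f :: "'x \<Rightarrow> real" where f: "continuous_map euclidean euclideanreal f"
      "f ` (- (U \<inter> V)) \<subseteq> {0}" "f ` K \<subseteq> {1}"
    using Urysohn_completely_regular_compact_closed_alt by metis
  define u where "u x = min 1 \<bar>f x\<bar>" for x
  have cu: "continuous_on UNIV u"
    using f(1) unfolding u_def by (intro continuous_intros) simp_all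
  have u0: "u x = 0" if "x \<notin> U \<inter> V" for x using f(2) that by (auto simp: u_def image_subset_iff)
  have "compact {x. e \<le> norm (u x)}" if "e > 0" for e
  proof -
    have "{x. e \<le> norm (u x)} \<subseteq> L" using that u0 UL by force
    moreover have "closed {x. e \<le> norm (u x)}" by (intro closed_Collect_le continuous_intros cu)
    ultimately show ?thesis using compact_closed_subset[OF \<open>compact L\<close>] by blast
  qed
  then have "u \<in> C0" using cu by (simp add: C0_def)
  moreover have "u x = 1" if "x \<in> K" for x using f(3) that by (auto simp: u_def image_subset_iff)
  ultimately show ?thesis using that[of u] u0 by (auto simp: u_def)
qed

section \<open>Positive functionals and the outer measure they generate\<close>

definition C0_pos :: "('x::topological_space \<Rightarrow> real) set" where
  "C0_pos = {f \<in> C0. \<forall>x. 0 \<le> f x}"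

lemma C0_pos_dominated:
  assumes "f \<in> C0_pos" "continuous_on UNIV h" "\<And>x. 0 \<le> h x" "\<And>x. h x \<le> f x"
  shows "h \<in> C0_pos"
  using assms C0_dominated[of f h 1] by (auto simp: C0_pos_def)

lemma C0_pos_add: "f \<in> C0_pos \<Longrightarrow> g \<in> C0_pos \<Longrightarrow> (\<lambda>x. f x + g x) \<in> C0_pos"
  by (auto simp: C0_pos_def intro: C0_add)

lemma C0_pos_continuous: "f \<in> C0_pos \<Longrightarrow> continuous_on UNIV f"
  by (simp add: C0_pos_def C0_def)

lemma C0_pos_diff: "f \<in> C0_pos \<Longrightarrow> g \<in> C0_pos \<Longrightarrow> (\<And>x. g x \<le> f x) \<Longrightarrow> (\<lambda>x. f x - g x) \<in> C0_pos"
  by (rule C0_pos_dominated[of f]) (auto simp: C0_pos_def C0_def intro!: continuous_intros)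

text \<open>Additivity is assumed on nonnegative functions only. Homogeneity for natural multiples
  follows from it, and the layer cake argument asks for no more.\<close>

locale positive_functional =
  fixes P :: "('x::t2_space \<Rightarrow> real) \<Rightarrow> real" and C :: real
  assumes lc: "locally_compact_space (euclidean :: 'x topology)"
    and C_nonneg: "0 \<le> C"
    and P_add: "f \<in> C0_pos \<Longrightarrow> g \<in> C0_pos \<Longrightarrow> P (\<lambda>x. f x + g x) = P f + P g"
    and P_nonneg: "f \<in> C0_pos \<Longrightarrow> 0 \<le> P f"
    and P_bound: "f \<in> C0_pos \<Longrightarrow> (\<And>x. f x \<le> B) \<Longrightarrow> 0 \<le> B \<Longrightarrow> P f \<le> C * B"
begin

lemma P_mono:
  assumes "f \<in> C0_pos" "g \<in> C0_pos" "\<And>x. f x \<le> g x" shows "P f \<le> P g"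
proof -
  have d: "(\<lambda>x. g x - f x) \<in> C0_pos" using assms by (intro C0_pos_diff)
  have "P (\<lambda>x. f x + (g x - f x)) = P f + P (\<lambda>x. g x - f x)" by (rule P_add[OF assms(1) d])
  then show ?thesis using P_nonneg[OF d] by simp
qed

text \<open>A test function vanishes off \<open>V\<close> but need not have compact support in
  \<open>V\<close>; \<open>truncation\<close> makes up for that.\<close>

definition tests :: "'x set \<Rightarrow> ('x \<Rightarrow> real) set" where
  "tests V = {u \<in> C0_pos. (\<forall>x. u x \<le> 1) \<and> (\<forall>x. x \<notin> V \<longrightarrow> u x = 0)}"

definition open_content :: "'x set \<Rightarrow> real" where
  "open_content V = (SUP u\<in>tests V. P u)"

definition outer :: "'x set \<Rightarrow> real" where
  "outer A = (INF V\<in>{V. open V \<and> A \<subseteq> V}. open_content V)"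

lemma testsD: "u \<in> tests V \<Longrightarrow> u \<in> C0_pos" "u \<in> tests V \<Longrightarrow> u x \<le> 1" "u \<in> tests V \<Longrightarrow> x \<notin> V \<Longrightarrow> u x = 0"
  by (auto simp: tests_def)

lemma tests_le: "u \<in> tests V \<Longrightarrow> P u \<le> C"
  using P_bound[of u 1] by (auto simp: tests_def)

lemma zero_tests: "(\<lambda>x. 0) \<in> tests V"
  by (auto simp: tests_def C0_pos_def C0_zero)

lemma bdd_tests: "bdd_above (P ` tests V)"
  by (rule bdd_aboveI2[where M=C]) (rule tests_le)

lemma open_content_upper: "u \<in> tests V \<Longrightarrow> P u \<le> open_content V"
  unfolding open_content_def by (rule cSUP_upper[OF _ bdd_tests])

lemma open_content_least: "(\<And>u. u \<in> tests V \<Longrightarrow> P u \<le> c) \<Longrightarrow> open_content V \<le> c"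
  unfolding open_content_def using zero_tests by (intro cSUP_least) auto

lemma open_content_nonneg: "0 \<le> open_content V"
  using open_content_upper[OF zero_tests] P_nonneg[of "\<lambda>x. 0"] by (auto simp: C0_pos_def C0_zero intro: order_trans)

lemma open_content_le: "open_content V \<le> C"
  by (rule open_content_least) (rule tests_le)

lemma open_content_mono: "V \<subseteq> W \<Longrightarrow> open_content V \<le> open_content W"
  by (rule open_content_least, rule open_content_upper) (auto simp: tests_def)

lemma open_content_empty: "open_content {} = 0"
proof (rule antisym[OF open_content_least open_content_nonneg])
  fix u assume "u \<in> tests {}"
  then show "P u \<le> 0" using P_bound[of u 0] by (auto simp: tests_def)
qed

text \<open>Cutting off height \<open>d\<close> costs \<open>P (min u d) \<le> C * d\<close>. What
  remains is supported by a compact subset of \<open>V\<close>, to which covering and separation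
  arguments apply.\<close>

lemma truncation:
  assumes u: "u \<in> tests V" and d: "0 < d"
  defines "w \<equiv> \<lambda>x. max 0 (u x - d)"
  shows "w \<in> tests {x. d \<le> u x}" "compact {x. d \<le> u x}" "{x. d \<le> u x} \<subseteq> V" "P u \<le> P w + C * d"
proof -
  note uD = testsD[OF u]
  have u0: "0 \<le> u x" for x using uD(1) by (simp add: C0_pos_def)
  have cu: "continuous_on UNIV u" using uD(1) by (rule C0_pos_continuous)
  have w: "w \<in> C0_pos"
  proof (rule C0_pos_dominated[OF uD(1)])
    show "continuous_on UNIV w" unfolding w_def by (intro continuous_intros cu)
    show "w x \<le> u x" for x using u0[of x] d by (simp add: w_def)
  qed (simp add: w_def)
  show "w \<in> tests {x. d \<le> u x}"
    unfolding tests_def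
  proof (intro CollectI conjI allI impI w)
    show "w x \<le> 1" for x using uD(2)[of x] d by (simp add: w_def)
  qed (simp add: w_def)
  have "{x. d \<le> u x} = {x. d \<le> norm (u x)}" using u0 by auto
  moreover have "compact {x. d \<le> norm (u x)}" using uD(1) d unfolding C0_pos_def C0_def by blast
  ultimately show "compact {x. d \<le> u x}" by (simp only:)
  show "{x. d \<le> u x} \<subseteq> V" using uD(3) d by force
  have m: "(\<lambda>x. min (u x) d) \<in> C0_pos"
  proof (rule C0_pos_dominated[OF uD(1)])
    show "continuous_on UNIV (\<lambda>x. min (u x) d)" by (intro continuous_intros cu)
  qed (use u0 d in \<open>simp_all add: less_imp_le\<close>)
  have "P u = P (\<lambda>x. w x + min (u x) d)"
    by (rule arg_cong[where f=P]) (simp add: w_def fun_eq_iff max_def min_def)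
  also have "\<dots> = P w + P (\<lambda>x. min (u x) d)" by (rule P_add[OF w m])
  also have "P (\<lambda>x. min (u x) d) \<le> C * d" using P_bound[OF m, of d] d by auto
  finally show "P u \<le> P w + C * d" by simp
qed

lemma le_epsilon_mult:
  fixes a b :: real
  assumes "\<And>d. 0 < d \<Longrightarrow> a \<le> b + C * d" shows "a \<le> b"
proof (rule field_le_epsilon)
  fix e :: real assume e: "0 < e"
  \<comment> \<open>\<open>C\<close> may be 0, hence the denominator \<open>C + 1\<close>.\<close>
  have "a \<le> b + C * (e / (C + 1))" using assms[of "e / (C + 1)"] e C_nonneg by simp
  also have "C * (e / (C + 1)) \<le> e" using e C_nonneg by (simp add: field_simps)
  finally show "a \<le> b + e" by simp
qed

text \<open>A partition of unity: \<open>v\<close> is 1 on the part of the compact set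
  \<open>{x. d \<le> u x}\<close> outside \<open>V2\<close> and vanishes off \<open>V1\<close>. Thus
  \<open>w * v\<close> tests \<open>V1\<close> and \<open>w * (1 - v)\<close> tests
  \<open>V2\<close>.\<close>

lemma open_content_Un:
  assumes V: "open V1" "open V2"
  shows "open_content (V1 \<union> V2) \<le> open_content V1 + open_content V2"
proof (rule open_content_least, rule le_epsilon_mult)
  fix u d assume u: "u \<in> tests (V1 \<union> V2)" and d: "0 < (d::real)"
  define w where "w = (\<lambda>x. max 0 (u x - d))"
  note t = truncation[OF u d, folded w_def]
  have "compact ({x. d \<le> u x} - V2)" using t(2) V compact_diff by blast
  then obtain v :: "'x \<Rightarrow> real" where v: "v \<in> C0" "\<And>x. 0 \<le> v x" "\<And>x. v x \<le> 1"
      "\<And>x. x \<in> {x. d \<le> u x} - V2 \<Longrightarrow> v x = 1" "\<And>x. x \<notin> V1 \<Longrightarrow> v x = 0"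
    using Urysohn_C0[OF lc, of "{x. d \<le> u x} - V2" V1] t(3) V by blast
  note w = testsD[OF t(1)]
  have w0: "0 \<le> w x" for x by (simp add: w_def)
  have c: "continuous_on UNIV w" "continuous_on UNIV v"
    using w(1) v(1) by (auto intro: C0_pos_continuous C0_continuous)
  have 1: "(\<lambda>x. w x * v x) \<in> tests V1"
    unfolding tests_def
  proof (intro CollectI conjI allI impI)
    show "(\<lambda>x. w x * v x) \<in> C0_pos"
      by (rule C0_pos_dominated[OF w(1)]) (use w0 v c in \<open>auto intro!: continuous_intros simp: mult_left_le\<close>)
  qed (use w0 w v in \<open>auto intro: mult_le_one\<close>)
  have 2: "(\<lambda>x. w x * (1 - v x)) \<in> tests V2"
    unfolding tests_def
  proof (intro CollectI conjI allI impI)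
    show "(\<lambda>x. w x * (1 - v x)) \<in> C0_pos"
      by (rule C0_pos_dominated[OF w(1)]) (use w0 v c in \<open>auto intro!: continuous_intros mult_left_le\<close>)
    show "w x * (1 - v x) \<le> 1" for x using w0[of x] w(2)[of x] v(2,3)[of x] by (intro mult_le_one) auto
    show "w x * (1 - v x) = 0" if "x \<notin> V2" for x using w(3)[of x] v(4)[of x] that by auto
  qed
  have "P u \<le> P w + C * d" by (rule t(4))
  also have "P w = P (\<lambda>x. w x * v x + w x * (1 - v x))"
    by (rule arg_cong[where f=P]) (simp add: fun_eq_iff algebra_simps)
  also have "\<dots> = P (\<lambda>x. w x * v x) + P (\<lambda>x. w x * (1 - v x))"
    by (rule P_add[OF testsD(1)[OF 1] testsD(1)[OF 2]])
  also have "\<dots> \<le> open_content V1 + open_content V2" by (intro add_mono open_content_upper 1 2)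
  finally show "P u \<le> open_content V1 + open_content V2 + C * d" by simp
qed

lemma open_content_finite_UN:
  fixes n :: nat
  assumes "\<And>i. open (V i)"
  shows "open_content (\<Union>i<n. V i) \<le> (\<Sum>i<n. open_content (V i))"
proof (induction n)
  case 0 then show ?case by (simp add: open_content_empty)
next
  case (Suc n)
  have "open_content (V n \<union> (\<Union>i<n. V i)) \<le> open_content (V n) + open_content (\<Union>i<n. V i)"
    using assms by (intro open_content_Un) auto
  then show ?case using Suc by (simp add: lessThan_Suc)
qed

text \<open>After truncation only a compact set matters, and finitely many of the \<open>V i\<close>
  cover it.\<close>

lemma open_content_UN:
  assumes V: "\<And>i::nat. open (V i)"
  shows "ennreal (open_content (\<Union>i. V i)) \<le> (\<Sum>i. ennreal (open_content (V i)))"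
proof (cases "(\<Sum>i. ennreal (open_content (V i))) = top")
  case False
  define s where "s = enn2real (\<Sum>i. ennreal (open_content (V i)))"
  have s: "(\<Sum>i. ennreal (open_content (V i))) = ennreal s" "0 \<le> s"
    using False by (simp_all add: s_def less_top)
  have "open_content (\<Union>i. V i) \<le> s"
  proof (rule open_content_least, rule le_epsilon_mult)
    fix u d assume u: "u \<in> tests (\<Union>i. V i)" and d: "0 < (d::real)"
    define w where "w = (\<lambda>x. max 0 (u x - d))"
    note t = truncation[OF u d, folded w_def]
    obtain I where I: "finite I" "{x. d \<le> u x} \<subseteq> (\<Union>i\<in>I. V i)"
    proof (rule compactE_image[OF t(2), of UNIV V])
      show "{x. d \<le> u x} \<subseteq> (\<Union>i\<in>UNIV. V i)" using t(3) by simp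
    qed (use V in auto)
    then obtain n where n: "I \<subseteq> {..<n}" by (meson finite_nat_bounded)
    have "w \<in> tests (\<Union>i<n. V i)" using t(1) I(2) n unfolding tests_def by blast
    then have "P w \<le> (\<Sum>i<n. open_content (V i))"
      by (rule order_trans[OF open_content_upper open_content_finite_UN[OF V]])
    moreover have "(\<Sum>i<n. ennreal (open_content (V i))) \<le> ennreal s"
      unfolding s(1)[symmetric] by (intro sum_le_suminf) auto
    then have "ennreal (\<Sum>i<n. open_content (V i)) \<le> ennreal s"
      using open_content_nonneg by simp
    then have "(\<Sum>i<n. open_content (V i)) \<le> s" using s(2) by (simp add: ennreal_le_iff)
    ultimately show "P u \<le> s + C * d" using t(4) by simp
  qed
  then show ?thesis using s by (simp add: ennreal_leI)
qed simp

lemma bdd_outer: "bdd_below (open_content ` {V. open V \<and> A \<subseteq> V})"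
  by (rule bdd_belowI2[where m=0]) (rule open_content_nonneg)

lemma outer_lower: "open V \<Longrightarrow> A \<subseteq> V \<Longrightarrow> outer A \<le> open_content V"
  unfolding outer_def by (rule cINF_lower[OF bdd_outer]) auto

lemma outer_greatest: "(\<And>V. open V \<Longrightarrow> A \<subseteq> V \<Longrightarrow> c \<le> open_content V) \<Longrightarrow> c \<le> outer A"
  unfolding outer_def by (rule cINF_greatest) (auto intro: exI[of _ UNIV])

lemma outer_close:
  assumes "0 < e" obtains V where "open V" "A \<subseteq> V" "open_content V < outer A + e"
proof -
  have "\<exists>V. open V \<and> A \<subseteq> V \<and> open_content V < outer A + e"
  proof (rule ccontr)
    assume "\<not> ?thesis"
    then have "outer A + e \<le> outer A" by (intro outer_greatest) (meson not_less)
    then show False using assms by simp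
  qed
  then show ?thesis using that by blast
qed

lemma outer_open: "open V \<Longrightarrow> outer V = open_content V"
  by (intro antisym outer_lower outer_greatest open_content_mono) auto

lemma outer_nonneg: "0 \<le> outer A"
  by (rule outer_greatest) (rule open_content_nonneg)

lemma outer_mono: "A \<subseteq> B \<Longrightarrow> outer A \<le> outer B"
  by (rule outer_greatest, rule outer_lower) auto

lemma outer_measure: "outer_measure_space UNIV (\<lambda>A. ennreal (outer A))"
  unfolding outer_measure_space_def
proof (intro conjI)
  show "positive UNIV (\<lambda>A. ennreal (outer A))"
    by (simp add: positive_def outer_open open_content_empty)
  show "increasing UNIV (\<lambda>A. ennreal (outer A))"
    by (auto simp: increasing_def intro!: ennreal_leI outer_mono)
  show "countably_subadditive UNIV (\<lambda>A. ennreal (outer A))"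
    unfolding countably_subadditive_def
  proof (intro allI impI)
    fix A :: "nat \<Rightarrow> 'x set"
    show "ennreal (outer (\<Union>i. A i)) \<le> (\<Sum>i. ennreal (outer (A i)))"
    proof (rule ennreal_le_epsilon)
      fix e :: real assume e: "0 < e"
      have "\<exists>V. open V \<and> A i \<subseteq> V \<and> open_content V < outer (A i) + e * (1/2)^Suc i" for i
        using outer_close[of "e * (1/2)^Suc i" "A i"] e by (metis mult_pos_pos zero_less_power half_gt_zero_iff zero_less_one)
      then obtain V where V: "\<And>i. open (V i)" "\<And>i. A i \<subseteq> V i"
          "\<And>i. open_content (V i) < outer (A i) + e * (1/2)^Suc i" by metis
      have "ennreal (outer (\<Union>i. A i)) \<le> ennreal (open_content (\<Union>i. V i))"
        by (intro ennreal_leI outer_lower) (use V in auto)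
      also have "\<dots> \<le> (\<Sum>i. ennreal (open_content (V i)))" by (rule open_content_UN[OF V(1)])
      also have "\<dots> \<le> (\<Sum>i. ennreal (outer (A i)) + ennreal (e * (1/2)^Suc i))"
        using V(3) e outer_nonneg
        by (intro suminf_le) (auto simp: less_imp_le simp del: power_Suc simp flip: ennreal_plus intro!: ennreal_leI)
      also have "\<dots> = (\<Sum>i. ennreal (outer (A i))) + (\<Sum>i. ennreal (e * (1/2)^Suc i))"
        by (rule suminf_add[symmetric]) auto
      also have "(\<Sum>i. ennreal (e * (1/2)^Suc i)) = ennreal (e * 1)"
        by (rule suminf_ennreal_eq[OF _ sums_mult[OF power_half_series]]) (use e in simp)
      finally show "ennreal (outer (\<Union>i. A i)) \<le> (\<Sum>i. ennreal (outer (A i))) + ennreal e" by simp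
    qed
  qed
qed

lemma outer_Un: "outer (A \<union> B) \<le> outer A + outer B"
proof (rule field_le_epsilon)
  fix e :: real assume "0 < e"
  then obtain V W where "open V" "A \<subseteq> V" "open_content V < outer A + e/2"
     "open W" "B \<subseteq> W" "open_content W < outer B + e/2"
    using outer_close[of "e/2"] by (metis half_gt_zero)
  moreover from this have "outer (A \<union> B) \<le> open_content (V \<union> W)" by (intro outer_lower) auto
  ultimately show "outer (A \<union> B) \<le> outer A + outer B + e"
    using open_content_Un[of V W] by linarith
qed

text \<open>The nontrivial half of the Caratheodory criterion for an open set. A truncated test
  function \<open>w\<close> of \<open>G \<inter> V\<close> and a test function \<open>v\<close> of
  the open set \<open>G - {x. d \<le> u x}\<close> are never both nonzero, so \<open>w + v\<close>
  is still a test function of \<open>G\<close>; that open set contains \<open>G - V\<close>.\<close>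

lemma outer_split_open:
  assumes V: "open V" shows "outer (W \<inter> V) + outer (W - V) \<le> outer W"
proof (rule outer_greatest)
  fix G assume G: "open G" "W \<subseteq> G"
  have "open_content (G \<inter> V) \<le> open_content G - outer (G - V)"
  proof (rule open_content_least, rule le_epsilon_mult)
    fix u d assume u: "u \<in> tests (G \<inter> V)" and d: "0 < (d::real)"
    define w where "w = (\<lambda>x. max 0 (u x - d))"
    note t = truncation[OF u d, folded w_def]
    have oG: "open (G - {x. d \<le> u x})" using G t(2) by (simp add: open_Diff compact_imp_closed)
    have "open_content (G - {x. d \<le> u x}) \<le> open_content G - P w"
    proof (rule open_content_least)
      fix v assume v: "v \<in> tests (G - {x. d \<le> u x})"
      have "(\<lambda>x. w x + v x) \<in> tests G"
        unfolding tests_def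
      proof (intro CollectI conjI allI impI)
        show "(\<lambda>x. w x + v x) \<in> C0_pos" using testsD(1) t(1) v by (intro C0_pos_add) auto
        show "w x + v x \<le> 1" for x
          using testsD(2)[OF t(1), of x] testsD(2)[OF v, of x] testsD(3)[OF t(1), of x] testsD(3)[OF v, of x] by force
        show "w x + v x = 0" if "x \<notin> G" for x
          using testsD(3)[OF t(1), of x] testsD(3)[OF v, of x] that t(3) by auto
      qed
      then have "P (\<lambda>x. w x + v x) \<le> open_content G" by (rule open_content_upper)
      then show "P v \<le> open_content G - P w"
        using P_add[OF testsD(1)[OF t(1)] testsD(1)[OF v]] by simp
    qed
    moreover have "outer (G - V) \<le> open_content (G - {x. d \<le> u x})"
      using oG t(3) by (intro outer_lower) auto
    ultimately show "P u \<le> open_content G - outer (G - V) + C * d" using t(4) by simp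
  qed
  moreover have "outer (W \<inter> V) \<le> open_content (G \<inter> V)" using G V by (intro outer_lower) auto
  moreover have "outer (W - V) \<le> outer (G - V)" using G by (intro outer_mono) auto
  ultimately show "outer (W \<inter> V) + outer (W - V) \<le> open_content G" by simp
qed

definition riesz_measure :: "'x measure" where
  "riesz_measure = measure_of UNIV (sets borel) (\<lambda>A. ennreal (outer A))"

lemma measure_space_outer: "measure_space UNIV (sets borel) (\<lambda>A. ennreal (outer A))"
proof -
  interpret s: sigma_algebra "UNIV :: 'x set" "UNIV :: 'x set set"
    using sigma_algebra_Pow[of "UNIV :: 'x set"] by simp
  let ?L = "lambda_system UNIV UNIV (\<lambda>A::'x set. ennreal (outer A))"
  have ms: "measure_space UNIV ?L (\<lambda>A. ennreal (outer A))"
    by (rule s.caratheodory_lemma[OF outer_measure])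
  have "V \<in> ?L" if V: "open V" for V
    unfolding s.lambda_system_eq
  proof (intro CollectI conjI ballI)
    fix W
    have "outer W \<le> outer (W \<inter> V) + outer (W - V)"
      using outer_Un[of "W \<inter> V" "W - V"] by (simp add: Int_Diff_Un)
    then have "outer (W \<inter> V) + outer (W - V) = outer W" using outer_split_open[OF V, of W] by simp
    then show "ennreal (outer (W \<inter> V)) + ennreal (outer (W - V)) = ennreal (outer W)"
      by (simp add: outer_nonneg flip: ennreal_plus)
  qed simp
  moreover have "sigma_algebra UNIV ?L" using ms by (simp add: measure_space_def)
  ultimately have "sigma_sets UNIV {V. open V} \<subseteq> ?L"
    by (intro sigma_algebra.sigma_sets_subset) auto
  then have "sets borel \<subseteq> ?L" by (simp add: borel_def)
  moreover have "sigma_algebra UNIV (sets (borel :: 'x measure))"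
    using sets.sigma_algebra_axioms[of "borel :: 'x measure"] by simp
  ultimately show ?thesis using measure_down[OF ms] by blast
qed

lemma sets_riesz [simp, measurable_cong]: "sets riesz_measure = sets borel"
  and space_riesz [simp]: "space riesz_measure = UNIV"
  unfolding riesz_measure_def
  using sets.sigma_sets_eq[of "borel::'x measure"] by (simp_all add: sets_measure_of_conv space_measure_of_conv)

lemma emeasure_riesz: "A \<in> sets borel \<Longrightarrow> emeasure riesz_measure A = ennreal (outer A)"
  using measure_space_outer
  by (intro emeasure_measure_of[OF riesz_measure_def]) (auto simp: measure_space_def)

lemma measure_riesz: "A \<in> sets borel \<Longrightarrow> measure riesz_measure A = outer A"
  by (simp add: measure_def emeasure_riesz outer_nonneg)

lemma finite_riesz: "finite_measure riesz_measure"
  by (rule finite_measureI) (simp add: emeasure_riesz)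

lemma outer_compact_ge:
  assumes "compact K" "u \<in> tests K" shows "P u \<le> outer K"
proof (rule outer_greatest)
  fix V assume "K \<subseteq> V"
  then have "u \<in> tests V" using assms unfolding tests_def by blast
  then show "P u \<le> open_content V" by (rule open_content_upper)
qed

text \<open>Outer approximation is built into \<open>outer\<close>. For the inner one,
  \<open>W\<close> is an open set slightly larger than the complement of \<open>A\<close>, and
  \<open>K\<close> is a compact set carrying almost all mass of the space. Then \<open>K - W\<close>
  is compact and lies in \<open>A\<close>.\<close>

lemma radon_riesz: "radon riesz_measure"
proof -
  interpret finite_measure riesz_measure by (rule finite_riesz)
  have "\<exists>K V. compact K \<and> open V \<and> K \<subseteq> A \<and> A \<subseteq> V \<and> measure riesz_measure (V - K) < e"
    if A: "A \<in> sets borel" and e: "e > 0" for A e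
  proof -
    have split: "measure riesz_measure (V - B) = outer V - outer B" if "V \<in> sets borel" "B \<in> sets borel" "B \<subseteq> V" for V B
      using finite_measure_Diff[of V B] that by (simp add: measure_riesz)
    obtain V where V: "open V" "A \<subseteq> V" "open_content V < outer A + e/3" using outer_close[of "e/3" A] e by (metis divide_pos_pos zero_less_numeral)
    obtain W where W: "open W" "- A \<subseteq> W" "open_content W < outer (- A) + e/3" using outer_close[of "e/3" "-A"] e by (metis divide_pos_pos zero_less_numeral)
    \<comment> \<open>Three errors of size \<open>e/3\<close> are affordable. The third consists of
      \<open>e/6\<close> for the choice of \<open>u\<close> and \<open>C * d < e/6\<close> for
      truncating it.\<close>
    define d where "d = e / (6 * (C + 1))"
    have d: "0 < d" "C * d < e / 6" using e C_nonneg by (auto simp: d_def field_simps)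
    have "\<exists>u. u \<in> tests UNIV \<and> open_content UNIV - e / 6 < P u"
    proof (rule ccontr)
      assume "\<not> ?thesis"
      then have "open_content UNIV \<le> open_content UNIV - e / 6"
        by (intro open_content_least) (meson not_less)
      then show False using e by simp
    qed
    then obtain u where u: "u \<in> tests UNIV" "open_content UNIV - e / 6 < P u" by blast
    define K where "K = {x. d \<le> u x}"
    note t = truncation[OF u(1) d(1), folded K_def]
    have K: "outer K > open_content UNIV - e / 3"
      using outer_compact_ge[OF t(2,1)] t(4) u(2) d(2) by linarith
    have s: "V \<in> sets borel" "W \<in> sets borel" "K \<in> sets borel" using V W t by (auto intro: borel_compact_t2)
    have "V - (K - W) \<subseteq> (V - A) \<union> ((W - (- A)) \<union> (UNIV - K))" by auto
    then have "measure riesz_measure (V - (K - W)) \<le> measure riesz_measure ((V - A) \<union> ((W - (- A)) \<union> (UNIV - K)))"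
      using s A by (intro finite_measure_mono) auto
    also have "\<dots> \<le> measure riesz_measure (V - A) + measure riesz_measure ((W - (- A)) \<union> (UNIV - K))"
      using s A by (intro measure_Un_le) auto
    also have "measure riesz_measure ((W - (- A)) \<union> (UNIV - K)) \<le>
        measure riesz_measure (W - (- A)) + measure riesz_measure (UNIV - K)"
      using s A by (intro measure_Un_le) auto
    also have "measure riesz_measure (V - A) + (measure riesz_measure (W - (- A)) + measure riesz_measure (UNIV - K)) < e"
      using V W K s A split[of V A] split[of W "-A"] split[of UNIV K] by (simp add: outer_open)
    finally have "measure riesz_measure (V - (K - W)) < e" by simp
    moreover have "compact (K - W)" using t(2) W compact_diff by blast
    moreover have "K - W \<subseteq> A" using W by auto
    ultimately show ?thesis using V by blast
  qed
  then show ?thesis using finite_riesz by (auto simp: radon_def)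
qed

end

section \<open>Integration against the representing measure\<close>

lemma C0_pos_bounded_borel: "f \<in> C0_pos \<Longrightarrow> f \<in> bounded_borel"
  by (simp add: C0_pos_def C0_bounded_borel)

lemma C0_pos_scale_nat: "f \<in> C0_pos \<Longrightarrow> (\<lambda>x. real n * f x) \<in> C0_pos"
  using C0_dominated[of f "\<lambda>x. real n * f x" "real n", OF _ continuous_on_mult_left]
  by (auto simp: C0_pos_def abs_mult C0_continuous)

context positive_functional
begin

lemma additive_scale_nat:
  assumes add: "\<And>f g. f \<in> C0_pos \<Longrightarrow> g \<in> C0_pos \<Longrightarrow> Q (\<lambda>x. f x + g x) = Q f + (Q g :: real)"
    and f: "f \<in> C0_pos"
  shows "Q (\<lambda>x. real n * f x) = real n * Q f"
proof (induction n)
  case 0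
  have "(\<lambda>x. 0) \<in> C0_pos" by (simp add: C0_pos_def C0_zero)
  from add[OF this this] show ?case by simp
next
  case (Suc n)
  have "Q (\<lambda>x. real n * f x + f x) = Q (\<lambda>x. real n * f x) + Q f"
    by (rule add[OF C0_pos_scale_nat[OF f] f])
  then show ?case using Suc by (simp add: algebra_simps)
qed

lemma additive_sum:
  fixes n :: nat
  assumes add: "\<And>f g. f \<in> C0_pos \<Longrightarrow> g \<in> C0_pos \<Longrightarrow> Q (\<lambda>x. f x + g x) = Q f + (Q g :: real)"
    and f: "\<And>k. f k \<in> C0_pos"
  shows "Q (\<lambda>x. \<Sum>k<n. f k x) = (\<Sum>k<n. Q (f k)) \<and> (\<lambda>x. \<Sum>k<n. f k x) \<in> C0_pos"
proof (induction n)
  case 0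
  have "(\<lambda>x. 0) \<in> C0_pos" by (simp add: C0_pos_def C0_zero)
  from add[OF this this] this show ?case by simp
next
  case (Suc n)
  then show ?case using add[of "\<lambda>x. \<Sum>k<n. f k x" "f n"] C0_pos_add[of "\<lambda>x. \<Sum>k<n. f k x" "f n"] f by simp
qed

text \<open>Isolates what \<open>P\<close> and integration against \<open>riesz_measure\<close> have
  in common, so that one comparison argument can be run in both directions.\<close>

definition squeezed :: "(('x \<Rightarrow> real) \<Rightarrow> real) \<Rightarrow> bool" where
  "squeezed Q \<longleftrightarrow> (\<forall>f\<in>C0_pos. \<forall>g\<in>C0_pos. Q (\<lambda>x. f x + g x) = Q f + Q g) \<and>
     (\<forall>V u. open V \<longrightarrow> u \<in> tests V \<longrightarrow> Q u \<le> open_content V) \<and>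
     (\<forall>V u. open V \<longrightarrow> u \<in> C0_pos \<longrightarrow> (\<forall>x\<in>V. u x = 1) \<longrightarrow> open_content V \<le> Q u)"

text \<open>Layer cake: cut \<open>g\<close> into slices of height \<open>1/N\<close>; the slice above level \<open>k/N\<close> is squeezed
  between multiples of the indicators of \<open>{g > (k+1)/N}\<close> and \<open>{g > k/N}\<close>.\<close>
lemma layer_cake:
  assumes Q: "squeezed Q"
    and g: "g \<in> C0_pos" and B: "\<And>x. g x \<le> real m" and N: "N > 0"
  defines "V \<equiv> \<lambda>k. {x. real k / real N < g x}"
  shows "real N * Q g \<le> (\<Sum>k<m*N. open_content (V k))"
    "(\<Sum>k<m*N. open_content (V (Suc k))) \<le> real N * Q g"
proof -
  have add: "Q (\<lambda>x. f x + g x) = Q f + Q g" if "f \<in> C0_pos" "g \<in> C0_pos" for f g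
    using Q that by (simp add: squeezed_def)
  have up: "Q u \<le> open_content V" if "open V" "u \<in> tests V" for u V
    using Q that by (simp add: squeezed_def)
  have lo: "open_content V \<le> Q u" if "open V" "u \<in> C0_pos" "\<And>x. x \<in> V \<Longrightarrow> u x = 1" for u V
    using Q that by (simp add: squeezed_def)
  have cg: "continuous_on UNIV g" using g by (rule C0_pos_continuous)
  have g0: "0 \<le> g x" for x using g by (simp add: C0_pos_def)
  have oV: "open (V k)" for k
    unfolding V_def by (intro open_Collect_less continuous_intros cg)
  define s where "s k x = min (max (g x - real k / real N) 0) (1 / real N)" for k x
  have sk: "s k \<in> C0_pos" for k
  proof (rule C0_pos_dominated[OF g])
    show "continuous_on UNIV (s k)" unfolding s_def by (intro continuous_intros cg)
    show "s k x \<le> g x" for x 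
    proof -
      have "max (g x - real k / real N) 0 \<le> g x" using g0[of x] by simp
      then show ?thesis unfolding s_def by (rule min.coboundedI1)
    qed
  qed (simp add: s_def)
  have t: "(\<lambda>x. real N * s k x) \<in> tests (V k)" for k
    unfolding tests_def
  proof (intro CollectI conjI allI impI C0_pos_scale_nat sk)
    have "real N * s k x \<le> real N * (1 / real N)" for x
      unfolding s_def by (intro mult_left_mono) auto
    then show "real N * s k x \<le> 1" for x using N by simp
  qed (simp add: s_def V_def)
  have one: "real N * s k x = 1" if "x \<in> V (Suc k)" for k x
  proof -
    have "1 / real N \<le> g x - real k / real N" using that by (simp add: V_def add_divide_distrib)
    then have "s k x = 1 / real N" unfolding s_def by simp
    then show ?thesis using N by simp
  qed
  have "(\<Sum>k<n. s k x) = min (g x) (real n / real N)" for n x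
  proof (induction n)
    case (Suc n)
    have slice: "min a p + min (max (a - p) 0) q = min a (p + q)" if "0 < q" for a p q :: real
      using that by (auto simp: min_def max_def)
    show ?case
      using slice[of "1 / real N" "g x" "real n / real N"] N Suc
      by (simp add: s_def add_divide_distrib add.commute)
  qed (use g0 in simp)
  moreover have "min (g x) (real (m*N) / real N) = g x" for x using B[of x] N by simp
  ultimately have gs: "g = (\<lambda>x. \<Sum>k<m*N. s k x)" by (simp add: fun_eq_iff)
  have "Q g = (\<Sum>k<m*N. Q (s k))"
    using additive_sum[where Q=Q and f=s and n="m*N", OF add sk] gs by metis
  moreover have "Q (\<lambda>x. real N * s k x) = real N * Q (s k)" for k
    by (rule additive_scale_nat[where Q=Q, OF add sk])
  ultimately have "real N * Q g = (\<Sum>k<m*N. Q (\<lambda>x. real N * s k x))"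
    by (simp add: sum_distrib_left)
  then show "real N * Q g \<le> (\<Sum>k<m*N. open_content (V k))"
    "(\<Sum>k<m*N. open_content (V (Suc k))) \<le> real N * Q g"
    using up[OF oV t] lo[OF oV testsD(1)[OF t] one] by (auto intro!: sum_mono)
qed

text \<open>The upper sum for \<open>Q\<close> and the lower sum for \<open>R\<close> differ by an
  index shift. The difference telescopes to at most \<open>C\<close>, and division by
  \<open>N\<close> makes it negligible.\<close>

lemma layer_cake_unique:
  assumes Q: "squeezed Q" and R: "squeezed R"
    and g: "g \<in> C0_pos"
  shows "Q g \<le> R g"
proof -
  obtain B where B: "\<And>x. norm (g x) \<le> B" using bounded_borelE[OF C0_pos_bounded_borel[OF g]] by metis
  obtain m where m: "B \<le> real m" using real_arch_simple by blast
  have gm: "g x \<le> real m" for x using B[of x] m by simp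
  have key: "Q g - R g \<le> C / real N" if N: "N > 0" for N :: nat
  proof -
    let ?o = "\<lambda>k. open_content {x. real k / real N < g x}"
    have "real N * (Q g - R g) \<le> (\<Sum>k<m*N. ?o k - ?o (Suc k))"
      using layer_cake(1)[where Q=Q, OF Q g gm N] layer_cake(2)[where Q=R, OF R g gm N]
      unfolding sum_subtractf right_diff_distrib by linarith
    also have "\<dots> = ?o 0 - ?o (m*N)" by (rule sum_lessThan_telescope')
    also have "\<dots> \<le> C" using open_content_le[of "{x. real 0 / real N < g x}"] open_content_nonneg[of "{x. real (m*N) / real N < g x}"] by linarith
    finally show ?thesis using N by (simp add: field_simps)
  qed
  have "(\<lambda>n. C / real n) \<longlonglongrightarrow> 0" by (rule lim_const_over_n)
  moreover have "\<forall>\<^sub>F n in sequentially. Q g - R g \<le> C / real n"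
    using key by (auto simp: eventually_sequentially intro!: exI[of _ 1])
  ultimately have "Q g - R g \<le> 0"
    by (intro tendsto_le[OF trivial_limit_sequentially _ tendsto_const]) auto
  then show ?thesis by simp
qed

lemma integral_riesz:
  assumes g: "g \<in> C0_pos"
  shows "(\<integral>x. g x \<partial>riesz_measure) = P g"
proof -
  interpret finite_measure riesz_measure by (rule finite_riesz)
  note int = bounded_borel_integrable[OF C0_pos_bounded_borel finite_riesz sets_riesz]
  have P: "open_content V \<le> P u" if "u \<in> C0_pos" "\<And>x. x \<in> V \<Longrightarrow> u x = 1" for u V
  proof (rule open_content_least, rule P_mono)
    fix v x assume v: "v \<in> tests V"
    show "v \<in> C0_pos" using v by (rule testsD)
    show "v x \<le> u x" using that testsD(2,3)[OF v, of x] by (cases "x \<in> V") (auto simp: C0_pos_def)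
  qed (rule that)
  have ind: "(\<integral>x. indicat_real V x \<partial>riesz_measure) = open_content V" "integrable riesz_measure (indicat_real V)"
    if "open V" for V
    using that by (simp_all add: measure_riesz outer_open less_top[symmetric])
  let ?R = "\<lambda>g. \<integral>x. g x \<partial>riesz_measure"
  have R: "?R (\<lambda>x. f x + g x) = ?R f + ?R g" if "f \<in> C0_pos" "g \<in> C0_pos" for f g
    using that int by (simp add: Bochner_Integration.integral_add)
  have R1: "?R u \<le> open_content V" if "open V" "u \<in> tests V" for u V
    unfolding ind(1)[OF that(1), symmetric]
    by (rule integral_mono[OF int[OF testsD(1)[OF that(2)]] ind(2)[OF that(1)]])
       (use testsD(2,3)[OF that(2)] in \<open>auto simp: indicator_def\<close>)
  have R2: "open_content V \<le> ?R u" if "open V" "u \<in> C0_pos" "\<And>x. x \<in> V \<Longrightarrow> u x = 1" for u V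
    unfolding ind(1)[OF that(1), symmetric]
    by (rule integral_mono[OF ind(2)[OF that(1)] int[OF that(2)]])
       (use that in \<open>auto simp: indicator_def C0_pos_def\<close>)
  have "squeezed P" unfolding squeezed_def by (simp add: P_add open_content_upper P)
  moreover have "squeezed ?R" unfolding squeezed_def by (simp add: R R1 R2)
  ultimately have "P g \<le> ?R g" "?R g \<le> P g" using g by (simp_all add: layer_cake_unique)
  then show ?thesis by simp
qed

end

section \<open>Bounded functionals that need not be positive\<close>

lemma C0_pos_minus_parts:
  assumes "f \<in> C0"
  shows "(\<lambda>x. max 0 (f x)) \<in> C0_pos" "(\<lambda>x. max 0 (- f x :: real)) \<in> C0_pos"
proof -
  have "(\<lambda>x. max 0 (f x)) \<in> C0"
    by (rule C0_dominated[OF assms, where K=1]) (auto intro!: continuous_on_max C0_continuous[OF assms])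
  moreover have "(\<lambda>x. max 0 (- f x)) \<in> C0"
    by (rule C0_dominated[OF assms, where K=1])
       (auto intro!: continuous_on_max continuous_on_minus C0_continuous[OF assms])
  ultimately show "(\<lambda>x. max 0 (f x)) \<in> C0_pos" "(\<lambda>x. max 0 (- f x)) \<in> C0_pos"
    by (auto simp: C0_pos_def)
qed

text \<open>Jordan decomposition of a bounded functional: the positive part of \<open>L\<close> at \<open>g\<close> is the supremum of
  \<open>L u\<close> over \<open>0 \<le> u \<le> g\<close>.\<close>
lemma real_riesz:
  fixes L :: "('x::t2_space \<Rightarrow> real) \<Rightarrow> real"
  assumes lc: "locally_compact_space (euclidean :: 'x topology)"
    and add: "\<And>f g. f \<in> C0 \<Longrightarrow> g \<in> C0 \<Longrightarrow> L (\<lambda>x. f x + g x) = L f + L g"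
    and bound: "\<And>f B. f \<in> C0 \<Longrightarrow> (\<And>x. \<bar>f x\<bar> \<le> B) \<Longrightarrow> 0 \<le> B \<Longrightarrow> \<bar>L f\<bar> \<le> C * B"
    and C: "0 \<le> C"
  shows "\<exists>M N. radon M \<and> radon N \<and> (\<forall>f\<in>C0. L f = (\<integral>x. f x \<partial>M) - (\<integral>x. f x \<partial>N))"
proof -
  have sub: "u \<in> C0" if "u \<in> C0_pos" for u :: "'x \<Rightarrow> real" using that by (simp add: C0_pos_def)
  define I where "I g = {u \<in> C0_pos. \<forall>x. u x \<le> g x}" for g :: "'x \<Rightarrow> real"
  define P where "P g = (SUP u\<in>I g. L u)" for g
  have Ib: "L u \<le> C * B" if "u \<in> I g" "\<And>x. g x \<le> B" "0 \<le> B" for u g B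
  proof -
    have u: "u \<in> C0_pos" "\<And>x. u x \<le> g x" using that(1) by (auto simp: I_def)
    have "\<bar>u x\<bar> \<le> B" for x using u(2)[of x] that(2)[of x] u(1) by (simp add: C0_pos_def)
    then show ?thesis using bound[OF sub[OF u(1)] _ that(3)] by (meson abs_le_D1)
  qed
  have bdd: "bdd_above (L ` I g)" if g: "g \<in> C0_pos" for g
  proof -
    obtain B where B: "B > 0" "\<And>x. norm (g x) \<le> B" using bounded_borelE[OF C0_pos_bounded_borel[OF g]] by metis
    then have "g x \<le> B" for x by (metis abs_le_D1 real_norm_def)
    then show ?thesis using Ib B(1) by (intro bdd_aboveI2[where M="C*B"]) auto
  qed
  have z: "(\<lambda>x. 0) \<in> I g" if "g \<in> C0_pos" for g using that by (auto simp: I_def C0_pos_def C0_zero)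
  have up: "L u \<le> P g" if "u \<in> I g" "g \<in> C0_pos" for u g
    unfolding P_def by (rule cSUP_upper[OF that(1) bdd[OF that(2)]])
  have least: "P g \<le> c" if "\<And>u. u \<in> I g \<Longrightarrow> L u \<le> c" "g \<in> C0_pos" for g c
    unfolding P_def using z[OF that(2)] that(1) by (intro cSUP_least) auto
  have L0: "L (\<lambda>x. 0) = 0" using add[OF C0_zero C0_zero] by simp
  have Padd: "P (\<lambda>x. f x + g x) = P f + P g" if f: "f \<in> C0_pos" and g: "g \<in> C0_pos" for f g
  proof (rule antisym)
    have fg: "(\<lambda>x. f x + g x) \<in> C0_pos" using f g by (rule C0_pos_add)
    show "P (\<lambda>x. f x + g x) \<le> P f + P g"
    proof (rule least[OF _ fg])
      fix u assume u: "u \<in> I (\<lambda>x. f x + g x)"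
      then have up': "u \<in> C0_pos" and ule: "\<And>x. u x \<le> f x + g x" by (auto simp: I_def)
      \<comment> \<open>Riesz decomposition: \<open>u \<le> f + g\<close> is split into
        \<open>min u f \<le> f\<close> and a remainder that is at most \<open>g\<close>.\<close>
      have m: "(\<lambda>x. min (u x) (f x)) \<in> C0_pos"
      proof (rule C0_pos_dominated[OF up'])
        show "continuous_on UNIV (\<lambda>x. min (u x) (f x))"
          by (intro continuous_on_min C0_pos_continuous up' f)
        show "0 \<le> min (u x) (f x)" for x using up' f by (simp add: C0_pos_def)
      qed simp
      have d: "(\<lambda>x. u x - min (u x) (f x)) \<in> C0_pos" by (rule C0_pos_diff[OF up' m]) simp
      have "L u = L (\<lambda>x. min (u x) (f x) + (u x - min (u x) (f x)))" by simp
      also have "\<dots> = L (\<lambda>x. min (u x) (f x)) + L (\<lambda>x. u x - min (u x) (f x))"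
        by (rule add[OF sub[OF m] sub[OF d]])
      also have "\<dots> \<le> P f + P g"
      proof (intro add_mono up f g)
        show "(\<lambda>x. min (u x) (f x)) \<in> I f" using m by (simp add: I_def)
        have "u x - min (u x) (f x) \<le> g x" for x using ule[of x] g by (simp add: min_def C0_pos_def)
        then show "(\<lambda>x. u x - min (u x) (f x)) \<in> I g" using d by (simp add: I_def)
      qed
      finally show "L u \<le> P f + P g" .
    qed
    have "P f \<le> P (\<lambda>x. f x + g x) - P g"
    proof (rule least[OF _ f])
      fix u assume u: "u \<in> I f"
      have "P g \<le> P (\<lambda>x. f x + g x) - L u"
      proof (rule least[OF _ g])
        fix v assume v: "v \<in> I g"
        have "(\<lambda>x. u x + v x) \<in> I (\<lambda>x. f x + g x)"
          using u v C0_pos_add[of u v] by (simp add: I_def add_mono)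
        then have "L (\<lambda>x. u x + v x) \<le> P (\<lambda>x. f x + g x)" using fg by (rule up)
        moreover have "L (\<lambda>x. u x + v x) = L u + L v" using u v by (intro add sub) (simp_all add: I_def)
        ultimately show "L v \<le> P (\<lambda>x. f x + g x) - L u" by simp
      qed
      then show "L u \<le> P (\<lambda>x. f x + g x) - P g" by simp
    qed
    then show "P f + P g \<le> P (\<lambda>x. f x + g x)" by simp
  qed
  have P0: "0 \<le> P f" if "f \<in> C0_pos" for f using up[OF z[OF that] that] L0 by simp
  have PB: "P f \<le> C * B" if "f \<in> C0_pos" "\<And>x. f x \<le> B" "0 \<le> B" for f B
    by (rule least[OF _ that(1)]) (rule Ib[OF _ that(2,3)])
  have self: "L f \<le> P f" if "f \<in> C0_pos" for f using that by (intro up) (auto simp: I_def)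
  interpret P: positive_functional P C
  proof unfold_locales
    show "P (\<lambda>x. f x + g x) = P f + P g" if "f \<in> C0_pos" "g \<in> C0_pos" for f g by (rule Padd[OF that])
    show "P f \<le> C * B" if "f \<in> C0_pos" "\<And>x. f x \<le> B" "0 \<le> B" for f B by (rule PB[OF that])
  qed (use lc C P0 in auto)
  \<comment> \<open>\<open>P - L\<close> is the negative part; its bound adds those of
    \<open>P\<close> and \<open>L\<close>.\<close>
  interpret N: positive_functional "\<lambda>f. P f - L f" "2 * C"
  proof unfold_locales
    show "P (\<lambda>x. f x + g x) - L (\<lambda>x. f x + g x) = P f - L f + (P g - L g)" if "f \<in> C0_pos" "g \<in> C0_pos" for f g
      using Padd[OF that] add[OF sub[OF that(1)] sub[OF that(2)]] by simp
    show "P f - L f \<le> 2 * C * B" if "f \<in> C0_pos" "\<And>x. f x \<le> B" "0 \<le> B" for f B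
    proof -
      have "\<bar>L f\<bar> \<le> C * B" using that by (intro bound sub) (auto simp: C0_pos_def)
      then show ?thesis using PB[OF that] by linarith
    qed
  qed (use lc C self in auto)
  have "L f = (\<integral>x. f x \<partial>P.riesz_measure) - (\<integral>x. f x \<partial>N.riesz_measure)" if f: "f \<in> C0" for f
  proof -
    let ?p = "\<lambda>x. max 0 (f x)" and ?n = "\<lambda>x. max 0 (- f x)"
    note pn = C0_pos_minus_parts[OF f]
    have e: "f x + ?n x = ?p x" for x by simp
    have i: "(\<integral>x. f x \<partial>K) = (\<integral>x. ?p x \<partial>K) - (\<integral>x. ?n x \<partial>K)" if "finite_measure K" "sets K = sets borel" for K
    proof -
      have "(\<integral>x. ?p x - ?n x \<partial>K) = (\<integral>x. ?p x \<partial>K) - (\<integral>x. ?n x \<partial>K)"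
        using pn that by (intro Bochner_Integration.integral_diff bounded_borel_integrable C0_pos_bounded_borel)
      moreover have "(\<lambda>x. ?p x - ?n x) = f" by (auto simp: fun_eq_iff)
      ultimately show ?thesis by simp
    qed
    have "L (\<lambda>x. f x + ?n x) = L f + L ?n" by (rule add[OF f sub[OF pn(2)]])
    then have "L f = L ?p - L ?n" unfolding e by simp
    then show ?thesis
      using P.integral_riesz[OF pn(1)] P.integral_riesz[OF pn(2)] N.integral_riesz[OF pn(1)] N.integral_riesz[OF pn(2)]
        i[OF P.finite_riesz P.sets_riesz] i[OF N.finite_riesz N.sets_riesz] by simp
  qed
  then show ?thesis using P.radon_riesz N.radon_riesz by blast
qed

lemma C0_of_real: "f \<in> C0 \<Longrightarrow> (\<lambda>x. complex_of_real (f x)) \<in> C0"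
  by (rule C0_dominated[where K=1]) (auto intro!: continuous_intros C0_continuous)

lemma C0_Re_Im:
  assumes "f \<in> C0" shows "(\<lambda>x. Re (f x)) \<in> C0" "(\<lambda>x. Im (f x)) \<in> C0"
  by (rule C0_dominated[OF assms, where K=1];
      auto intro!: continuous_intros C0_continuous[OF assms] simp: abs_Re_le_cmod abs_Im_le_cmod)+

lemma C0_cmult: 
  fixes f :: "'x::topological_space \<Rightarrow> complex"
  assumes "f \<in> C0" shows "(\<lambda>x. c * f x) \<in> C0"
  by (rule C0_dominated[OF assms, where K="cmod c"])
     (auto intro!: continuous_intros C0_continuous[OF assms] simp: norm_mult)

text \<open>On real functions the real and the imaginary part of \<open>L\<close> are each a
  difference of two Radon integrals. The four measures together define the extension, and their sum
  dominates it.\<close>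

theorem riesz_C0:
  fixes L :: "('x::t2_space \<Rightarrow> complex) \<Rightarrow> complex"
  assumes lc: "locally_compact_space (euclidean :: 'x topology)"
    and add: "\<And>f g. f \<in> C0 \<Longrightarrow> g \<in> C0 \<Longrightarrow> L (\<lambda>x. f x + g x) = L f + L g"
    and scale: "\<And>c f. f \<in> C0 \<Longrightarrow> L (\<lambda>x. c * f x) = c * L f"
    and bound: "\<And>f B. f \<in> C0 \<Longrightarrow> (\<And>x. cmod (f x) \<le> B) \<Longrightarrow> 0 \<le> B \<Longrightarrow> cmod (L f) \<le> C * B"
    and C: "0 \<le> C"
  shows "\<exists>\<Lambda> N. dominated \<Lambda> N \<and> (\<forall>f\<in>C0. \<Lambda> f = L f)"
proof -
  have "\<exists>M N. radon M \<and> radon N \<and> (\<forall>f\<in>C0. Re (L (\<lambda>x. of_real (f x))) = (\<integral>x. f x \<partial>M) - (\<integral>x. f x \<partial>N))"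
  proof (rule real_riesz[OF lc _ _ C])
    show "Re (L (\<lambda>x. of_real (f x + g x))) = Re (L (\<lambda>x. of_real (f x))) + Re (L (\<lambda>x. of_real (g x)))"
      if "f \<in> C0" "g \<in> C0" for f g
      using add[OF C0_of_real[OF that(1)] C0_of_real[OF that(2)]] by simp
    show "\<bar>Re (L (\<lambda>x. of_real (f x)))\<bar> \<le> C * B" if "f \<in> C0" "\<And>x. \<bar>f x\<bar> \<le> B" "0 \<le> B" for f B
      using bound[OF C0_of_real[OF that(1)], of B] that(2,3) abs_Re_le_cmod order_trans by (metis norm_of_real)
  qed
  then obtain M1 M2 where M: "radon M1" "radon M2"
     "\<And>f. f \<in> C0 \<Longrightarrow> Re (L (\<lambda>x. of_real (f x))) = (\<integral>x. f x \<partial>M1) - (\<integral>x. f x \<partial>M2)" by blast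
  have "\<exists>M N. radon M \<and> radon N \<and> (\<forall>f\<in>C0. Im (L (\<lambda>x. of_real (f x))) = (\<integral>x. f x \<partial>M) - (\<integral>x. f x \<partial>N))"
  proof (rule real_riesz[OF lc _ _ C])
    show "Im (L (\<lambda>x. of_real (f x + g x))) = Im (L (\<lambda>x. of_real (f x))) + Im (L (\<lambda>x. of_real (g x)))"
      if "f \<in> C0" "g \<in> C0" for f g
      using add[OF C0_of_real[OF that(1)] C0_of_real[OF that(2)]] by simp
    show "\<bar>Im (L (\<lambda>x. of_real (f x)))\<bar> \<le> C * B" if "f \<in> C0" "\<And>x. \<bar>f x\<bar> \<le> B" "0 \<le> B" for f B
      using bound[OF C0_of_real[OF that(1)], of B] that(2,3) abs_Im_le_cmod order_trans by (metis norm_of_real)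
  qed
  then obtain N1 N2 where N: "radon N1" "radon N2"
     "\<And>f. f \<in> C0 \<Longrightarrow> Im (L (\<lambda>x. of_real (f x))) = (\<integral>x. f x \<partial>N1) - (\<integral>x. f x \<partial>N2)" by blast
  define \<Lambda> where "\<Lambda> f = ((\<integral>x. f x \<partial>M1) - (\<integral>x. f x \<partial>M2)) + \<i> * ((\<integral>x. f x \<partial>N1) - (\<integral>x. f x \<partial>N2))"
    for f :: "'x \<Rightarrow> complex"
  define R where "R = add_measure (add_measure M1 M2) (add_measure N1 N2)"
  have r: "finite_measure K \<and> sets K = sets borel" if "K \<in> {M1, M2, N1, N2}" for K
    using that M N by (auto simp: radon_def)
  note rf = r[THEN conjunct1] and rs = r[THEN conjunct2]
  have int: "integrable K f" if "f \<in> bounded_borel" "K \<in> {M1, M2, N1, N2}" for f :: "'x \<Rightarrow> complex" and K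
    using bounded_borel_integrable that r by blast
  have "dominated \<Lambda> R"
    unfolding dominated_def
  proof (intro conjI ballI)
    show "linear_on_bb \<Lambda>"
      unfolding linear_on_bb_def \<Lambda>_def
      by (simp add: Bochner_Integration.integral_add int algebra_simps)
    show "radon R" unfolding R_def by (intro radon_add_measure M N)
    fix g :: "'x \<Rightarrow> complex" assume g: "g \<in> bounded_borel"
    have *: "cmod (LINT x|K. g x) \<le> (\<integral>x. cmod (g x) \<partial>K)" for K by (rule integral_norm_bound)
    have "cmod (\<Lambda> g) \<le> (cmod (\<integral>x. g x \<partial>M1) + cmod (\<integral>x. g x \<partial>M2)) + (cmod (\<integral>x. g x \<partial>N1) + cmod (\<integral>x. g x \<partial>N2))"
      unfolding \<Lambda>_def
      by (intro norm_triangle_le add_mono norm_triangle_ineq4) (simp add: norm_mult norm_triangle_ineq4)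
    also have "\<dots> \<le> ((\<integral>x. cmod (g x) \<partial>M1) + (\<integral>x. cmod (g x) \<partial>M2)) + ((\<integral>x. cmod (g x) \<partial>N1) + (\<integral>x. cmod (g x) \<partial>N2))"
      by (intro add_mono *)
    also have "\<dots> = (\<integral>x. cmod (g x) \<partial>R)"
      unfolding R_def
      by (simp add: integral_add_measure finite_add_measure rf rs bounded_borel_cmod[OF g])
    finally show "cmod (\<Lambda> g) \<le> (\<integral>x. cmod (g x) \<partial>R)" .
  qed
  moreover have "\<Lambda> f = L f" if f: "f \<in> C0" for f
  proof -
    have re: "\<Lambda> (\<lambda>x. of_real (u x)) = L (\<lambda>x. of_real (u x))" if u: "u \<in> C0" for u
    proof -
      have "\<Lambda> (\<lambda>x. of_real (u x)) = Complex (Re (L (\<lambda>x. of_real (u x)))) (Im (L (\<lambda>x. of_real (u x))))"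
        unfolding \<Lambda>_def M(3)[OF u] N(3)[OF u] by (simp add: complex_eq_iff)
      then show ?thesis by simp
    qed
    let ?r = "\<lambda>x. complex_of_real (Re (f x))" and ?i = "\<lambda>x. complex_of_real (Im (f x))"
    note ri = C0_Re_Im[OF f, THEN C0_of_real]
    have f_eq: "f = (\<lambda>x. ?r x + \<i> * ?i x)" by (auto simp: fun_eq_iff complex_eq_iff)
    have "L f = L ?r + \<i> * L ?i"
      by (subst f_eq, subst add[OF ri(1) C0_cmult[OF ri(2)]], subst scale[OF ri(2)]) simp
    moreover have "\<Lambda> f = \<Lambda> ?r + \<i> * \<Lambda> ?i"
    proof -
      have l: "linear_on_bb \<Lambda>" by (rule dominatedD[OF \<open>dominated \<Lambda> R\<close>])
      show ?thesis
        by (subst f_eq, subst linear_on_bb_add[OF l])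
           (simp_all add: linear_on_bb_cmult[OF l] bounded_borel_cmult C0_bounded_borel ri)
    qed
    ultimately show ?thesis using re[OF C0_Re_Im(1)[OF f]] re[OF C0_Re_Im(2)[OF f]] by simp
  qed
  ultimately show ?thesis by blast
qed

text \<open>A Urysohn function between \<open>K\<close> and \<open>V\<close> differs from the
  indicator only on \<open>V - K\<close>, by at most 1.\<close>

lemma dominated_indicator_approx:
  fixes L :: "('x::t2_space \<Rightarrow> complex) \<Rightarrow> complex"
  assumes lc: "locally_compact_space (euclidean :: 'x topology)"
    and d: "dominated L N" and A: "A \<in> sets borel" and e: "e > 0"
  obtains u where "u \<in> C0" "\<And>x. cmod (u x) \<le> 1" "cmod (L (indicator A) - L u) \<le> e"
proof -
  note D = dominatedD[OF d]
  interpret finite_measure N by (rule D)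
  have sp: "space N = UNIV" using D(3) sets_eq_imp_space_eq by fastforce
  obtain K V where K: "compact K" "open V" "K \<subseteq> A" "A \<subseteq> V" "measure N (V - K) < e"
    using radonE[OF D(2) A e] by metis
  have s: "K \<in> sets borel" "V \<in> sets borel" using K by (auto intro: borel_compact_t2)
  obtain v :: "'x \<Rightarrow> real" where v: "v \<in> C0" "\<And>x. 0 \<le> v x" "\<And>x. v x \<le> 1"
    "\<And>x. x \<in> K \<Longrightarrow> v x = 1" "\<And>x. x \<notin> V \<Longrightarrow> v x = 0"
    using Urysohn_C0[OF lc K(1,2)] K(3,4) by (metis subset_trans)
  define u where "u x = complex_of_real (v x)" for x
  have u: "u \<in> C0" unfolding u_def by (rule C0_of_real[OF v(1)])
  have iA: "(indicator A :: 'x \<Rightarrow> complex) \<in> bounded_borel" by (rule bounded_borel_indicator[OF A])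
  have "cmod (indicator A x - u x) \<le> indicat_real (V - K) x" for x
  proof -
    have "indicator A x - u x = complex_of_real (indicator A x - v x)" by (simp add: u_def indicator_def)
    then have "cmod (indicator A x - u x) = \<bar>indicator A x - v x\<bar>" by (simp only: norm_of_real)
    also have "\<dots> \<le> indicat_real (V - K) x"
      using v(2,3)[of x] v(4,5)[of x] K(3,4) by (auto simp: indicator_def)
    finally show ?thesis .
  qed
  moreover have df: "(\<lambda>x. indicator A x - u x) \<in> bounded_borel"
    using bounded_borel_add[OF iA bounded_borel_cmult[OF C0_bounded_borel[OF u], of "-1"]] by simp
  ultimately have "(\<integral>x. cmod (indicator A x - u x) \<partial>N) \<le> (\<integral>x. indicat_real (V - K) x \<partial>N)"
    using s D(3) by (intro integral_mono bounded_borel_integrable[OF bounded_borel_cmod D(4)])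
       (auto simp: less_top[symmetric])
  also have "\<dots> = measure N (V - K)" using sp by simp
  finally have "cmod (L (\<lambda>x. indicator A x - u x)) \<le> e" using D(5)[OF df] K(5) by simp
  then have "cmod (L (indicator A) - L u) \<le> e"
    using linear_on_bb_diff[OF D(1) iA C0_bounded_borel[OF u]] by simp
  moreover have "cmod (u x) \<le> 1" for x using v(2,3) by (simp add: u_def)
  ultimately show ?thesis using that u by blast
qed

lemma dominated_eq_0:
  fixes L :: "('x::t2_space \<Rightarrow> complex) \<Rightarrow> complex"
  assumes lc: "locally_compact_space (euclidean :: 'x topology)"
    and d: "dominated L N" and 0: "\<And>u. u \<in> C0 \<Longrightarrow> L u = 0" and g: "g \<in> bounded_borel"
  shows "L g = 0"
proof (rule linear_on_bb_eq_0[OF dominatedD(1)[OF d] dominated_bound[OF d] _ g])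
  fix A :: "'x set" assume A: "A \<in> sets borel"
  have "cmod (L (indicator A)) \<le> 0 + e" if "e > 0" for e
    using dominated_indicator_approx[OF lc d A that] 0 by (metis add_0 diff_zero)
  then have "cmod (L (indicator A)) \<le> 0" by (rule field_le_epsilon)
  then show "L (indicator A) = 0" by simp
qed

text \<open>The resulting constant does not involve the dominating measure, so it can be made
  uniform over families of functionals whose dominating measures are unrelated.\<close>

lemma dominated_indicator_bound:
  fixes L :: "('x::t2_space \<Rightarrow> complex) \<Rightarrow> complex"
  assumes lc: "locally_compact_space (euclidean :: 'x topology)"
    and d: "dominated L N" and A: "A \<in> sets borel"
    and b: "\<And>u. u \<in> C0 \<Longrightarrow> (\<And>x. cmod (u x) \<le> 1) \<Longrightarrow> cmod (L u) \<le> C"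
  shows "cmod (L (indicator A)) \<le> C"
proof (rule field_le_epsilon)
  fix e :: real assume "e > 0"
  then obtain u where u: "u \<in> C0" "\<And>x. cmod (u x) \<le> 1" "cmod (L (indicator A) - L u) \<le> e"
    using dominated_indicator_approx[OF lc d A] by metis
  then show "cmod (L (indicator A)) \<le> C + e"
    using b[OF u(1,2)] norm_triangle_sub[of "L (indicator A)" "L u"] by linarith
qed

section \<open>Haar measure on the unitary group\<close>

lemma cadj_nth [simp]: "cadj A $ i $ j = cnj (A $ j $ i)"
  by (simp add: cadj_def)

lemma cadj_cadj [simp]: "cadj (cadj A) = A"
  by (simp add: vec_eq_iff)

lemma cadj_mult: "cadj (A ** B) = cadj B ** cadj A"
  by (simp add: vec_eq_iff matrix_matrix_mult_def mult.commute)

lemma cadj_add: "cadj (A + B) = cadj A + cadj B"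
  by (simp add: vec_eq_iff)

lemma cadj_diff: "cadj (A - B) = cadj A - cadj B"
  by (simp add: vec_eq_iff)

lemma cadj_scaleR: "cadj (c *\<^sub>R A) = c *\<^sub>R cadj A"
  by (simp add: vec_eq_iff)

lemma cadj_mat [simp]: "cadj (mat c) = mat (cnj c)"
  by (auto simp: vec_eq_iff mat_def)

lemma norm_matrix_sq: "(norm (A :: complex^'n^'m))\<^sup>2 = (\<Sum>i\<in>UNIV. \<Sum>j\<in>UNIV. (cmod (A $ i $ j))\<^sup>2)"
  by (simp add: norm_vec_def L2_set_def sum_nonneg)

lemma norm_cadj [simp]: "norm (cadj A) = norm A"
proof -
  have "(norm (cadj A))\<^sup>2 = (norm A)\<^sup>2"
    unfolding norm_matrix_sq by (subst sum.swap) simp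
  then show ?thesis by simp
qed

text \<open>The norm on matrices is the Frobenius norm, which is submultiplicative by
  Cauchy-Schwarz. Since \<open>norm (mat 1)\<close> exceeds 1 in general, it appears explicitly in
  later bounds.\<close>

lemma norm_matrix_mult_le: "norm (A ** B :: complex^'n^'m) \<le> norm A * norm (B :: complex^'n^'k)"
proof (rule power2_le_imp_le)
  have "(cmod ((A ** B) $ i $ j))\<^sup>2 \<le> (\<Sum>k\<in>UNIV. (cmod (A $ i $ k))\<^sup>2) * (\<Sum>k\<in>UNIV. (cmod (B $ k $ j))\<^sup>2)" for i j
  proof -
    have "cmod ((A ** B) $ i $ j) \<le> (\<Sum>k\<in>UNIV. cmod (A $ i $ k) * cmod (B $ k $ j))"
      unfolding matrix_matrix_mult_def by (simp add: norm_sum[THEN order_trans] norm_mult sum_norm_le)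
    then have "(cmod ((A ** B) $ i $ j))\<^sup>2 \<le> (\<Sum>k\<in>UNIV. cmod (A $ i $ k) * cmod (B $ k $ j))\<^sup>2"
      by (intro power_mono) auto
    also have "\<dots> \<le> (\<Sum>k\<in>UNIV. (cmod (A $ i $ k))\<^sup>2) * (\<Sum>k\<in>UNIV. (cmod (B $ k $ j))\<^sup>2)"
      by (rule Cauchy_Schwarz_ineq_sum)
    finally show ?thesis .
  qed
  then have "(norm (A ** B))\<^sup>2 \<le>
      (\<Sum>i\<in>UNIV. \<Sum>j\<in>UNIV. (\<Sum>k\<in>UNIV. (cmod (A $ i $ k))\<^sup>2) * (\<Sum>k\<in>UNIV. (cmod (B $ k $ j))\<^sup>2))"
    unfolding norm_matrix_sq[of "A ** B"] by (intro sum_mono)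
  also have "\<dots> = (\<Sum>i\<in>UNIV. \<Sum>k\<in>UNIV. (cmod (A $ i $ k))\<^sup>2) * (\<Sum>j\<in>UNIV. \<Sum>k\<in>UNIV. (cmod (B $ k $ j))\<^sup>2)"
    by (simp add: sum_product)
  also have "(\<Sum>j\<in>UNIV. \<Sum>k\<in>UNIV. (cmod (B $ k $ j))\<^sup>2) = (norm B)\<^sup>2"
    unfolding norm_matrix_sq by (rule sum.swap)
  finally show "(norm (A ** B))\<^sup>2 \<le> (norm A * norm B)\<^sup>2"
    by (simp add: norm_matrix_sq power_mult_distrib)
qed simp

lemma norm_matrix_mult_mono:
  "norm A \<le> p \<Longrightarrow> norm B \<le> q \<Longrightarrow> norm (A ** B :: complex^'n^'m) \<le> p * q"
  using norm_matrix_mult_le[of A B] mult_mono[of "norm A" p "norm B" q] norm_ge_zero[of A] norm_ge_zero[of B]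
  by linarith

interpretation mm: bounded_bilinear "(**) :: complex^'k^'m \<Rightarrow> complex^'n^'k \<Rightarrow> complex^'n^'m"
proof
  show "\<exists>K. \<forall>A B. norm (A ** B :: complex^'n^'m) \<le> norm (A :: complex^'k^'m) * norm B * K"
    using norm_matrix_mult_le by (intro exI[of _ 1]) auto
qed (simp_all add: vec_eq_iff matrix_matrix_mult_def sum.distrib algebra_simps sum_distrib_left scaleR_sum_right)

lemma bounded_linear_cadj: "bounded_linear cadj"
  by (rule bounded_linear_intro[where K=1]) (simp_all add: cadj_add cadj_scaleR)

lemmas continuous_on_cadj [continuous_intros] = bounded_linear.continuous_on[OF bounded_linear_cadj]
lemmas continuous_on_matrix_mult [continuous_intros] = mm.continuous_on

text \<open>For square matrices a left inverse is also a right inverse.\<close>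

lemma unitaries_iff: "U \<in> unitaries \<longleftrightarrow> cadj U ** U = mat 1 \<and> U ** cadj U = mat 1"
  unfolding unitaries_def using matrix_left_right_inverse[of U "cadj U"] by auto

lemma unitaries_mult: "U \<in> unitaries \<Longrightarrow> V \<in> unitaries \<Longrightarrow> U ** V \<in> unitaries"
proof -
  assume U: "U \<in> unitaries" "V \<in> unitaries"
  have "cadj (U ** V) ** (U ** V) = cadj V ** (cadj U ** U) ** V"
    by (simp add: cadj_mult matrix_mul_assoc)
  then show ?thesis using U by (simp add: unitaries_def)
qed

lemma unitaries_cadj: "U \<in> unitaries \<Longrightarrow> cadj U \<in> unitaries"
  by (simp add: unitaries_iff)

text \<open>The squared Frobenius norm of \<open>B\<close> is the trace of
  \<open>cadj B ** B\<close>, which does not see a unitary factor on the left.\<close>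

lemma norm_unitary_left:
  assumes "U \<in> unitaries" shows "norm (U ** A) = norm (A :: complex^'n^'n)"
proof -
  have sq: "complex_of_real ((norm B)\<^sup>2) = (\<Sum>j\<in>UNIV. (cadj B ** B) $ j $ j)" for B :: "complex^'n^'n"
  proof -
    have "(norm B)\<^sup>2 = (\<Sum>j\<in>UNIV. \<Sum>i\<in>UNIV. (cmod (B $ i $ j))\<^sup>2)"
      unfolding norm_matrix_sq by (rule sum.swap)
    then show ?thesis
      by (simp add: matrix_matrix_mult_def mult.commute[of "cnj _"] complex_norm_square del: of_real_power)
  qed
  have "cadj (U ** A) ** (U ** A) = cadj A ** (cadj U ** U) ** A"
    by (simp add: cadj_mult matrix_mul_assoc)
  then have "cadj (U ** A) ** (U ** A) = cadj A ** A" using assms by (simp add: unitaries_def)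
  then have "complex_of_real ((norm (U ** A))\<^sup>2) = complex_of_real ((norm A)\<^sup>2)" by (simp only: sq)
  then have "(norm (U ** A))\<^sup>2 = (norm A)\<^sup>2" by (simp only: of_real_eq_iff)
  then show ?thesis by simp
qed

lemma norm_unitary_right:
  assumes "U \<in> unitaries" shows "norm (A ** U) = norm (A :: complex^'n^'n)"
  using norm_unitary_left[OF unitaries_cadj[OF assms], of "cadj A"]
  by (metis cadj_mult norm_cadj)

lemma norm_conj_unitary: "U \<in> unitaries \<Longrightarrow> norm (U ** A ** cadj U) = norm A"
  by (simp add: norm_unitary_left norm_unitary_right unitaries_cadj)

lemma compact_unitaries: "compact (unitaries :: (complex^'n^'n) set)"
proof -
  have "closed {U :: complex^'n^'n. cadj U ** U = mat 1}"
    by (intro closed_Collect_eq continuous_intros)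
  moreover have "norm U \<le> norm (mat 1 :: complex^'n^'n)" if "U \<in> unitaries" for U :: "complex^'n^'n"
    using norm_unitary_left[OF that, of "mat 1"] by simp
  then have "bounded (unitaries :: (complex^'n^'n) set)" by (auto simp: bounded_iff)
  ultimately show ?thesis by (simp add: compact_eq_bounded_closed unitaries_def)
qed

section \<open>Inverse square roots and polar decomposition\<close>

lemma conj_unitary_mult:
  assumes "U \<in> unitaries"
  shows "(U ** A ** cadj U) ** (U ** B ** cadj U) = U ** (A ** B) ** cadj U"
proof -
  have "(U ** A ** cadj U) ** (U ** B ** cadj U) = U ** A ** (cadj U ** U) ** B ** cadj U"
    by (simp only: matrix_mul_assoc)
  also have "\<dots> = U ** (A ** B) ** cadj U"
    using assms unfolding unitaries_def mem_Collect_eq by (metis matrix_mul_rid matrix_mul_assoc)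
  finally show ?thesis .
qed

text \<open>An inverse square root without power series: \<open>r\<close> solves \<open>(1 + r)(1 - a)(1 + r) = 1\<close> iff it is a
  fixed point of the map below, a contraction of the ball of radius \<open>1/4\<close> when \<open>norm a \<le> 1/8\<close>.\<close>
definition isr_step :: "complex^'n^'n \<Rightarrow> complex^'n^'n \<Rightarrow> complex^'n^'n" where
  "isr_step a r = (1/2) *\<^sub>R (a + r ** a + a ** r + r ** a ** r - r ** r)"

lemma isr_step_lipschitz:
  assumes a: "norm a \<le> 1/8" and r: "norm r \<le> 1/4" and s: "norm s \<le> 1/4"
  shows "norm (isr_step a r - isr_step a s) \<le> (1/2) * norm (r - s)"
proof -
  let ?d = "norm (r - s)"
  have e: "isr_step a r - isr_step a s =
     (1/2) *\<^sub>R ((r - s) ** a + a ** (r - s) + (r ** (a ** (r - s)) + (r - s) ** (a ** s)) - (r ** (r - s) + (r - s) ** s))"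
    by (simp add: isr_step_def mm.diff_left mm.diff_right matrix_mul_assoc algebra_simps)
  \<comment> \<open>The coefficients add up to \<open>13/16 < 1\<close>; the factor
    \<open>1/2\<close> in \<open>isr_step\<close> then gives the contraction constant.\<close>
  have 1: "norm ((r - s) ** a) \<le> ?d * (1/8)" "norm (a ** (r - s)) \<le> 1/8 * ?d"
    "norm (r ** (a ** (r - s))) \<le> 1/4 * (1/8 * ?d)" "norm ((r - s) ** (a ** s)) \<le> ?d * (1/8 * (1/4))"
    "norm (r ** (r - s)) \<le> 1/4 * ?d" "norm ((r - s) ** s) \<le> ?d * (1/4)"
    by (intro norm_matrix_mult_mono order_refl a r s)+
  have "norm ((r - s) ** a + a ** (r - s) + (r ** (a ** (r - s)) + (r - s) ** (a ** s)) - (r ** (r - s) + (r - s) ** s))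
     \<le> norm ((r - s) ** a) + norm (a ** (r - s)) + (norm (r ** (a ** (r - s))) + norm ((r - s) ** (a ** s)))
       + (norm (r ** (r - s)) + norm ((r - s) ** s))"
    by (intro norm_triangle_le norm_triangle_le_diff add_mono order_refl)
  also have "\<dots> \<le> ?d" using 1 norm_ge_zero[of "r - s"] by linarith
  finally show ?thesis unfolding e by simp
qed

text \<open>Lipschitz dependence of the map on its parameter. Together with the contraction it makes
  the fixed point Lipschitz in \<open>a\<close>.\<close>

lemma isr_step_diff:
  assumes r: "norm r \<le> 1/4"
  shows "norm (isr_step a r - isr_step b r) \<le> norm (a - b)"
proof -
  let ?d = "norm (a - b)"
  have e: "isr_step a r - isr_step b r =
     (1/2) *\<^sub>R ((a - b) + r ** (a - b) + (a - b) ** r + r ** ((a - b) ** r))"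
    by (simp add: isr_step_def mm.diff_left mm.diff_right matrix_mul_assoc algebra_simps)
  have 1: "norm (r ** (a - b)) \<le> 1/4 * ?d" "norm ((a - b) ** r) \<le> ?d * (1/4)"
    "norm (r ** ((a - b) ** r)) \<le> 1/4 * (?d * (1/4))"
    by (intro norm_matrix_mult_mono order_refl r)+
  have "norm ((a - b) + r ** (a - b) + (a - b) ** r + r ** ((a - b) ** r)) \<le>
     norm (a - b) + norm (r ** (a - b)) + norm ((a - b) ** r) + norm (r ** ((a - b) ** r))"
    by (intro norm_triangle_le add_mono order_refl)
  also have "\<dots> \<le> 2 * ?d" using 1 norm_ge_zero[of "a - b"] by linarith
  finally show ?thesis unfolding e by simp
qed

lemma isr_step_0: "isr_step a 0 = (1/2) *\<^sub>R a"
  by (simp add: isr_step_def mm.zero_left mm.zero_right)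

text \<open>The ball is mapped into itself: \<open>isr_step a 0\<close> has norm at most
  \<open>1/16\<close>, and the contraction adds at most \<open>1/8\<close>.\<close>

lemma isr_ex1:
  assumes a: "norm (a :: complex^'n^'n) \<le> 1/8"
  shows "\<exists>!r. r \<in> cball 0 (1/4) \<and> isr_step a r = r"
proof (rule Banach_fix[where c="1/2"])
  show "complete (cball 0 (1/4) :: (complex^'n^'n) set)" by (simp add: complete_eq_closed)
  show "isr_step a ` cball 0 (1/4) \<subseteq> cball 0 (1/4)"
  proof safe
    fix r :: "complex^'n^'n" assume r: "r \<in> cball 0 (1/4)"
    have "norm (isr_step a r - isr_step a 0) \<le> (1/2) * norm (r - 0)"
      by (rule isr_step_lipschitz[OF a]) (use r in auto)
    then have "norm (isr_step a r) \<le> (1/2) * (1/4) + (1/2) * (1/8)"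
      using r a norm_triangle_sub[of "isr_step a r" "isr_step a 0"] by (simp add: isr_step_0)
    then show "isr_step a r \<in> cball 0 (1/4)" by simp
  qed
  show "dist (isr_step a x) (isr_step a y) \<le> 1/2 * dist x y" if "x \<in> cball 0 (1/4)" "y \<in> cball 0 (1/4)" for x y
    using isr_step_lipschitz[OF a, of x y] that by (simp add: dist_norm)
qed (auto intro: exI[of _ 0])

text \<open>For small self-adjoint \<open>a\<close> this is \<open>(1 - a)\<close> to the power
  \<open>-1/2\<close>, minus 1. Removing the 1 makes it vanish with \<open>a\<close>, so that it can
  be applied inside an algebra of functions vanishing at infinity.\<close>

definition isr :: "complex^'n^'n \<Rightarrow> complex^'n^'n" where
  "isr a = (THE r. r \<in> cball 0 (1/4) \<and> isr_step a r = r)"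

lemma isr:
  assumes "norm a \<le> 1/8" shows "norm (isr a) \<le> 1/4" "isr_step a (isr a) = isr a"
  using theI'[OF isr_ex1[OF assms]] by (simp_all add: isr_def)

text \<open>Uniqueness of the fixed point is how \<open>isr\<close> is seen to respect adjoints and
  unitary conjugation.\<close>

lemma isr_eqI:
  assumes "norm a \<le> 1/8" "norm r \<le> 1/4" "isr_step a r = r" shows "isr a = r"
  using isr_ex1[OF assms(1)] isr[OF assms(1)] assms(2,3) by (metis mem_cball_0)

lemma isr_eq:
  assumes "norm a \<le> 1/8"
  shows "2 *\<^sub>R isr a = a + isr a ** a + a ** isr a + isr a ** a ** isr a - isr a ** isr a"
proof -
  have "2 *\<^sub>R isr a = 2 *\<^sub>R isr_step a (isr a)" using isr(2)[OF assms] by simp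
  then show ?thesis by (simp add: isr_step_def)
qed

lemma isr_inverse:
  assumes "norm a \<le> 1/8"
  shows "(mat 1 + isr a) ** (mat 1 - a) ** (mat 1 + isr a) = mat 1"
proof -
  have "(mat 1 + isr a) ** (mat 1 - a) ** (mat 1 + isr a) =
    mat 1 + (2 *\<^sub>R isr a - (a + isr a ** a + a ** isr a + isr a ** a ** isr a - isr a ** isr a))"
    by (simp add: mm.diff_left mm.diff_right mm.add_left mm.add_right matrix_mul_assoc scaleR_2 algebra_simps)
  then show ?thesis using isr_eq[OF assms] by simp
qed

lemma isr_lipschitz:
  assumes a: "norm a \<le> 1/8" and b: "norm b \<le> 1/8"
  shows "norm (isr a - isr b) \<le> 2 * norm (a - b)"
proof -
  have "norm (isr a - isr b) = norm ((isr_step a (isr a) - isr_step a (isr b)) + (isr_step a (isr b) - isr_step b (isr b)))"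
    by (simp add: isr[OF a] isr[OF b])
  also have "\<dots> \<le> (1/2) * norm (isr a - isr b) + norm (a - b)"
    by (intro norm_triangle_le add_mono isr_step_lipschitz isr_step_diff isr a b)
  finally show ?thesis by simp
qed

lemma isr_0: "isr 0 = 0"
  by (rule isr_eqI) (simp_all add: isr_step_0)

text \<open>Ensures that applying \<open>isr\<close> to a small function in \<open>C0\<close> gives
  a function in \<open>C0\<close>.\<close>

lemma norm_isr_le: "norm a \<le> 1/8 \<Longrightarrow> norm (isr a) \<le> 2 * norm a"
  using isr_lipschitz[of a 0] by (simp add: isr_0)

lemma continuous_on_isr: "continuous_on (cball 0 (1/8)) isr"
proof (rule lipschitz_on_continuous_on)
  show "2-lipschitz_on (cball 0 (1/8)) isr"
    by (rule lipschitz_onI) (simp_all add: dist_norm isr_lipschitz)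
qed

lemma cadj_isr:
  assumes "norm a \<le> 1/8" "cadj a = a" shows "cadj (isr a) = isr a"
proof (rule isr_eqI[symmetric])
  have "isr_step (cadj a) (cadj (isr a)) = cadj (isr_step a (isr a))"
    by (simp add: isr_step_def cadj_add cadj_diff cadj_scaleR cadj_mult matrix_mul_assoc add.commute add.left_commute)
  then show "isr_step a (cadj (isr a)) = cadj (isr a)" unfolding isr(2)[OF assms(1)] assms(2) .
qed (use assms isr in auto)

lemma isr_conj_unitary:
  assumes a: "norm a \<le> 1/8" and U: "U \<in> unitaries"
  shows "isr (U ** a ** cadj U) = U ** isr a ** cadj U"
proof (rule isr_eqI)
  have "isr_step (U ** a ** cadj U) (U ** isr a ** cadj U) = U ** isr_step a (isr a) ** cadj U"
    unfolding isr_step_def conj_unitary_mult[OF U]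
    by (simp add: mm.diff_left mm.diff_right mm.add_left mm.add_right mm.scaleR_left mm.scaleR_right)
  then show "isr_step (U ** a ** cadj U) (U ** isr a ** cadj U) = U ** isr a ** cadj U"
    using isr[OF a] by simp
qed (use a U isr in \<open>auto simp: norm_conj_unitary\<close>)

text \<open>The radius \<open>1/8\<close> is the one up to which \<open>isr\<close> is controlled.
  Taking the closed condition makes the extension of \<open>polar\<close> by a constant
  Borel.\<close>

definition near_unitary :: "(complex^'n^'n) set" where
  "near_unitary = {A. norm (mat 1 - cadj A ** A) \<le> 1/8}"

text \<open>\<open>1 + isr (1 - A\<^sup>* A)\<close> is the inverse square root of \<open>A\<^sup>* A\<close>.\<close>
definition polar :: "complex^'n^'n \<Rightarrow> complex^'n^'n" where
  "polar A = A ** (mat 1 + isr (mat 1 - cadj A ** A))"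

lemma polar_unitary:
  assumes "A \<in> near_unitary" shows "polar A \<in> unitaries"
proof -
  define a where "a = mat 1 - cadj A ** A"
  have a: "norm a \<le> 1/8" "cadj a = a" using assms by (simp_all add: near_unitary_def a_def cadj_diff cadj_mult)
  have "cadj (polar A) ** polar A = (mat 1 + isr a) ** (cadj A ** A) ** (mat 1 + isr a)"
    unfolding polar_def a_def[symmetric] by (simp add: cadj_mult cadj_add cadj_isr[OF a] matrix_mul_assoc)
  also have "cadj A ** A = mat 1 - a" by (simp add: a_def)
  finally show ?thesis using isr_inverse[OF a(1)] by (simp add: unitaries_def)
qed

lemma near_unitary_left:
  assumes "V \<in> unitaries"
  shows "V ** A \<in> near_unitary \<longleftrightarrow> A \<in> near_unitary" "polar (V ** A) = V ** polar A"
proof -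
  have "cadj (V ** A) ** (V ** A) = cadj A ** (cadj V ** V) ** A" by (simp add: cadj_mult matrix_mul_assoc)
  then have "cadj (V ** A) ** (V ** A) = cadj A ** A" using assms by (simp add: unitaries_def)
  then show "V ** A \<in> near_unitary \<longleftrightarrow> A \<in> near_unitary" "polar (V ** A) = V ** polar A"
    by (simp_all add: near_unitary_def polar_def matrix_mul_assoc)
qed

text \<open>A unitary factor on the right conjugates \<open>cadj A ** A\<close>, whereas one on the
  left leaves it unchanged; hence the appeal to \<open>isr_conj_unitary\<close>.\<close>

lemma near_unitary_right:
  assumes V: "V \<in> unitaries"
  shows "A ** V \<in> near_unitary \<longleftrightarrow> A \<in> near_unitary"
    "A \<in> near_unitary \<Longrightarrow> polar (A ** V) = polar A ** V"
proof -
  define a where "a = mat 1 - cadj A ** A"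
  have i: "cadj V ** V = mat 1" "V ** cadj V = mat 1" using V by (simp_all add: unitaries_iff)
  have e: "mat 1 - cadj (A ** V) ** (A ** V) = cadj V ** a ** V"
    by (simp add: a_def cadj_mult mm.diff_left mm.diff_right matrix_mul_assoc i)
  have n: "norm (cadj V ** a ** V) = norm a" using norm_conj_unitary[OF unitaries_cadj[OF V], of a] by simp
  show "A ** V \<in> near_unitary \<longleftrightarrow> A \<in> near_unitary"
    unfolding near_unitary_def mem_Collect_eq e n unfolding a_def ..
  assume "A \<in> near_unitary"
  then have a: "norm a \<le> 1/8" by (simp add: near_unitary_def a_def)
  have "polar (A ** V) = A ** V ** (mat 1 + cadj V ** isr a ** V)"
    unfolding polar_def e using isr_conj_unitary[OF a unitaries_cadj[OF V]] by simp
  also have "\<dots> = A ** V + A ** (V ** cadj V) ** isr a ** V" by (simp only: mm.add_right matrix_mul_assoc matrix_mul_rid)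
  also have "\<dots> = polar A ** V"
    unfolding i polar_def a_def[symmetric] by (simp add: mm.add_left mm.add_right)
  finally show "polar (A ** V) = polar A ** V" .
qed

lemma closed_near_unitary: "closed (near_unitary :: (complex^'n^'n) set)"
  unfolding near_unitary_def by (intro closed_Collect_le continuous_intros)

lemma continuous_on_polar: "continuous_on near_unitary polar"
  unfolding polar_def
  by (intro continuous_intros continuous_on_compose2[OF continuous_on_isr]) (auto simp: near_unitary_def)

text \<open>Needed to normalise Lebesgue measure on this set: it contains a ball around
  \<open>mat 1\<close> and it is bounded.\<close>

lemma emeasure_near_unitary:
  "emeasure lborel (near_unitary :: (complex^'n^'n) set) \<noteq> 0"
  "emeasure lborel (near_unitary :: (complex^'n^'n) set) \<noteq> \<infinity>"
proof -
  let ?O = "{A :: complex^'n^'n. norm (mat 1 - cadj A ** A) < 1/8}"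
  have "open ?O" by (intro open_Collect_less continuous_intros)
  moreover have "mat 1 \<in> ?O" by simp
  ultimately obtain e where e: "e > 0" "ball (mat 1) e \<subseteq> ?O" using openE by blast
  then have "emeasure lborel (ball (mat 1 :: complex^'n^'n) e) \<le> emeasure lborel (near_unitary :: (complex^'n^'n) set)"
    by (intro emeasure_mono) (auto simp: near_unitary_def intro: less_imp_le borel_closed[OF closed_near_unitary[unfolded near_unitary_def], simplified])
  moreover have "emeasure lborel (ball (mat 1 :: complex^'n^'n) e) \<noteq> 0"
    using content_ball_pos[OF e(1), of "mat 1 :: complex^'n^'n"] by (auto simp: measure_def)
  ultimately show "emeasure lborel (near_unitary :: (complex^'n^'n) set) \<noteq> 0" by auto
  have "norm A \<le> norm (mat 1 :: complex^'n^'n) * 2" if A: "A \<in> near_unitary" for A :: "complex^'n^'n"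
  proof -
    define r where "r = isr (mat 1 - cadj A ** A)"
    have r: "norm r \<le> 1/4" using A isr by (simp add: r_def near_unitary_def)
    \<comment> \<open>With \<open>norm r \<le> 1/4\<close> this bounds \<open>norm A\<close> by
      \<open>4/3\<close> of the norm of the unitary matrix \<open>polar A\<close>.\<close>
    have "A = polar A - A ** r" by (simp add: polar_def r_def mm.add_right)
    then have "norm A \<le> norm (polar A) + norm (A ** r)" by (metis norm_triangle_ineq4)
    moreover have "norm (polar A) = norm (mat 1 :: complex^'n^'n)"
      using norm_unitary_left[OF polar_unitary[OF A], of "mat 1"] by simp
    moreover have "norm (A ** r) \<le> norm A * (1/4)" using r by (intro norm_matrix_mult_mono) auto
    ultimately show ?thesis using norm_ge_zero[of "mat 1 :: complex^'n^'n"] norm_ge_zero[of A] by linarith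
  qed
  then have "(near_unitary :: (complex^'n^'n) set) \<subseteq> cball 0 (norm (mat 1 :: complex^'n^'n) * 2)" by auto
  then have "emeasure lborel (near_unitary :: (complex^'n^'n) set) \<le> emeasure lborel (cball 0 (norm (mat 1 :: complex^'n^'n) * 2) :: (complex^'n^'n) set)"
    by (intro emeasure_mono) auto
  then show "emeasure lborel (near_unitary :: (complex^'n^'n) set) \<noteq> \<infinity>"
    using emeasure_lborel_cball_finite[of "0::complex^'n^'n" "norm (mat 1 :: complex^'n^'n) * 2"] by auto
qed

section \<open>Haar measure as an image of Lebesgue measure\<close>

lemma measurable_indicator_comp:
  "S \<in> sets borel \<Longrightarrow> f \<in> borel_measurable M \<Longrightarrow> (\<lambda>z. indicator S (f z) :: ennreal) \<in> borel_measurable M"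
  by (rule measurable_compose[OF _ borel_measurable_indicator])

text \<open>Translation invariance determines Lebesgue measure up to a factor (Fubini), and the factor is read off
  the unit ball.\<close>
lemma lborel_isometry:
  fixes T :: "'a::euclidean_space \<Rightarrow> 'a"
  assumes T: "linear T" and iso: "\<And>x. norm (T x) = norm x" and sj: "surj T" and A: "A \<in> sets borel"
  shows "emeasure lborel (T -` A) = emeasure lborel A"
proof -
  have Tm [measurable]: "T \<in> borel_measurable borel"
    by (intro borel_measurable_continuous_onI linear_continuous_on) (simp add: T linear_conv_bounded_linear[symmetric])
  note [measurable] = A
  let ?B = "ball (0::'a) 1"
  have tr: "(\<integral>\<^sup>+x. f (c + x) \<partial>lborel) = (\<integral>\<^sup>+x. f x \<partial>lborel)"
    if [measurable]: "f \<in> borel_measurable borel" for f and c :: 'a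
  proof -
    have "(\<integral>\<^sup>+x. f x \<partial>lborel) = (\<integral>\<^sup>+x. f x \<partial>distr lborel borel ((+) c))" by (simp add: lborel_distr_plus)
    also have "\<dots> = (\<integral>\<^sup>+x. f (c + x) \<partial>lborel)" by (subst nn_integral_distr) auto
    finally show ?thesis by simp
  qed
  have TA: "T -` A \<in> sets borel" using measurable_sets[OF Tm A] by simp
  have "emeasure lborel (T -` A) * emeasure lborel ?B = (\<integral>\<^sup>+x. (\<integral>\<^sup>+y. indicator A (T x) * indicator ?B y \<partial>lborel) \<partial>lborel)"
  proof -
    have "emeasure lborel (T -` A) = (\<integral>\<^sup>+x. indicator A (T x) \<partial>lborel)"
      using nn_integral_indicator[of "T -` A" lborel] TA by (simp add: indicator_vimage[symmetric] comp_def)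
    then have "emeasure lborel (T -` A) * emeasure lborel ?B = (\<integral>\<^sup>+x. indicator A (T x) * emeasure lborel ?B \<partial>lborel)"
      by (simp only:) (rule nn_integral_multc[symmetric], measurable)
    then show ?thesis by (simp only: nn_integral_cmult_indicator borel_open open_ball sets_lborel)
  qed
  also have "\<dots> = (\<integral>\<^sup>+x. (\<integral>\<^sup>+y. indicator A (T x) * indicator ?B (- T x + y) \<partial>lborel) \<partial>lborel)"
  proof (rule nn_integral_cong)
    fix x
    have m: "(\<lambda>y. indicator A (T x) * indicator ?B y :: ennreal) \<in> borel_measurable borel"
      by (intro borel_measurable_times_ennreal borel_measurable_const borel_measurable_indicator) simp
    show "(\<integral>\<^sup>+y. indicator A (T x) * indicator ?B y \<partial>lborel) = (\<integral>\<^sup>+y. indicator A (T x) * indicator ?B (- T x + y) \<partial>lborel)"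
      by (rule tr[OF m, symmetric])
  qed
  also have "\<dots> = (\<integral>\<^sup>+y. (\<integral>\<^sup>+x. indicator A (T x) * indicator ?B (- T x + y) \<partial>lborel) \<partial>lborel)"
    by (rule lborel_pair.Fubini') (unfold case_prod_beta, intro borel_measurable_times_ennreal measurable_indicator_comp, measurable)
  also have "\<dots> = (\<integral>\<^sup>+y. (\<integral>\<^sup>+x. indicator A (T x + y) * indicator ?B (- T x) \<partial>lborel) \<partial>lborel)"
  proof (rule nn_integral_cong)
    fix y
    \<comment> \<open>Translating \<open>x\<close> by a preimage of \<open>y\<close> replaces
      \<open>T x\<close> by \<open>T x + y\<close>; surjectivity enters here.\<close>
    obtain z where z: "T z = y" using sj by (metis surjD)
    have "(\<integral>\<^sup>+x. indicator A (T (z + x)) * indicator ?B (- T (z + x) + y) \<partial>lborel) =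
      (\<integral>\<^sup>+x. indicator A (T x) * indicator ?B (- T x + y) \<partial>lborel)"
      by (rule tr, intro borel_measurable_times_ennreal measurable_indicator_comp) measurable
    then show "(\<integral>\<^sup>+x. indicator A (T x) * indicator ?B (- T x + y) \<partial>lborel) =
       (\<integral>\<^sup>+x. indicator A (T x + y) * indicator ?B (- T x) \<partial>lborel)"
      by (simp add: linear_add[OF T] z add.commute)
  qed
  also have "\<dots> = (\<integral>\<^sup>+x. (\<integral>\<^sup>+y. indicator A (T x + y) * indicator ?B (- T x) \<partial>lborel) \<partial>lborel)"
    by (rule lborel_pair.Fubini') (unfold case_prod_beta, intro borel_measurable_times_ennreal measurable_indicator_comp, measurable)
  also have "\<dots> = (\<integral>\<^sup>+x. emeasure lborel A * indicator ?B (- T x) \<partial>lborel)"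
    by (intro nn_integral_cong, subst nn_integral_multc) (auto simp: tr)
  \<comment> \<open>The ball is symmetric and \<open>T\<close> preserves norms.\<close>
  also have "\<dots> = (\<integral>\<^sup>+x. emeasure lborel A * indicator ?B x \<partial>lborel)"
    by (intro nn_integral_cong) (auto simp: indicator_def iso)
  also have "\<dots> = emeasure lborel A * emeasure lborel ?B"
    by (simp only: nn_integral_cmult_indicator borel_open open_ball sets_lborel)
  finally have e: "emeasure lborel (T -` A) * emeasure lborel ?B = emeasure lborel A * emeasure lborel ?B" .
  have "emeasure lborel ?B \<noteq> 0"
    using content_ball_pos[of 1 "0::'a"] by (metis measure_def enn2real_0 less_irrefl zero_less_one)
  moreover have "emeasure lborel ?B \<noteq> top" using emeasure_lborel_ball_finite[of "0::'a" 1] by auto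
  ultimately show ?thesis using e
    by (metis ennreal_mult_divide_eq mult.commute)
qed

text \<open>The measure lives on all matrices and gives full mass to the unitary ones. The value
  \<open>mat 1\<close> off \<open>near_unitary\<close> is a default on a null set of the uniform
  measure.\<close>

definition haar :: "(complex^'n^'n) measure" where
  "haar = distr (uniform_measure lborel near_unitary) borel (\<lambda>A. if A \<in> near_unitary then polar A else mat 1)"

lemma sets_haar [simp, measurable_cong]: "sets haar = sets borel" and space_haar [simp]: "space haar = UNIV"
  by (simp_all add: haar_def)

lemma polar_measurable: "(\<lambda>A. if A \<in> near_unitary then polar A else mat 1) \<in> borel_measurable borel"
  by (rule borel_measurable_continuous_on_if)
     (auto intro!: continuous_on_polar borel_closed closed_near_unitary continuous_on_const)

lemma emeasure_haar:
  assumes S: "(S :: (complex^'n^'n) set) \<in> sets borel"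
  shows "emeasure haar S = emeasure lborel {A \<in> near_unitary. polar A \<in> S} / emeasure lborel (near_unitary :: (complex^'n^'n) set)"
proof -
  have m: "(\<lambda>A. if A \<in> near_unitary then polar A else mat 1) \<in> measurable (uniform_measure lborel near_unitary) borel"
    using polar_measurable by (simp cong: measurable_cong_sets)
  have c: "(near_unitary :: (complex^'n^'n) set) \<in> sets borel" by (rule borel_closed[OF closed_near_unitary])
  have "emeasure haar S = emeasure lborel (near_unitary \<inter> (\<lambda>A. if A \<in> near_unitary then polar A else mat 1) -` S) / emeasure lborel (near_unitary :: (complex^'n^'n) set)"
    unfolding haar_def
    using measurable_sets[OF polar_measurable S]
    by (subst emeasure_distr[OF m S]) (simp add: c)
  also have "near_unitary \<inter> (\<lambda>A. if A \<in> near_unitary then polar A else mat 1) -` S = {A \<in> near_unitary. polar A \<in> S}"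
    by auto
  finally show ?thesis .
qed

lemma haar_prob: "emeasure (haar :: (complex^'n^'n) measure) UNIV = 1"
proof -
  have "emeasure (haar :: (complex^'n^'n) measure) UNIV = emeasure lborel (near_unitary :: (complex^'n^'n) set) / emeasure lborel (near_unitary :: (complex^'n^'n) set)"
    by (simp add: emeasure_haar)
  then show ?thesis
    using ennreal_divide_self[of "emeasure lborel (near_unitary :: (complex^'n^'n) set)"]
      emeasure_near_unitary[where 'n='n] by (simp add: top.not_eq_extremum)
qed

lemma finite_haar: "finite_measure haar"
  by (rule finite_measureI) (simp add: haar_prob)

lemma haar_unitary: "AE U in (haar :: (complex^'n^'n) measure). U \<in> unitaries"
proof (rule AE_I'[where N="- unitaries"])
  have m: "- (unitaries :: (complex^'n^'n) set) \<in> sets borel"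
    using borel_closed[OF compact_imp_closed[OF compact_unitaries]] by (rule borel_comp)
  have "{A \<in> near_unitary. polar A \<notin> unitaries} = ({} :: (complex^'n^'n) set)" using polar_unitary by auto
  then have "emeasure haar (- (unitaries :: (complex^'n^'n) set)) = 0" 
    using emeasure_haar[OF m] by (simp only: Compl_iff) simp
  then show "- (unitaries :: (complex^'n^'n) set) \<in> null_sets haar"
    using m by (auto simp: null_sets_def)
qed auto

lemma polar_set_measurable:
  assumes "(S :: (complex^'n^'n) set) \<in> sets borel" shows "{A \<in> near_unitary. polar A \<in> S} \<in> sets borel"
proof -
  have "near_unitary \<inter> ((\<lambda>A. if A \<in> near_unitary then polar A else mat 1) -` S) \<in> sets borel"
    using measurable_sets[OF polar_measurable assms] borel_closed[OF closed_near_unitary] by auto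
  moreover have "near_unitary \<inter> ((\<lambda>A. if A \<in> near_unitary then polar A else mat 1) -` S) = {A \<in> near_unitary. polar A \<in> S}"
    by auto
  ultimately show ?thesis by simp
qed

lemma measure_eqI_borel:
  assumes "sets M = sets borel" "sets N = sets borel" "\<And>S. S \<in> sets borel \<Longrightarrow> emeasure M S = emeasure N S"
  shows "M = N"
  using assms by (intro measure_eqI) auto

text \<open>Multiplication by a unitary is a surjective linear isometry for the Frobenius norm; it
  preserves \<open>near_unitary\<close> and commutes with \<open>polar\<close>, so preimages keep
  their Lebesgue measure.\<close>

lemma haar_left:
  assumes V: "(V :: complex^'n^'n) \<in> unitaries" shows "distr haar borel ((**) V) = haar"
proof (rule measure_eqI_borel)
  fix S :: "(complex^'n^'n) set" assume S: "S \<in> sets borel"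
  have m: "(**) V \<in> borel_measurable borel" by (intro borel_measurable_continuous_onI continuous_intros)
  then have VS: "(**) V -` S \<in> sets borel" using measurable_sets[OF m S] by simp
  have "emeasure (distr haar borel ((**) V)) S = emeasure haar ((**) V -` S)"
    using m S by (subst emeasure_distr) (auto cong: measurable_cong_sets)
  also have "\<dots> = emeasure lborel {A \<in> near_unitary. polar A \<in> (**) V -` S} / emeasure lborel (near_unitary :: (complex^'n^'n) set)"
    by (rule emeasure_haar[OF VS])
  also have "{A \<in> near_unitary. polar A \<in> (**) V -` S} = (**) V -` {A \<in> near_unitary. polar A \<in> S}"
    by (auto simp: near_unitary_left[OF V])
  also have "emeasure lborel \<dots> = emeasure lborel {A \<in> near_unitary. polar A \<in> S}"
  proof (rule lborel_isometry)
    show "linear ((**) V)" by (rule linearI) (simp_all add: mm.add_right mm.scaleR_right)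
    show "surj ((**) V)"
      using V by (auto simp: unitaries_iff matrix_mul_assoc intro!: surjI[where f="\<lambda>A. cadj V ** A"])
  qed (use V S polar_set_measurable in \<open>auto simp: norm_unitary_left\<close>)
  also have "\<dots> / emeasure lborel (near_unitary :: (complex^'n^'n) set) = emeasure haar S" by (rule emeasure_haar[OF S, symmetric])
  finally show "emeasure (distr haar borel ((**) V)) S = emeasure haar S" .
qed simp_all

lemma haar_right:
  assumes V: "(V :: complex^'n^'n) \<in> unitaries" shows "distr haar borel (\<lambda>A. A ** V) = haar"
proof (rule measure_eqI_borel)
  fix S :: "(complex^'n^'n) set" assume S: "S \<in> sets borel"
  have m: "(\<lambda>A. A ** V) \<in> borel_measurable borel" by (intro borel_measurable_continuous_onI continuous_intros)
  then have VS: "(\<lambda>A. A ** V) -` S \<in> sets borel" using measurable_sets[OF m S] by simp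
  have "emeasure (distr haar borel (\<lambda>A. A ** V)) S = emeasure haar ((\<lambda>A. A ** V) -` S)"
    using m S by (subst emeasure_distr) (auto cong: measurable_cong_sets)
  also have "\<dots> = emeasure lborel {A \<in> near_unitary. polar A \<in> (\<lambda>A. A ** V) -` S} / emeasure lborel (near_unitary :: (complex^'n^'n) set)"
    by (rule emeasure_haar[OF VS])
  also have "{A \<in> near_unitary. polar A \<in> (\<lambda>A. A ** V) -` S} = (\<lambda>A. A ** V) -` {A \<in> near_unitary. polar A \<in> S}"
    by (auto simp: near_unitary_right[OF V])
  also have "emeasure lborel \<dots> = emeasure lborel {A \<in> near_unitary. polar A \<in> S}"
  proof (rule lborel_isometry)
    show "linear (\<lambda>A :: complex^'n^'n. A ** V)" by (rule linearI) (simp_all add: mm.add_left mm.scaleR_left)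
    show "surj (\<lambda>A :: complex^'n^'n. A ** V)"
    proof (rule surjI[where f="\<lambda>A. A ** cadj V"])
      show "(x ** cadj V) ** V = x" for x :: "complex^'n^'n"
        using V by (simp add: unitaries_iff matrix_mul_assoc[symmetric])
    qed
  qed (use V S polar_set_measurable in \<open>auto simp: norm_unitary_right\<close>)
  also have "\<dots> / emeasure lborel (near_unitary :: (complex^'n^'n) set) = emeasure haar S" by (rule emeasure_haar[OF S, symmetric])
  finally show "emeasure (distr haar borel (\<lambda>A. A ** V)) S = emeasure haar S" .
qed simp_all

section \<open>Averaging over the unitary group\<close>

text \<open>The group action on matrix functions whose fixed points are the equivariant
  functions.\<close>

definition twist :: "(complex^'n::finite^'n \<Rightarrow> 'x \<Rightarrow> 'x) \<Rightarrow> complex^'n^'n \<Rightarrow> ('x \<Rightarrow> complex^'n^'n) \<Rightarrow> 'x \<Rightarrow> complex^'n^'n" where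
  "twist act U F = (\<lambda>x. cadj U ** F (act U x) ** U)"

text \<open>The cutoff outside \<open>unitaries\<close> makes the integrand Borel: \<open>act\<close> is arbitrary there.\<close>
definition avg :: "(complex^'n::finite^'n \<Rightarrow> 'x \<Rightarrow> 'x) \<Rightarrow> ('x \<Rightarrow> complex^'n^'n) \<Rightarrow> 'x \<Rightarrow> complex^'n^'n" where
  "avg act F = (\<lambda>x. \<integral>U. (if U \<in> unitaries then twist act U F x else 0) \<partial>haar)"

lemma Cstar_iff: "f \<in> Cstar act \<longleftrightarrow> f \<in> C0 \<and> equivariant act f"
  by (auto simp: Cstar_def C0_def)

lemma BCstar_iff: "f \<in> BCstar act \<longleftrightarrow> f \<in> bounded_borel \<and> equivariant act f"
  by (auto simp: BCstar_def bounded_borel_def)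

lemma integrable_haar:
  fixes f :: "complex^'n^'n \<Rightarrow> complex^'n^'n"
  assumes f: "continuous_on unitaries f" and B: "\<And>U. U \<in> unitaries \<Longrightarrow> norm (f U) \<le> B"
  shows "integrable haar (\<lambda>U. if U \<in> unitaries then f U else 0)"
proof (rule finite_measure.integrable_const_bound[OF finite_haar])
  show "AE U in haar. norm (if U \<in> unitaries then f U else 0) \<le> B"
    using haar_unitary by eventually_elim (use B in auto)
  have "(\<lambda>U. if U \<in> unitaries then f U else 0) \<in> borel_measurable borel"
    by (rule borel_measurable_continuous_on_if)
       (auto intro!: f borel_closed compact_imp_closed compact_unitaries)
  then show "(\<lambda>U. if U \<in> unitaries then f U else 0) \<in> borel_measurable haar"
    by (simp cong: measurable_cong_sets)
qed

lemma norm_integral_haar_le: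
  fixes f :: "complex^'n^'n \<Rightarrow> complex^'n^'n"
  assumes f: "integrable haar f" and B: "\<And>U. U \<in> unitaries \<Longrightarrow> norm (f U) \<le> B"
  shows "norm (\<integral>U. f U \<partial>haar) \<le> B"
proof -
  interpret finite_measure "haar :: (complex^'n^'n) measure" by (rule finite_haar)
  have "norm (\<integral>U. f U \<partial>haar) \<le> (\<integral>U. norm (f U) \<partial>haar)" by (rule integral_norm_bound)
  also have "\<dots> \<le> (\<integral>U. B \<partial>(haar :: (complex^'n^'n) measure))"
  proof (rule integral_mono_AE)
    show "AE U in haar. norm (f U) \<le> B" using haar_unitary by eventually_elim (use B in auto)
  qed (use f in auto)
  also have "\<dots> = B" using haar_prob[where 'n='n] by (simp add: measure_def)
  finally show ?thesis .
qed

definition cscale :: "complex \<Rightarrow> complex^'n::finite^'n \<Rightarrow> complex^'n^'n" where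
  "cscale c A = (\<chi> i j. c * A $ i $ j)"

lemma bounded_linear_cscale: "bounded_linear (cscale c)"
proof -
  have "cscale c A = cscale c (mat 1) ** A" for A
    by (auto simp: vec_eq_iff cscale_def matrix_matrix_mult_def mat_def if_distrib if_distribR cong: if_cong)
  then have "cscale c = (\<lambda>A. cscale c (mat 1) ** A)" by auto
  then show ?thesis by (metis mm.bounded_linear_right)
qed

lemma cscale_mult: "cscale c A ** B = cscale c (A ** B)" "A ** cscale c B = cscale c (A ** B)"
  by (simp_all add: vec_eq_iff cscale_def matrix_matrix_mult_def sum_distrib_left algebra_simps)

lemma fscale_eq: "fscale c F = (\<lambda>x. cscale c (F x))"
  by (simp add: fscale_def cscale_def)

lemma norm_cscale: "norm (cscale c A) = cmod c * norm A"
proof -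
  have "(norm (cscale c A))\<^sup>2 = (cmod c * norm A)\<^sup>2"
    by (simp add: norm_matrix_sq cscale_def norm_mult power_mult_distrib sum_distrib_left)
  then show ?thesis by simp
qed

section \<open>Twists and averages on an n-space\<close>

locale nspace =
  fixes act :: "complex^'n::finite^'n \<Rightarrow> 'x::t2_space \<Rightarrow> 'x"
  assumes n_space: "n_space act"
begin

lemma lc: "locally_compact_space (euclidean :: 'x topology)"
  using n_space by (simp add: n_space_def)

lemma act_continuous: "continuous_on (unitaries \<times> UNIV) (\<lambda>p. act (fst p) (snd p))"
  using n_space by (simp add: n_space_def)

lemma act_one [simp]: "act (mat 1) x = x"
  using n_space by (simp add: n_space_def)

lemma act_mult: "U \<in> unitaries \<Longrightarrow> V \<in> unitaries \<Longrightarrow> act (U ** V) x = act U (act V x)"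
  using n_space by (simp add: n_space_def)

lemma act_cadj: "U \<in> unitaries \<Longrightarrow> act (cadj U) (act U x) = x" "U \<in> unitaries \<Longrightarrow> act U (act (cadj U) x) = x"
  using act_mult[of "cadj U" U] act_mult[of U "cadj U"] by (simp_all add: unitaries_iff)

lemma continuous_on_act:
  assumes "continuous_on S f" "continuous_on S g" "\<And>s. s \<in> S \<Longrightarrow> f s \<in> unitaries"
  shows "continuous_on S (\<lambda>s. act (f s) (g s))"
  using continuous_on_compose2[OF act_continuous continuous_on_Pair[OF assms(1,2)]] assms(3) by auto

lemma continuous_act: "U \<in> unitaries \<Longrightarrow> continuous_on UNIV (act U)"
  by (intro continuous_on_act continuous_intros) auto

lemma act_measurable: "U \<in> unitaries \<Longrightarrow> act U \<in> borel_measurable borel"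
  by (intro borel_measurable_continuous_onI continuous_act)

lemma act_image: "U \<in> unitaries \<Longrightarrow> act U ` A = act (cadj U) -` A"
  using act_cadj by (auto simp: image_iff) (metis act_cadj(2))

lemma act_image_borel: "U \<in> unitaries \<Longrightarrow> A \<in> sets borel \<Longrightarrow> act U ` A \<in> sets borel"
  using measurable_sets[OF act_measurable[OF unitaries_cadj], of U A] by (simp add: act_image)

lemma norm_twist: "U \<in> unitaries \<Longrightarrow> norm (twist act U F x) = norm (F (act U x))"
  by (simp add: twist_def norm_unitary_left norm_unitary_right unitaries_cadj)

lemma continuous_on_twist:
  assumes F: "continuous_on UNIV F" and "continuous_on S f" "continuous_on S g" "\<And>s. s \<in> S \<Longrightarrow> f s \<in> unitaries"
  shows "continuous_on S (\<lambda>s. twist act (f s) F (g s))"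
  unfolding twist_def
  by (intro continuous_intros continuous_on_compose2[OF F continuous_on_act] assms) auto

lemma twist_mult:
  "U \<in> unitaries \<Longrightarrow> V \<in> unitaries \<Longrightarrow> twist act U (twist act V F) = twist act (V ** U) F"
  by (simp add: twist_def act_mult cadj_mult matrix_mul_assoc)

lemma twist_equivariant:
  assumes "equivariant act F" "U \<in> unitaries" shows "twist act U F = F"
proof
  fix x
  have "twist act U F x = (cadj U ** U) ** F x ** (cadj U ** U)"
    using assms by (simp add: twist_def equivariant_def matrix_mul_assoc)
  then show "twist act U F x = F x" using assms(2) by (simp add: unitaries_def)
qed

text \<open>The union of the orbits that meet \<open>C\<close>. It stays compact because the group
  is compact, which is why averages still vanish at infinity.\<close>

definition saturation :: "'x set \<Rightarrow> 'x set" where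
  "saturation C = {x. \<exists>U\<in>unitaries. act U x \<in> C}"

lemma compact_saturation:
  assumes C: "compact C" shows "compact (saturation C)"
proof -
  have "saturation C = (\<lambda>p. act (fst p) (snd p)) ` (unitaries \<times> C)"
  proof safe
    fix x assume "x \<in> saturation C"
    then obtain U where U: "U \<in> unitaries" "act U x \<in> C" by (auto simp: saturation_def)
    then show "x \<in> (\<lambda>p. act (fst p) (snd p)) ` (unitaries \<times> C)"
      by (intro image_eqI[where x="(cadj U, act U x)"]) (auto simp: act_cadj unitaries_cadj)
  next
    fix U :: "complex^'n^'n" and x assume U: "U \<in> unitaries" "x \<in> C"
    then show "act (fst (U, x)) (snd (U, x)) \<in> saturation C"
      unfolding saturation_def by (auto intro!: bexI[where x="cadj U"] simp: act_cadj unitaries_cadj)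
  qed
  then show ?thesis
    using compact_continuous_image[OF continuous_on_subset[OF act_continuous] compact_Times[OF compact_unitaries C]]
    by auto
qed

lemma integrable_twist:
  assumes F: "F \<in> C0"
  shows "integrable haar (\<lambda>U. if U \<in> unitaries then twist act U F x else 0)"
proof -
  obtain B where B: "\<And>x. norm (F x) \<le> B" using bounded_borelE[OF C0_bounded_borel[OF F]] by metis
  show ?thesis
  proof (rule integrable_haar)
    show "continuous_on unitaries (\<lambda>U. twist act U F x)"
      by (intro continuous_on_twist C0_continuous[OF F] continuous_intros) auto
  qed (use B norm_twist in auto)
qed

lemma norm_avg_le:
  assumes "F \<in> C0" "\<And>U. U \<in> unitaries \<Longrightarrow> norm (F (act U x)) \<le> B"
  shows "norm (avg act F x) \<le> B"
  unfolding avg_def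
  by (rule norm_integral_haar_le[OF integrable_twist[OF assms(1)]]) (use assms norm_twist in auto)

lemma avg_diff_pointwise:
  assumes F: "F \<in> C0" and d: "\<And>U. U \<in> unitaries \<Longrightarrow> norm (twist act U F x - twist act U F y) \<le> e"
  shows "norm (avg act F x - avg act F y) \<le> e"
proof -
  have "avg act F x - avg act F y =
    (\<integral>U. (if U \<in> unitaries then twist act U F x else 0) - (if U \<in> unitaries then twist act U F y else 0) \<partial>haar)"
    unfolding avg_def by (rule Bochner_Integration.integral_diff[symmetric]) (intro integrable_twist F)+
  also have "norm \<dots> \<le> e"
    by (rule norm_integral_haar_le) (use d integrable_twist[OF F] in auto)
  finally show ?thesis .
qed

text \<open>The space need not be first countable, so dominated convergence along sequences would
  not suffice. Instead compactness of the group provides a neighbourhood of \<open>x\<close> on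
  which all twists are simultaneously close to their values at \<open>x\<close>.\<close>

lemma continuous_on_avg:
  assumes F: "F \<in> C0" shows "continuous_on UNIV (avg act F)"
proof -
  have c: "continuous_on (UNIV \<times> unitaries) (\<lambda>p. twist act (snd p) F (fst p))"
    by (intro continuous_on_twist C0_continuous[OF F] continuous_intros) auto
  have "\<exists>A. open A \<and> x \<in> A \<and> (\<forall>y\<in>A. dist (avg act F y) (avg act F x) < e)" if e: "e > 0" for x e
  proof -
    obtain X where X: "x \<in> X" "open X" "\<forall>y\<in>X \<inter> UNIV. \<forall>U\<in>unitaries.
        dist (twist act (snd (y, U)) F (fst (y, U))) (twist act (snd (x, U)) F (fst (x, U))) \<le> e/2"
      using continuous_on_prod_compactE[OF c compact_unitaries, of x "e/2"] e by auto
    have "dist (avg act F y) (avg act F x) \<le> e/2" if "y \<in> X" for y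
      unfolding dist_norm by (rule avg_diff_pointwise[OF F]) (use X that in \<open>auto simp: dist_norm\<close>)
    then have "\<forall>y\<in>X. dist (avg act F y) (avg act F x) < e" using e by fastforce
    then show ?thesis using X by blast
  qed
  note nbhd = this
  show ?thesis
    unfolding continuous_on_def tendsto_iff eventually_at_topological
  proof (intro ballI allI impI)
    fix x and e :: real assume "0 < e"
    then obtain A where "open A" "x \<in> A" "\<forall>y\<in>A. dist (avg act F y) (avg act F x) < e"
      using nbhd by metis
    then show "\<exists>A. open A \<and> x \<in> A \<and> (\<forall>y\<in>A. y \<noteq> x \<longrightarrow> y \<in> UNIV \<longrightarrow> dist (avg act F y) (avg act F x) < e)"
      by blast
  qed
qed

lemma avg_C0:
  assumes F: "F \<in> C0" shows "avg act F \<in> C0"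
proof -
  have "compact {x. e \<le> norm (avg act F x)}" if e: "e > 0" for e
  proof (rule compact_closed_subset)
    have "compact {x. e/2 \<le> norm (F x)}" using F half_gt_zero[OF e] unfolding C0_def by blast
    then show "compact (saturation {x. e/2 \<le> norm (F x)})" by (rule compact_saturation)
    show "closed {x. e \<le> norm (avg act F x)}"
      by (intro closed_Collect_le continuous_intros continuous_on_avg F)
    show "{x. e \<le> norm (avg act F x)} \<subseteq> saturation {x. e/2 \<le> norm (F x)}"
    proof (rule ccontr)
      assume "\<not> ?thesis"
      then obtain x where x: "e \<le> norm (avg act F x)" "x \<notin> saturation {x. e/2 \<le> norm (F x)}" by blast
      then have x2: "norm (F (act U x)) < e/2" if "U \<in> unitaries" for U
        using that unfolding saturation_def mem_Collect_eq by (meson not_le)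
      have "norm (avg act F x) \<le> e/2" by (rule norm_avg_le[OF F less_imp_le[OF x2]])
      then show False using x(1) e by simp
    qed
  qed
  then show ?thesis using continuous_on_avg[OF F] by (simp add: C0_def)
qed

lemma avg_add: "F \<in> C0 \<Longrightarrow> G \<in> C0 \<Longrightarrow> avg act (\<lambda>x. F x + G x) = (\<lambda>x. avg act F x + avg act G x)"
  unfolding avg_def
  by (subst Bochner_Integration.integral_add[symmetric])
     (auto intro!: integrable_twist Bochner_Integration.integral_cong simp: twist_def mm.add_left mm.add_right)

lemma twist_fscale: "twist act U (fscale c F) x = cscale c (twist act U F x)"
  by (simp add: twist_def fscale_eq cscale_mult)

lemma avg_fscale:
  assumes "F \<in> C0" shows "avg act (fscale c F) = fscale c (avg act F)"
proof
  fix x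
  have "avg act (fscale c F) x = (\<integral>U. cscale c (if U \<in> unitaries then twist act U F x else 0) \<partial>haar)"
    unfolding avg_def
    by (rule Bochner_Integration.integral_cong)
       (auto simp: twist_fscale linear_0[OF bounded_linear.linear[OF bounded_linear_cscale]])
  also have "\<dots> = cscale c (avg act F x)"
    unfolding avg_def by (rule integral_bounded_linear[OF bounded_linear_cscale integrable_twist[OF assms]])
  finally show "avg act (fscale c F) x = fscale c (avg act F) x" by (simp add: fscale_eq)
qed

text \<open>Twisting by \<open>V\<close> and then by \<open>U\<close> is twisting by
  \<open>V ** U\<close>: left invariance of Haar measure.\<close>

lemma avg_twist:
  assumes F: "F \<in> C0" and V: "V \<in> unitaries"
  shows "avg act (twist act V F) = avg act F"
proof
  fix x
  let ?h = "\<lambda>U. if U \<in> unitaries then twist act U F x else 0"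
  have iff: "V ** U \<in> unitaries \<longleftrightarrow> U \<in> unitaries" for U
  proof
    assume "V ** U \<in> unitaries"
    from unitaries_mult[OF unitaries_cadj[OF V] this] show "U \<in> unitaries"
      using V unfolding unitaries_iff[of V] by (simp add: matrix_mul_assoc)
  qed (use V unitaries_mult in blast)
  have m: "(**) V \<in> measurable haar borel"
    using borel_measurable_continuous_onI[of "(**) V"] by (auto simp: continuous_intros cong: measurable_cong_sets)
  have "avg act F x = (\<integral>U. ?h U \<partial>distr haar borel ((**) V))"
    unfolding avg_def haar_left[OF V] ..
  also have "\<dots> = (\<integral>U. ?h (V ** U) \<partial>haar)"
    using borel_measurable_integrable[OF integrable_twist[OF F, of x]]
    by (intro integral_distr[OF m]) (simp cong: measurable_cong_sets)
  also have "\<dots> = avg act (twist act V F) x"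
    unfolding avg_def by (intro Bochner_Integration.integral_cong) (auto simp: iff twist_mult V)
  finally show "avg act (twist act V F) x = avg act F x" by simp
qed

text \<open>Moving the point by \<open>V\<close> turns the twist by \<open>U\<close> into a
  conjugate of the twist by \<open>U ** V\<close>: right invariance of Haar measure.\<close>

lemma avg_equivariant:
  assumes F: "F \<in> C0" shows "equivariant act (avg act F)"
  unfolding equivariant_def
proof (intro ballI allI)
  fix V :: "complex^'n^'n" and x assume V: "V \<in> unitaries"
  let ?h = "\<lambda>U. if U \<in> unitaries then twist act U F x else 0"
  have i: "V ** cadj V = mat 1" "cadj V ** V = mat 1" using V by (simp_all add: unitaries_iff)
  have iff: "U ** V \<in> unitaries \<longleftrightarrow> U \<in> unitaries" for U
  proof
    assume "U ** V \<in> unitaries"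
    from unitaries_mult[OF this unitaries_cadj[OF V]] show "U \<in> unitaries"
      using i by (simp add: matrix_mul_assoc[symmetric])
  qed (use V unitaries_mult in blast)
  have m: "(\<lambda>U. U ** V) \<in> measurable haar borel"
    using borel_measurable_continuous_onI[of "\<lambda>U. U ** V"] by (auto simp: continuous_intros cong: measurable_cong_sets)
  have hm: "?h \<in> borel_measurable borel"
    using borel_measurable_integrable[OF integrable_twist[OF F, of x]] by (simp cong: measurable_cong_sets)
  have bl: "bounded_linear (\<lambda>A. V ** A ** cadj V)"
    using bounded_linear_compose[OF mm.bounded_linear_left mm.bounded_linear_right] by blast
  have tw: "twist act U F (act V x) = V ** twist act (U ** V) F x ** cadj V" if "U \<in> unitaries" for U
  proof -
    have "V ** twist act (U ** V) F x ** cadj V = (V ** cadj V) ** cadj U ** F (act U (act V x)) ** U ** (V ** cadj V)"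
      using that V by (simp add: twist_def cadj_mult act_mult matrix_mul_assoc)
    then show ?thesis by (simp add: i twist_def)
  qed
  have int: "integrable haar (\<lambda>U. ?h (U ** V))"
    using integrable_distr[OF m, of ?h] integrable_twist[OF F, of x] haar_right[OF V] by simp
  have "avg act F (act V x) = (\<integral>U. V ** ?h (U ** V) ** cadj V \<partial>haar)"
    unfolding avg_def
    by (intro Bochner_Integration.integral_cong) (auto simp: iff tw mm.zero_left mm.zero_right)
  also have "\<dots> = V ** (\<integral>U. ?h (U ** V) \<partial>haar) ** cadj V"
    by (rule integral_bounded_linear[OF bl int])
  also have "(\<integral>U. ?h (U ** V) \<partial>haar) = (\<integral>U. ?h U \<partial>distr haar borel (\<lambda>U. U ** V))"
    by (rule integral_distr[OF m hm, symmetric])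
  also have "\<dots> = avg act F x" unfolding haar_right[OF V] avg_def ..
  finally show "avg act F (act V x) = V ** avg act F x ** cadj V" .
qed

lemma avg_Cstar: "F \<in> C0 \<Longrightarrow> avg act F \<in> Cstar act"
  by (simp add: Cstar_iff avg_C0 avg_equivariant)

lemma avg_id:
  assumes F: "F \<in> Cstar act" shows "avg act F = F"
proof
  fix x
  interpret finite_measure "haar :: (complex^'n^'n) measure" by (rule finite_haar)
  have "avg act F x = (\<integral>U. F x \<partial>(haar :: (complex^'n^'n) measure))"
    unfolding avg_def
  proof (rule integral_cong_AE)
    show "AE U in haar. (if U \<in> unitaries then twist act U F x else 0) = F x"
      using haar_unitary by eventually_elim (use F in \<open>auto simp: twist_equivariant Cstar_iff\<close>)
    show "(\<lambda>U. if U \<in> unitaries then twist act U F x else 0) \<in> borel_measurable haar"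
      using F by (intro borel_measurable_integrable integrable_twist) (simp add: Cstar_iff)
  qed simp
  also have "\<dots> = F x" using haar_prob[where 'n='n] by (simp add: measure_def)
  finally show "avg act F x = F x" .
qed

text \<open>On the compact set \<open>S\<close> joint continuity gives uniformity in
  \<open>x\<close>. Off \<open>S\<close> every twist of \<open>F\<close> has norm below
  \<open>e/2\<close>, so any two are within \<open>e\<close>.\<close>

lemma twist_equicontinuous:
  assumes F: "F \<in> C0" and V: "V \<in> unitaries" and e: "e > 0"
  obtains X where "open X" "V \<in> X"
    "\<And>U x. U \<in> X \<Longrightarrow> U \<in> unitaries \<Longrightarrow> norm (twist act U F x - twist act V F x) \<le> e"
proof -
  define S where "S = saturation {x. e/2 \<le> norm (F x)}"
  have cS: "compact S"
    unfolding S_def using F half_gt_zero[OF e] unfolding C0_def by (intro compact_saturation) blast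
  have c: "continuous_on (unitaries \<times> S) (\<lambda>p. twist act (fst p) F (snd p))"
    by (intro continuous_on_twist C0_continuous[OF F] continuous_intros) auto
  obtain X where X: "V \<in> X" "open X" "\<forall>U\<in>X \<inter> unitaries. \<forall>x\<in>S.
      dist (twist act (fst (U, x)) F (snd (U, x))) (twist act (fst (V, x)) F (snd (V, x))) \<le> e"
    using continuous_on_prod_compactE[OF c cS V e] by blast
  have "norm (twist act U F x - twist act V F x) \<le> e" if U: "U \<in> X" "U \<in> unitaries" for U x
  proof (cases "x \<in> S")
    case True
    then show ?thesis using X(3) U by (auto simp: dist_norm)
  next
    case False
    then have "norm (F (act U x)) < e/2" "norm (F (act V x)) < e/2"
      using U V by (auto simp: S_def saturation_def not_le)
    then show ?thesis
      using norm_triangle_ineq4[of "twist act U F x" "twist act V F x"] U V by (simp add: norm_twist)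
  qed
  then show ?thesis using that X by blast
qed

lemma twist_C0:
  assumes F: "F \<in> C0" and U: "U \<in> unitaries" shows "twist act U F \<in> C0"
proof -
  have c: "continuous_on UNIV (twist act U F)"
    by (intro continuous_on_twist C0_continuous[OF F] continuous_intros U)
  have "compact {x. e \<le> norm (twist act U F x)}" if e: "e > 0" for e
  proof (rule compact_closed_subset)
    have "compact {x. e \<le> norm (F x)}" using F e unfolding C0_def by blast
    then show "compact (saturation {x. e \<le> norm (F x)})" by (rule compact_saturation)
    show "closed {x. e \<le> norm (twist act U F x)}"
      by (intro closed_Collect_le continuous_intros c)
  qed (use U in \<open>auto simp: saturation_def norm_twist\<close>)
  then show ?thesis using c by (simp add: C0_def)
qed

lemma fscale_C0: "F \<in> C0 \<Longrightarrow> fscale c F \<in> C0"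
  unfolding fscale_eq
  by (rule C0_dominated[where K="cmod c"])
     (auto simp: norm_cscale intro!: bounded_linear.continuous_on[OF bounded_linear_cscale C0_continuous])

text \<open>\<open>avg act F\<close> is a uniform limit of convex combinations of twists of \<open>F\<close>, so no Fubini theorem is
  needed to see that invariant functionals do not distinguish them.\<close>
lemma invariant_avg:
  assumes add: "\<And>F G. F \<in> C0 \<Longrightarrow> G \<in> C0 \<Longrightarrow> \<Phi> (\<lambda>x. F x + G x) = \<Phi> F + \<Phi> G"
    and scale: "\<And>c F. F \<in> C0 \<Longrightarrow> \<Phi> (fscale c F) = c * (\<Phi> F :: complex)"
    and bound: "\<And>F B. F \<in> C0 \<Longrightarrow> (\<And>x. norm (F x) \<le> B) \<Longrightarrow> cmod (\<Phi> F) \<le> C * B"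
    and inv: "\<And>F U. F \<in> C0 \<Longrightarrow> U \<in> unitaries \<Longrightarrow> \<Phi> (twist act U F) = \<Phi> F"
    and F: "F \<in> C0"
  shows "\<Phi> (avg act F) = \<Phi> F"
proof -
  have "cmod (\<Phi> (avg act F) - \<Phi> F) \<le> C * e" if e: "e > 0" for e
  proof -
    have "\<forall>V\<in>unitaries. \<exists>X. open X \<and> V \<in> X \<and> (\<forall>U\<in>X \<inter> unitaries. \<forall>x. norm (twist act U F x - twist act V F x) \<le> e)"
      using twist_equicontinuous[OF F _ e] by (metis IntD1 IntD2)
    then obtain X where X: "\<And>V. V \<in> unitaries \<Longrightarrow> open (X V) \<and> V \<in> X V \<and>
        (\<forall>U\<in>X V \<inter> unitaries. \<forall>x. norm (twist act U F x - twist act V F x) \<le> e)" by metis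
    obtain T where T: "T \<subseteq> unitaries" "finite T" "unitaries \<subseteq> (\<Union>V\<in>T. X V)"
      using compactE_image[OF compact_unitaries, of unitaries X] X by blast
    obtain m and V :: "nat \<Rightarrow> complex^'n^'n" where V: "T = V ` {i. i < m}"
      using finite_imp_nat_seg_image_inj_on[OF T(2)] by blast
    \<comment> \<open>Writing the finite cover as a sequence that is empty from \<open>m\<close> on
      lets \<open>disjointed\<close> produce a Borel partition of \<open>unitaries\<close> with at
      most \<open>m\<close> nonempty pieces.\<close>
    define W where "W i = (if i < m then X (V i) \<inter> unitaries else {})" for i
    define D where "D = disjointed W"
    have VU: "V i \<in> unitaries" if "i < m" for i using T(1) V that by auto
    have uc: "(unitaries :: (complex^'n^'n) set) \<in> sets borel" by (intro borel_closed compact_imp_closed compact_unitaries)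
    have Wm: "W i \<in> sets borel" for i using X VU uc by (auto simp: W_def)
    then have Dm: "D i \<in> sets borel" for i
      unfolding D_def disjointed_def by (intro sets.Diff sets.finite_UN) auto
    have UD: "(\<Union>i. D i) = unitaries"
    proof -
      have "(\<Union>i. W i) = unitaries" using T(3) V by (auto simp: W_def split: if_splits)
      then show ?thesis by (simp add: D_def UN_disjointed_eq)
    qed
    have Dsub: "D i \<subseteq> W i" for i unfolding D_def disjointed_def by auto
    have disj: "disjoint_family D" unfolding D_def by (rule disjoint_family_disjointed)
    interpret finite_measure "haar :: (complex^'n^'n) measure" by (rule finite_haar)
    define c where "c i = measure haar (D i)" for i
    have Dout: "D i = {}" if "\<not> i < m" for i using Dsub[of i] that by (auto simp: W_def)
    have csum: "(\<Sum>i<m. c i) = 1"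
    proof -
      have "(\<Sum>i<m. c i) = measure haar (\<Union>i<m. D i)"
        unfolding c_def using Dm disj
        by (intro finite_measure_finite_Union[symmetric]) (auto simp: disjoint_family_on_def)
      also have "(\<Union>i<m. D i) = unitaries" using UD Dout by (auto; metis UN_iff UNIV_I empty_iff)
      also have "measure haar (unitaries :: (complex^'n^'n) set) = measure haar (UNIV :: (complex^'n^'n) set)"
        using haar_unitary uc by (intro measure_eq_AE) auto
      also have "\<dots> = 1" using haar_prob[where 'n='n] by (simp add: measure_def)
      finally show ?thesis .
    qed
    \<comment> \<open>A Riemann sum of the averaging integral. The sample point \<open>V i\<close>
      need not belong to \<open>D i\<close>; it matters only that \<open>D i\<close> lies in the
      neighbourhood \<open>X (V i)\<close>.\<close>
    define R where "R = (\<lambda>x. \<Sum>i<m. fscale (c i) (twist act (V i) F) x)"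
    have fs: "fscale (complex_of_real r) A x = r *\<^sub>R A x" for r and A :: "'x \<Rightarrow> complex^'n^'n" and x
      by (simp add: fscale_def vec_eq_iff scaleR_conv_of_real[where 'a=complex])
    have close: "norm (avg act F x - R x) \<le> e" for x
    proof -
      let ?g = "\<lambda>U. if U \<in> unitaries then twist act U F x else 0"
      have ii: "integrable haar (\<lambda>U. indicat_real (D i) U *\<^sub>R twist act (V i) F x)" for i
        using Dm by (intro integrable_scaleR_left integrable_real_indicator) (auto simp: emeasure_finite less_top[symmetric])
      have "R x = (\<Sum>i<m. \<integral>U. indicat_real (D i) U *\<^sub>R twist act (V i) F x \<partial>haar)"
        unfolding R_def fs c_def using Dm
        by (intro sum.cong refl, subst integral_scaleR_left) (auto simp: less_top[symmetric])
      also have "\<dots> = (\<integral>U. (\<Sum>i<m. indicat_real (D i) U *\<^sub>R twist act (V i) F x) \<partial>haar)"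
        by (rule Bochner_Integration.integral_sum[symmetric]) (rule ii)
      finally have Rx: "R x = (\<integral>U. (\<Sum>i<m. indicat_real (D i) U *\<^sub>R twist act (V i) F x) \<partial>haar)" .
      have si: "integrable haar (\<lambda>U. \<Sum>i<m. indicat_real (D i) U *\<^sub>R twist act (V i) F x)"
        by (rule Bochner_Integration.integrable_sum[OF ii])
      have "avg act F x - R x =
         (\<integral>U. ?g U - (\<Sum>i<m. indicat_real (D i) U *\<^sub>R twist act (V i) F x) \<partial>haar)"
        unfolding avg_def Rx by (rule Bochner_Integration.integral_diff[OF integrable_twist[OF F] si, symmetric])
      also have "norm \<dots> \<le> e"
      proof (rule norm_integral_haar_le)
        show "integrable haar (\<lambda>U. ?g U - (\<Sum>i<m. indicat_real (D i) U *\<^sub>R twist act (V i) F x))"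
          by (rule Bochner_Integration.integrable_diff[OF integrable_twist[OF F] si])
        fix U :: "complex^'n^'n" assume U: "U \<in> unitaries"
        then obtain i where i: "U \<in> D i" using UD by auto
        then have im: "i < m" using Dout by blast
        have "(\<Sum>k<m. indicat_real (D k) U *\<^sub>R twist act (V k) F x) = (\<Sum>k<m. if k = i then twist act (V i) F x else 0)"
        proof (intro sum.cong refl)
          fix k
          have "U \<in> D k \<longleftrightarrow> k = i" using disj i by (auto simp: disjoint_family_on_def)
          then show "indicat_real (D k) U *\<^sub>R twist act (V k) F x = (if k = i then twist act (V i) F x else 0)"
            by (simp add: indicator_def)
        qed
        also have "\<dots> = twist act (V i) F x" using im by simp
        finally have "?g U - (\<Sum>k<m. indicat_real (D k) U *\<^sub>R twist act (V k) F x) = twist act U F x - twist act (V i) F x"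
          using U by simp
        moreover have "U \<in> X (V i) \<inter> unitaries" using Dsub[of i] i im by (auto simp: W_def)
        ultimately show "norm (?g U - (\<Sum>i<m. indicat_real (D i) U *\<^sub>R twist act (V i) F x)) \<le> e"
          using X[OF VU[OF im]] by (simp only:)
      qed
      finally show ?thesis .
    qed
    have tC: "fscale (c i) (twist act (V i) F) \<in> C0" if "i < m" for i
      by (intro fscale_C0 twist_C0 F VU that)
    have R: "R \<in> C0 \<and> \<Phi> R = \<Phi> F"
    proof -
      have "(\<lambda>x. \<Sum>i<k. fscale (c i) (twist act (V i) F) x) \<in> C0 \<and>
         \<Phi> (\<lambda>x. \<Sum>i<k. fscale (c i) (twist act (V i) F) x) = (\<Sum>i<k. c i * \<Phi> F)" if "k \<le> m" for k
        using that
      proof (induction k)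
        case 0
        have "\<Phi> (\<lambda>x. 0) = 0" using add[OF C0_zero C0_zero] by simp
        then show ?case by (simp add: C0_zero)
      next
        case (Suc k)
        then have k: "k < m" by simp
        have p: "\<Phi> (fscale (c k) (twist act (V k) F)) = c k * \<Phi> F"
          unfolding scale[OF twist_C0[OF F VU[OF k]]] inv[OF F VU[OF k]] ..
        have S: "(\<lambda>x. \<Sum>i<k. fscale (c i) (twist act (V i) F) x) \<in> C0"
          "\<Phi> (\<lambda>x. \<Sum>i<k. fscale (c i) (twist act (V i) F) x) = (\<Sum>i<k. c i * \<Phi> F)"
          using Suc by auto
        show ?case
          unfolding sum.lessThan_Suc add[OF S(1) tC[OF k]] S(2) p using C0_add[OF S(1) tC[OF k]] by simp
      qed
      from this[of m] show ?thesis
        unfolding R_def sum_distrib_right[symmetric] of_real_sum[symmetric] csum by simp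
    qed
    have aC: "avg act F \<in> C0" by (rule avg_C0[OF F])
    have "\<Phi> (\<lambda>x. (avg act F x - R x) + R x) = \<Phi> (\<lambda>x. avg act F x - R x) + \<Phi> R"
      using R by (intro add C0_diff aC) auto
    then have "\<Phi> (avg act F) - \<Phi> F = \<Phi> (\<lambda>x. avg act F x - R x)" using R by simp
    also have "cmod \<dots> \<le> C * e" using R by (intro bound C0_diff aC close) auto
    finally show ?thesis .
  qed
  note key = this
  have "cmod (\<Phi> (avg act F) - \<Phi> F) \<le> 0 + d" if d: "d > 0" for d
  proof -
    \<comment> \<open>\<open>\<bar>C\<bar> + 1\<close> is positive whatever the sign of
      \<open>C\<close>.\<close>
    have "cmod (\<Phi> (avg act F) - \<Phi> F) \<le> C * (d / (\<bar>C\<bar> + 1))" by (rule key) (use d in auto)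
    also have "\<dots> \<le> (\<bar>C\<bar> + 1) * (d / (\<bar>C\<bar> + 1))" using d by (intro mult_right_mono) auto
    finally show ?thesis by simp
  qed
  then have "cmod (\<Phi> (avg act F) - \<Phi> F) \<le> 0" by (rule field_le_epsilon)
  then show ?thesis by simp
qed

end

section \<open>Radon functionals on matrix-valued functions\<close>

definition munit :: "'n \<Rightarrow> 'n \<Rightarrow> complex \<Rightarrow> complex^'n::finite^'n" where
  "munit j k c = (\<chi> a b. if a = j \<and> b = k then c else 0)"

lemma munit_nth: "munit j k c $ a $ b = (if a = j \<and> b = k then c else 0)"
  by (simp add: munit_def)

lemma munit_add: "munit j k (c + d) = munit j k c + munit j k d"
  by (simp add: vec_eq_iff munit_nth)

lemma cscale_munit: "cscale c (munit j k d) = munit j k (c * d)"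
  by (simp add: vec_eq_iff munit_nth cscale_def)

lemma norm_munit: "norm (munit j k c) = cmod c"
proof -
  have "(norm (munit j k c))\<^sup>2 = (\<Sum>a\<in>UNIV. \<Sum>b\<in>UNIV. if b = k then (if a = j then (cmod c)\<^sup>2 else 0) else 0)"
    unfolding norm_matrix_sq munit_nth by (intro sum.cong refl) auto
  also have "\<dots> = (cmod c)\<^sup>2" by simp
  finally show ?thesis by simp
qed

lemma bounded_linear_munit: "bounded_linear (munit j k)"
  by (rule bounded_linear_intro[where K=1]) (auto simp: norm_munit munit_add vec_eq_iff munit_nth)

lemma matrix_eq_sum_munit: "(\<Sum>j\<in>UNIV. \<Sum>k\<in>UNIV. munit j k (A $ j $ k)) = (A :: complex^'n::finite^'n)"
proof -
  have "(\<Sum>j\<in>UNIV. \<Sum>k\<in>UNIV. munit j k (A $ j $ k)) $ a $ b = A $ a $ b" for a b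
  proof -
    have "(\<Sum>j\<in>UNIV. \<Sum>k\<in>UNIV. munit j k (A $ j $ k)) $ a $ b =
        (\<Sum>j\<in>UNIV. \<Sum>k\<in>UNIV. if a = j \<and> b = k then A $ j $ k else 0)"
      by (simp add: munit_nth)
    also have "\<dots> = (\<Sum>j\<in>UNIV. if a = j then A $ j $ b else 0)"
    proof (rule sum.cong[OF refl])
      show "(\<Sum>k\<in>UNIV. if a = j \<and> b = k then A $ j $ k else 0) = (if a = j then A $ j $ b else 0)" for j
        by (cases "a = j") simp_all
    qed
    finally show ?thesis by simp
  qed
  then show ?thesis by (simp add: vec_eq_iff)
qed

lemma cmod_nth_nth_le: "cmod (A $ j $ k) \<le> norm (A :: complex^'n^'m)"
  by (rule order_trans[OF Finite_Cartesian_Product.norm_nth_le Finite_Cartesian_Product.norm_nth_le])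

lemma bounded_linear_nth_nth: "bounded_linear (\<lambda>A :: complex^'n^'m. A $ j $ k)"
  by (rule bounded_linear_intro[where K=1]) (simp_all add: cmod_nth_nth_le)

lemma bounded_borel_linear:
  fixes F :: "'x::topological_space \<Rightarrow> 'a::real_normed_vector" and l :: "'a \<Rightarrow> 'b::real_normed_vector"
  assumes "F \<in> bounded_borel" "bounded_linear l"
  shows "(\<lambda>x. l (F x)) \<in> bounded_borel"
proof -
  obtain K where "\<And>y. norm (l y) \<le> norm y * K" "0 < K" using bounded_linear.pos_bounded[OF assms(2)] by blast
  then show ?thesis
    by (intro bounded_borel_continuous_comp[OF assms(1) linear_continuous_on[OF assms(2)], where K=K])
       (simp_all add: mult.commute less_imp_le)
qed

lemma C0_linear:
  fixes F :: "'x::topological_space \<Rightarrow> 'a::real_normed_vector" and l :: "'a \<Rightarrow> 'b::real_normed_vector"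
  assumes "F \<in> C0" "bounded_linear l"
  shows "(\<lambda>x. l (F x)) \<in> C0"
proof -
  obtain K where "\<And>y. norm (l y) \<le> norm y * K" using bounded_linear.pos_bounded[OF assms(2)] by blast
  then show ?thesis
    by (intro C0_dominated[OF assms(1) bounded_linear.continuous_on[OF assms(2) C0_continuous[OF assms(1)]], where K=K])
       (simp add: mult.commute)
qed

section \<open>Operations on bounded Borel matrix functions and Radon functionals\<close>

lemma fscale_bounded_borel: "F \<in> bounded_borel \<Longrightarrow> fscale c F \<in> bounded_borel"
  unfolding fscale_eq by (rule bounded_borel_linear[OF _ bounded_linear_cscale])

lemma fadj_bounded_borel: "F \<in> bounded_borel \<Longrightarrow> fadj F \<in> bounded_borel"
  unfolding fadj_def by (rule bounded_borel_linear[OF _ bounded_linear_cadj])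

lemma fmult_bounded_borel:
  assumes F: "F \<in> bounded_borel" and G: "G \<in> bounded_borel"
  shows "fmult F G \<in> bounded_borel"
proof -
  obtain B where B: "\<And>x. norm (F x) \<le> B" by (rule bounded_borelE[OF F]) blast
  obtain D where D: "\<And>x. norm (G x) \<le> D" by (rule bounded_borelE[OF G]) blast
  have "continuous_on UNIV (\<lambda>p :: (complex^'b^'b) \<times> (complex^'b^'b). fst p ** snd p)" by (intro continuous_intros)
  then have "(\<lambda>x. F x ** G x) \<in> borel_measurable borel"
    using borel_measurable_continuous_Pair[of F borel G "(**)"] F G by (simp add: bounded_borel_def)
  then show ?thesis unfolding fmult_def by (rule bounded_borelI) (rule norm_matrix_mult_mono[OF B D])
qed

text \<open>The matrix version of \<open>dominated\<close>, with the dominating measure quantified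
  away: functionals are compared with each other, their measures are not. Evaluated on
  \<open>munit j k\<close> times indicators it yields regular complex measures.\<close>

definition radon_functional :: "(('x::topological_space \<Rightarrow> complex^'n::finite^'n) \<Rightarrow> complex) \<Rightarrow> bool" where
  "radon_functional \<Phi> \<longleftrightarrow>
     (\<forall>F\<in>bounded_borel. \<forall>G\<in>bounded_borel. \<Phi> (\<lambda>x. F x + G x) = \<Phi> F + \<Phi> G) \<and>
     (\<forall>c. \<forall>F\<in>bounded_borel. \<Phi> (fscale c F) = c * \<Phi> F) \<and>
     (\<exists>N. radon N \<and> (\<forall>F\<in>bounded_borel. cmod (\<Phi> F) \<le> (\<integral>x. norm (F x) \<partial>N)))"

lemma radon_functional_add:
  "radon_functional \<Phi> \<Longrightarrow> F \<in> bounded_borel \<Longrightarrow> G \<in> bounded_borel \<Longrightarrow> \<Phi> (\<lambda>x. F x + G x) = \<Phi> F + \<Phi> G"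
  by (simp add: radon_functional_def)

lemma radon_functional_fscale:
  "radon_functional \<Phi> \<Longrightarrow> F \<in> bounded_borel \<Longrightarrow> \<Phi> (fscale c F) = c * \<Phi> F"
  by (simp add: radon_functional_def)

lemma radon_functionalE:
  assumes "radon_functional \<Phi>"
  obtains N where "radon N" "\<And>F. F \<in> bounded_borel \<Longrightarrow> cmod (\<Phi> F) \<le> (\<integral>x. norm (F x) \<partial>N)"
proof -
  have "\<exists>N. radon N \<and> (\<forall>F\<in>bounded_borel. cmod (\<Phi> F) \<le> (\<integral>x. norm (F x) \<partial>N))"
    using assms by (simp add: radon_functional_def)
  then show ?thesis using that by auto
qed

lemma radon_functionalI:
  assumes "\<And>F G. F \<in> bounded_borel \<Longrightarrow> G \<in> bounded_borel \<Longrightarrow> \<Phi> (\<lambda>x. F x + G x) = \<Phi> F + \<Phi> G"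
    and "\<And>c F. F \<in> bounded_borel \<Longrightarrow> \<Phi> (fscale c F) = c * \<Phi> F"
    and "radon N" and "\<And>F. F \<in> bounded_borel \<Longrightarrow> cmod (\<Phi> F) \<le> (\<integral>x. norm (F x) \<partial>N)"
  shows "radon_functional \<Phi>"
  unfolding radon_functional_def
proof (intro conjI ballI allI exI[where x=N])
  show "\<Phi> (\<lambda>x. F x + G x) = \<Phi> F + \<Phi> G" if "F \<in> bounded_borel" "G \<in> bounded_borel" for F G
    by (rule assms(1)[OF that])
  show "\<Phi> (fscale c F) = c * \<Phi> F" if "F \<in> bounded_borel" for c F
    by (rule assms(2)[OF that])
  show "cmod (\<Phi> F) \<le> (\<integral>x. norm (F x) \<partial>N)" if "F \<in> bounded_borel" for F
    by (rule assms(4)[OF that])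
qed (rule assms(3))

lemma radon_integral_le:
  fixes f :: "'x::topological_space \<Rightarrow> real"
  assumes N: "radon N" and f: "f \<in> bounded_borel" and B: "\<And>x. f x \<le> B"
  shows "(\<integral>x. f x \<partial>N) \<le> measure N UNIV * B"
proof -
  have N': "finite_measure N" "sets N = sets borel" using N by (simp_all add: radon_def)
  interpret finite_measure N by (rule N')
  have sp: "space N = UNIV" using N'(2) sets_eq_imp_space_eq by fastforce
  have "(\<integral>x. f x \<partial>N) \<le> (\<integral>x. B \<partial>N)"
    by (rule integral_mono[OF bounded_borel_integrable[OF f N']]) (use B in auto)
  then show ?thesis using sp by simp
qed

lemma radon_functional_bounded:
  fixes \<Phi> :: "('x::topological_space \<Rightarrow> complex^'n::finite^'n) \<Rightarrow> complex"
  assumes "radon_functional \<Phi>"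
  obtains C where "0 \<le> C" "\<And>F B. F \<in> bounded_borel \<Longrightarrow> (\<And>x. norm (F x) \<le> B) \<Longrightarrow> cmod (\<Phi> F) \<le> C * B"
proof -
  obtain N where N: "radon N" "\<And>F. F \<in> bounded_borel \<Longrightarrow> cmod (\<Phi> F) \<le> (\<integral>x. norm (F x) \<partial>N)"
    by (rule radon_functionalE[OF assms]) blast
  show ?thesis
  proof (rule that[of "measure N UNIV"])
    fix F :: "'x \<Rightarrow> complex^'n^'n" and B assume F: "F \<in> bounded_borel" "\<And>x. norm (F x) \<le> B"
    show "cmod (\<Phi> F) \<le> measure N UNIV * B"
      by (rule order_trans[OF N(2)[OF F(1)] radon_integral_le[OF N(1) bounded_borel_cmod[OF F(1)] F(2)]])
  qed simp
qed

lemma radon_functional_sum: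
  fixes \<Phi> :: "('x::topological_space \<Rightarrow> complex^'n::finite^'n) \<Rightarrow> complex"
  assumes "radon_functional \<Phi>" "finite I" "\<And>i. i \<in> I \<Longrightarrow> F i \<in> bounded_borel"
  shows "\<Phi> (\<lambda>x. \<Sum>i\<in>I. F i x) = (\<Sum>i\<in>I. \<Phi> (F i))"
  using assms(2,3)
proof (induction I)
  case empty
  have z: "(\<lambda>x :: 'x. 0 :: complex^'n^'n) \<in> bounded_borel" by (rule bounded_borelI[where B=0]) auto
  have "\<Phi> (\<lambda>x. 0 + 0) = \<Phi> (\<lambda>x. 0) + \<Phi> (\<lambda>x. 0)" by (rule radon_functional_add[OF assms(1) z z])
  then show ?case by simp
next
  case (insert i I)
  then have "(\<lambda>x. \<Sum>i\<in>I. F i x) \<in> bounded_borel" by (intro bounded_borel_sum) auto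
  then have "\<Phi> (\<lambda>x. F i x + (\<Sum>i\<in>I. F i x)) = \<Phi> (F i) + \<Phi> (\<lambda>x. \<Sum>i\<in>I. F i x)"
    using insert by (intro radon_functional_add[OF assms(1)]) auto
  then show ?case using insert by simp
qed

lemma radon_functional_entry:
  assumes \<Phi>: "radon_functional \<Phi>"
  obtains N where "dominated (\<lambda>g. \<Phi> (\<lambda>x. munit j k (g x))) N"
proof -
  obtain N where N: "radon N" "\<And>F. F \<in> bounded_borel \<Longrightarrow> cmod (\<Phi> F) \<le> (\<integral>x. norm (F x) \<partial>N)"
    by (rule radon_functionalE[OF \<Phi>]) blast
  have m: "(\<lambda>x. munit j k (g x)) \<in> bounded_borel" if "g \<in> bounded_borel" for g :: "'a \<Rightarrow> complex"
    by (rule bounded_borel_linear[OF that bounded_linear_munit])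
  have s: "(\<lambda>x. munit j k (c * g x)) = fscale c (\<lambda>x. munit j k (g x))" for c and g :: "'a \<Rightarrow> complex"
    by (simp add: fscale_eq cscale_munit)
  have "dominated (\<lambda>g. \<Phi> (\<lambda>x. munit j k (g x))) N"
    unfolding dominated_def linear_on_bb_def
  proof (intro conjI ballI allI N(1))
    show "\<Phi> (\<lambda>x. munit j k (f x + g x)) = \<Phi> (\<lambda>x. munit j k (f x)) + \<Phi> (\<lambda>x. munit j k (g x))"
      if "f \<in> bounded_borel" "g \<in> bounded_borel" for f g
      unfolding munit_add by (rule radon_functional_add[OF \<Phi> m[OF that(1)] m[OF that(2)]])
    show "\<Phi> (\<lambda>x. munit j k (c * f x)) = c * \<Phi> (\<lambda>x. munit j k (f x))" if "f \<in> bounded_borel" for c f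
      unfolding s by (rule radon_functional_fscale[OF \<Phi> m[OF that]])
    show "cmod (\<Phi> (\<lambda>x. munit j k (f x))) \<le> (\<integral>x. cmod (f x) \<partial>N)" if "f \<in> bounded_borel" for f
      using N(2)[OF m[OF that]] by (simp add: norm_munit)
  qed
  then show ?thesis using that by blast
qed

lemma radon_functional_decomp:
  assumes \<Phi>: "radon_functional \<Phi>" and F: "F \<in> bounded_borel"
  shows "\<Phi> F = (\<Sum>j\<in>UNIV. \<Sum>k\<in>UNIV. \<Phi> (\<lambda>x. munit j k (F x $ j $ k)))"
proof -
  have m: "(\<lambda>x. munit j k (F x $ j $ k)) \<in> bounded_borel" for j k
    by (intro bounded_borel_linear[OF _ bounded_linear_munit] bounded_borel_linear[OF F bounded_linear_nth_nth])
  have "\<Phi> F = \<Phi> (\<lambda>x. \<Sum>j\<in>UNIV. \<Sum>k\<in>UNIV. munit j k (F x $ j $ k))"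
    by (simp add: matrix_eq_sum_munit)
  also have "\<dots> = (\<Sum>j\<in>UNIV. \<Phi> (\<lambda>x. \<Sum>k\<in>UNIV. munit j k (F x $ j $ k)))"
    by (rule radon_functional_sum[OF \<Phi>]) (auto intro!: bounded_borel_sum m)
  also have "\<dots> = (\<Sum>j\<in>UNIV. \<Sum>k\<in>UNIV. \<Phi> (\<lambda>x. munit j k (F x $ j $ k)))"
    by (intro sum.cong refl radon_functional_sum[OF \<Phi>] m) auto
  finally show ?thesis .
qed

lemma radon_functional_eq_0_indicator:
  assumes \<Phi>: "radon_functional \<Phi>" and F: "F \<in> bounded_borel"
    and 0: "\<And>A j k. A \<in> sets borel \<Longrightarrow> \<Phi> (\<lambda>x. munit j k (indicator A x)) = 0"
  shows "\<Phi> F = 0"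
proof -
  have "\<Phi> (\<lambda>x. munit j k (F x $ j $ k)) = 0" for j k
  proof -
    obtain N where N: "dominated (\<lambda>g. \<Phi> (\<lambda>x. munit j k (g x))) N" using radon_functional_entry[OF \<Phi>] by metis
    show ?thesis
      using linear_on_bb_eq_0[OF dominatedD(1)[OF N] dominated_bound[OF N] 0
          bounded_borel_linear[OF F bounded_linear_nth_nth]] by simp
  qed
  then show ?thesis using radon_functional_decomp[OF \<Phi> F] by simp
qed

text \<open>Unlike the criterion by indicators, this one draws on regularity of the dominating
  measure and on local compactness.\<close>

lemma radon_functional_eq_0:
  fixes \<Phi> :: "('x::t2_space \<Rightarrow> complex^'n::finite^'n) \<Rightarrow> complex"
  assumes lc: "locally_compact_space (euclidean :: 'x topology)"
    and \<Phi>: "radon_functional \<Phi>" and 0: "\<And>F. F \<in> C0 \<Longrightarrow> \<Phi> F = 0" and F: "F \<in> bounded_borel"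
  shows "\<Phi> F = 0"
proof -
  have "\<Phi> (\<lambda>x. munit j k (F x $ j $ k)) = 0" for j k
  proof -
    obtain N where N: "dominated (\<lambda>g. \<Phi> (\<lambda>x. munit j k (g x))) N" using radon_functional_entry[OF \<Phi>] by metis
    show ?thesis
      using dominated_eq_0[OF lc N 0[OF C0_linear[OF _ bounded_linear_munit]]
          bounded_borel_linear[OF F bounded_linear_nth_nth]] by simp
  qed
  then show ?thesis using radon_functional_decomp[OF \<Phi> F] by simp
qed

lemma radon_functional_diff:
  fixes \<Phi> \<Psi> :: "('x::t2_space \<Rightarrow> complex^'n::finite^'n) \<Rightarrow> complex"
  assumes \<Phi>: "radon_functional \<Phi>" and \<Psi>: "radon_functional \<Psi>"
  shows "radon_functional (\<lambda>F. \<Phi> F - \<Psi> F)"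
proof -
  obtain N where N: "radon N" "\<And>F. F \<in> bounded_borel \<Longrightarrow> cmod (\<Phi> F) \<le> (\<integral>x. norm (F x) \<partial>N)"
    by (rule radon_functionalE[OF \<Phi>]) blast
  obtain M where M: "radon M" "\<And>F. F \<in> bounded_borel \<Longrightarrow> cmod (\<Psi> F) \<le> (\<integral>x. norm (F x) \<partial>M)"
    by (rule radon_functionalE[OF \<Psi>]) blast
  show ?thesis
  proof (rule radon_functionalI[OF _ _ radon_add_measure[OF N(1) M(1)]])
    fix F :: "'x \<Rightarrow> complex^'n^'n" assume F: "F \<in> bounded_borel"
    have "(\<integral>x. norm (F x) \<partial>add_measure N M) = (\<integral>x. norm (F x) \<partial>N) + (\<integral>x. norm (F x) \<partial>M)"
      using N(1) M(1) by (intro integral_add_measure bounded_borel_cmod[OF F]) (auto simp: radon_def)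
    then show "cmod (\<Phi> F - \<Psi> F) \<le> (\<integral>x. norm (F x) \<partial>add_measure N M)"
      using N(2)[OF F] M(2)[OF F] norm_triangle_ineq4[of "\<Phi> F" "\<Psi> F"] by linarith
  qed (simp_all add: radon_functional_add[OF \<Phi>] radon_functional_add[OF \<Psi>]
      radon_functional_fscale[OF \<Phi>] radon_functional_fscale[OF \<Psi>] algebra_simps)
qed

lemma radon_functional_zero: "radon_functional (\<lambda>F :: 'x::t2_space \<Rightarrow> complex^'n::finite^'n. 0)"
proof (rule radon_functionalI)
  have "\<exists>K V. compact K \<and> open V \<and> K \<subseteq> A \<and> A \<subseteq> V \<and> measure (null_measure (borel :: 'x measure)) (V - K) < e"
    if "e > 0" for A e
    by (rule exI[of _ "{}"], rule exI[of _ UNIV]) (use that in \<open>simp add: measure_def\<close>)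
  then show "radon (null_measure (borel :: 'x measure))"
    by (auto simp: radon_def intro!: finite_measureI)
qed auto

lemma radon_functional_plus:
  fixes \<Phi> \<Psi> :: "('x::t2_space \<Rightarrow> complex^'n::finite^'n) \<Rightarrow> complex"
  assumes "radon_functional \<Phi>" "radon_functional \<Psi>"
  shows "radon_functional (\<lambda>F. \<Phi> F + \<Psi> F)"
  using radon_functional_diff[OF assms(1) radon_functional_diff[OF radon_functional_zero assms(2)]] by simp

lemma radon_functional_sum_functionals:
  fixes \<Phi> :: "'i \<Rightarrow> ('x::t2_space \<Rightarrow> complex^'n::finite^'n) \<Rightarrow> complex"
  assumes "finite I" "\<And>i. i \<in> I \<Longrightarrow> radon_functional (\<Phi> i)"
  shows "radon_functional (\<lambda>F. \<Sum>i\<in>I. \<Phi> i F)"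
  using assms
proof (induction I)
  case empty then show ?case by (simp add: radon_functional_zero)
next
  case (insert i I) then show ?case by (simp add: radon_functional_plus)
qed

lemma radon_functional_of_entry:
  assumes d: "dominated L N"
  shows "radon_functional (\<lambda>F. L (\<lambda>x. F x $ j $ k))"
proof (rule radon_functionalI[OF _ _ dominatedD(2)[OF d]])
  note b = bounded_borel_linear[OF _ bounded_linear_nth_nth]
  show "L (\<lambda>x. (F x + G x) $ j $ k) = L (\<lambda>x. F x $ j $ k) + L (\<lambda>x. G x $ j $ k)"
    if "F \<in> bounded_borel" "G \<in> bounded_borel" for F G
    using linear_on_bb_add[OF dominatedD(1)[OF d] b[OF that(1)] b[OF that(2)]] by simp
  show "L (\<lambda>x. fscale c F x $ j $ k) = c * L (\<lambda>x. F x $ j $ k)" if "F \<in> bounded_borel" for c F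
    using linear_on_bb_cmult[OF dominatedD(1)[OF d] b[OF that]] by (simp add: fscale_def)
  show "cmod (L (\<lambda>x. F x $ j $ k)) \<le> (\<integral>x. norm (F x) \<partial>N)" if "F \<in> bounded_borel" for F
  proof (rule order_trans[OF dominatedD(5)[OF d b[OF that]]])
    show "(\<integral>x. cmod (F x $ j $ k) \<partial>N) \<le> (\<integral>x. norm (F x) \<partial>N)"
      by (intro integral_mono bounded_borel_integrable[OF bounded_borel_cmod dominatedD(4)[OF d] dominatedD(3)[OF d]]
           b[OF that] that) (rule cmod_nth_nth_le)
  qed
qed

lemma radon_scale_measure:
  fixes N :: "'x::topological_space measure"
  assumes N: "radon N" and r: "0 \<le> r"
  shows "radon (scale_measure (ennreal r) N)"
proof -
  have Nf: "finite_measure N" "sets N = sets borel" using N by (simp_all add: radon_def)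
  have m: "measure (scale_measure (ennreal r) N) A = r * measure N A" for A
    using r by (simp add: measure_def enn2real_mult)
  have "\<exists>K V. compact K \<and> open V \<and> K \<subseteq> A \<and> A \<subseteq> V \<and> measure (scale_measure (ennreal r) N) (V - K) < e"
    if A: "A \<in> sets borel" and e: "e > 0" for A e
  proof -
    obtain K V where K: "compact K" "open V" "K \<subseteq> A" "A \<subseteq> V" "measure N (V - K) < e / (r + 1)"
      using radonE[OF N A, of "e / (r + 1)"] e r by (metis divide_pos_pos add_nonneg_pos zero_less_one)
    have "r * measure N (V - K) \<le> (r + 1) * measure N (V - K)" by (intro mult_right_mono) auto
    also have "\<dots> < e" using K(5) r by (simp add: field_simps)
    finally show ?thesis using K m by metis
  qed
  moreover have "finite_measure (scale_measure (ennreal r) N)"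
    using finite_measure.emeasure_finite[OF Nf(1)] by (intro finite_measureI) (simp add: ennreal_mult_eq_top_iff)
  ultimately show ?thesis using Nf by (auto simp: radon_def)
qed

lemma integral_scale_measure_nonneg:
  fixes f :: "'x::topological_space \<Rightarrow> real"
  assumes "f \<in> borel_measurable N" "\<And>x. 0 \<le> f x" "0 \<le> r"
  shows "(\<integral>x. f x \<partial>scale_measure (ennreal r) N) = r * (\<integral>x. f x \<partial>N)"
  using assms by (simp add: integral_eq_nn_integral nn_integral_scale_measure enn2real_mult)

text \<open>The intended \<open>T\<close> is multiplication by a bounded function, on either side.
  Domination survives with the measure scaled by \<open>K\<close>.\<close>

lemma radon_functional_bounded_comp:
  fixes \<Phi> :: "('x::topological_space \<Rightarrow> complex^'n::finite^'n) \<Rightarrow> complex"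
    and T :: "('x \<Rightarrow> complex^'n^'n) \<Rightarrow> 'x \<Rightarrow> complex^'n^'n"
  assumes \<Phi>: "radon_functional \<Phi>" and K: "0 \<le> K"
    and T: "\<And>F. F \<in> bounded_borel \<Longrightarrow> T F \<in> bounded_borel"
    and le: "\<And>F x. F \<in> bounded_borel \<Longrightarrow> norm (T F x) \<le> K * norm (F x)"
    and add: "\<And>F G. F \<in> bounded_borel \<Longrightarrow> G \<in> bounded_borel \<Longrightarrow> T (\<lambda>x. F x + G x) = (\<lambda>x. T F x + T G x)"
    and scale: "\<And>F c. F \<in> bounded_borel \<Longrightarrow> T (fscale c F) = fscale c (T F)"
  shows "radon_functional (\<lambda>F. \<Phi> (T F))"
proof -
  obtain N where N: "radon N" "\<And>F. F \<in> bounded_borel \<Longrightarrow> cmod (\<Phi> F) \<le> (\<integral>x. norm (F x) \<partial>N)"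
    by (rule radon_functionalE[OF \<Phi>]) blast
  have N': "finite_measure N" "sets N = sets borel" using N(1) by (simp_all add: radon_def)
  show ?thesis
  proof (rule radon_functionalI[OF _ _ radon_scale_measure[OF N(1) K]])
    fix F :: "'x \<Rightarrow> complex^'n^'n" assume F: "F \<in> bounded_borel"
    have nF: "(\<lambda>x. norm (F x)) \<in> borel_measurable N"
      using bounded_borel_measurable[OF bounded_borel_cmod[OF F]] N'(2) by (simp cong: measurable_cong_sets)
    have "(\<integral>x. norm (T F x) \<partial>N) \<le> (\<integral>x. K * norm (F x) \<partial>N)"
      by (intro integral_mono bounded_borel_integrable[OF bounded_borel_cmod[OF T[OF F]] N']
          integrable_mult_right bounded_borel_integrable[OF bounded_borel_cmod[OF F] N'] le F)
    also have "\<dots> = (\<integral>x. norm (F x) \<partial>scale_measure (ennreal K) N)"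
      by (simp add: integral_scale_measure_nonneg[OF nF _ K])
    finally show "cmod (\<Phi> (T F)) \<le> (\<integral>x. norm (F x) \<partial>scale_measure (ennreal K) N)"
      using N(2)[OF T[OF F]] by simp
  qed (simp_all add: add scale T radon_functional_add[OF \<Phi>] radon_functional_fscale[OF \<Phi>])
qed

lemma radon_functional_mult_right:
  assumes \<Phi>: "radon_functional \<Phi>" and g: "g \<in> bounded_borel"
  shows "radon_functional (\<lambda>F. \<Phi> (fmult F g))"
proof -
  obtain B where B: "B > 0" "\<And>x. norm (g x) \<le> B" by (rule bounded_borelE[OF g]) blast
  show ?thesis
  proof (rule radon_functional_bounded_comp[OF \<Phi>, where K=B and T="\<lambda>F. fmult F g"])
    show "norm (fmult F g x) \<le> B * norm (F x)" for F x
      using norm_matrix_mult_mono[OF order_refl B(2), of "F x" x] by (simp add: fmult_def mult.commute)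
    show "fmult F g \<in> bounded_borel" if "F \<in> bounded_borel" for F using that g by (intro fmult_bounded_borel)
    show "fmult (\<lambda>x. F x + G x) g = (\<lambda>x. fmult F g x + fmult G g x)" for F G by (simp add: fmult_def mm.add_left)
    show "fmult (fscale c F) g = fscale c (fmult F g)" for c F by (simp add: fmult_def fscale_eq cscale_mult)
    show "0 \<le> B" using B(1) by simp
  qed
qed

lemma radon_functional_mult_left:
  assumes \<Phi>: "radon_functional \<Phi>" and g: "g \<in> bounded_borel"
  shows "radon_functional (\<lambda>F. \<Phi> (fmult g F))"
proof -
  obtain B where B: "B > 0" "\<And>x. norm (g x) \<le> B" by (rule bounded_borelE[OF g]) blast
  show ?thesis
  proof (rule radon_functional_bounded_comp[OF \<Phi>, where K=B and T="\<lambda>F. fmult g F"])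
    show "norm (fmult g F x) \<le> B * norm (F x)" for F x
      using norm_matrix_mult_mono[OF B(2) order_refl, of x "F x"] by (simp add: fmult_def)
    show "fmult g F \<in> bounded_borel" if "F \<in> bounded_borel" for F using that g by (intro fmult_bounded_borel)
    show "fmult g (\<lambda>x. F x + G x) = (\<lambda>x. fmult g F x + fmult g G x)" for F G by (simp add: fmult_def mm.add_right)
    show "fmult g (fscale c F) = fscale c (fmult g F)" for c F by (simp add: fmult_def fscale_eq cscale_mult)
    show "0 \<le> B" using B(1) by simp
  qed
qed

lemma fadj_fscale: "fadj (fscale c F) = fscale (cnj c) (fadj F)"
  by (simp add: fadj_def fscale_def vec_eq_iff fun_eq_iff)

lemma radon_functional_adj:
  fixes \<Phi> :: "('x::topological_space \<Rightarrow> complex^'n::finite^'n) \<Rightarrow> complex"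
  assumes \<Phi>: "radon_functional \<Phi>"
  shows "radon_functional (\<lambda>F. cnj (\<Phi> (fadj F)))"
proof -
  obtain N where N: "radon N" "\<And>F. F \<in> bounded_borel \<Longrightarrow> cmod (\<Phi> F) \<le> (\<integral>x. norm (F x) \<partial>N)"
    by (rule radon_functionalE[OF \<Phi>]) blast
  show ?thesis
  proof (rule radon_functionalI[OF _ _ N(1)])
    fix F G :: "'x \<Rightarrow> complex^'n^'n" and c assume F: "F \<in> bounded_borel"
    show "cmod (cnj (\<Phi> (fadj F))) \<le> (\<integral>x. norm (F x) \<partial>N)"
      using N(2)[OF fadj_bounded_borel[OF F]] by (simp add: fadj_def)
    show "cnj (\<Phi> (fadj (fscale c F))) = c * cnj (\<Phi> (fadj F))"
      unfolding fadj_fscale radon_functional_fscale[OF \<Phi> fadj_bounded_borel[OF F]] by simp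
    assume G: "G \<in> bounded_borel"
    have "fadj (\<lambda>x. F x + G x) = (\<lambda>x. fadj F x + fadj G x)" by (simp add: fadj_def cadj_add)
    then show "cnj (\<Phi> (fadj (\<lambda>x. F x + G x))) = cnj (\<Phi> (fadj F)) + cnj (\<Phi> (fadj G))"
      using radon_functional_add[OF \<Phi> fadj_bounded_borel[OF F] fadj_bounded_borel[OF G]] by simp
  qed
qed

lemma bounded_borel_munit_indicator:
  "A \<in> sets borel \<Longrightarrow> (\<lambda>x. munit j k (indicator A x)) \<in> bounded_borel"
  by (rule bounded_borel_linear[OF bounded_borel_indicator bounded_linear_munit])

section \<open>Invariant functionals on an n-space\<close>

context nspace
begin

lemma twist_bounded_borel:
  assumes F: "F \<in> bounded_borel" and U: "U \<in> unitaries"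
  shows "twist act U F \<in> bounded_borel"
proof -
  obtain B where B: "\<And>x. norm (F x) \<le> B" by (rule bounded_borelE[OF F]) blast
  have "(\<lambda>x. F (act U x)) \<in> bounded_borel"
    using measurable_compose[OF act_measurable[OF U] bounded_borel_measurable[OF F]] B by (rule bounded_borelI)
  moreover have "bounded_linear (\<lambda>A. cadj U ** A ** U)"
    using bounded_linear_compose[OF mm.bounded_linear_left mm.bounded_linear_right] by blast
  ultimately show ?thesis unfolding twist_def by (rule bounded_borel_linear)
qed

definition invariant :: "(('x \<Rightarrow> complex^'n^'n) \<Rightarrow> complex) \<Rightarrow> bool" where
  "invariant \<Phi> \<longleftrightarrow> (\<forall>U\<in>unitaries. \<forall>F\<in>bounded_borel. \<Phi> (twist act U F) = \<Phi> F)"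

text \<open>\<open>act U\<close> is a homeomorphism, so the sets approximating the preimage of
  \<open>A\<close> can be pushed forward.\<close>

lemma radon_distr_act:
  assumes N: "radon N" and U: "U \<in> unitaries"
  shows "radon (distr N borel (act U))"
proof -
  have Nf: "finite_measure N" "sets N = sets borel" using N by (simp_all add: radon_def)
  have am: "act U \<in> measurable N borel" using act_measurable[OF U] Nf(2) by (simp cong: measurable_cong_sets)
  have sp: "space N = UNIV" using Nf(2) sets_eq_imp_space_eq by fastforce
  have "\<exists>K V. compact K \<and> open V \<and> K \<subseteq> A \<and> A \<subseteq> V \<and> measure (distr N borel (act U)) (V - K) < e"
    if A: "A \<in> sets borel" and e: "e > 0" for A e
  proof -
    have "act U -` A \<in> sets borel" using measurable_sets[OF act_measurable[OF U] A] by simp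
    then obtain K V where K: "compact K" "open V" "K \<subseteq> act U -` A" "act U -` A \<subseteq> V" "measure N (V - K) < e"
      using radonE[OF N _ e] by metis
    have oV: "open (act U ` V)"
      using open_vimage[OF K(2) continuous_act[OF unitaries_cadj[OF U]]] by (simp add: act_image[OF U])
    have cK: "compact (act U ` K)"
      by (rule compact_continuous_image[OF continuous_on_subset[OF continuous_act[OF U]] K(1)]) simp
    have "act U -` (act U ` V - act U ` K) = V - K"
      using act_cadj[OF U] by (auto simp: image_iff) metis+
    moreover have "act U ` V - act U ` K \<in> sets borel" using oV cK by (auto intro: borel_compact_t2)
    ultimately have "measure (distr N borel (act U)) (act U ` V - act U ` K) < e"
      using K(5) measure_distr[OF am] sp by simp
    moreover have "act U ` K \<subseteq> A" using K(3) by auto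
    moreover have "A \<subseteq> act U ` V"
    proof
      fix x assume "x \<in> A"
      then have "act (cadj U) x \<in> V" using K(4) act_cadj(2)[OF U, of x] by auto
      then show "x \<in> act U ` V" by (simp add: act_image[OF U])
    qed
    ultimately show ?thesis using oV cK by blast
  qed
  then show ?thesis using finite_measure.finite_measure_distr[OF Nf(1) am] by (auto simp: radon_def)
qed

lemma radon_functional_twist:
  assumes \<Phi>: "radon_functional \<Phi>" and U: "U \<in> unitaries"
  shows "radon_functional (\<lambda>F. \<Phi> (twist act U F))"
proof -
  obtain N where N: "radon N" "\<And>F. F \<in> bounded_borel \<Longrightarrow> cmod (\<Phi> F) \<le> (\<integral>x. norm (F x) \<partial>N)"
    by (rule radon_functionalE[OF \<Phi>]) blast
  have N': "sets N = sets borel" using N(1) by (simp_all add: radon_def)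
  have am: "act U \<in> measurable N borel" using act_measurable[OF U] N' by (simp cong: measurable_cong_sets)
  show ?thesis
  proof (rule radon_functionalI[OF _ _ radon_distr_act[OF N(1) U]])
    fix F G :: "'x \<Rightarrow> complex^'n^'n" and c assume F: "F \<in> bounded_borel"
    have "(\<integral>x. norm (F x) \<partial>distr N borel (act U)) = (\<integral>x. norm (F (act U x)) \<partial>N)"
      by (rule integral_distr[OF am bounded_borel_measurable[OF bounded_borel_cmod[OF F]]])
    then show "cmod (\<Phi> (twist act U F)) \<le> (\<integral>x. norm (F x) \<partial>distr N borel (act U))"
      using N(2)[OF twist_bounded_borel[OF F U]] by (simp add: norm_twist U)
    have "twist act U (fscale c F) = fscale c (twist act U F)" by (simp add: fun_eq_iff twist_fscale fscale_eq[of c "twist act U F"])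
    then show "\<Phi> (twist act U (fscale c F)) = c * \<Phi> (twist act U F)"
      using radon_functional_fscale[OF \<Phi> twist_bounded_borel[OF F U]] by simp
    assume G: "G \<in> bounded_borel"
    have "twist act U (\<lambda>x. F x + G x) = (\<lambda>x. twist act U F x + twist act U G x)"
      by (simp add: twist_def mm.add_left mm.add_right)
    then show "\<Phi> (twist act U (\<lambda>x. F x + G x)) = \<Phi> (twist act U F) + \<Phi> (twist act U G)"
      using radon_functional_add[OF \<Phi> twist_bounded_borel[OF F U] twist_bounded_borel[OF G U]] by simp
  qed
qed

lemma invariant_radon_avg:
  assumes \<Phi>: "radon_functional \<Phi>" and inv: "invariant \<Phi>" and F: "F \<in> C0"
  shows "\<Phi> (avg act F) = \<Phi> F"
proof -
  obtain C where C: "\<And>F B. F \<in> bounded_borel \<Longrightarrow> (\<And>x. norm (F x) \<le> B) \<Longrightarrow> cmod (\<Phi> F) \<le> C * B"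
    by (rule radon_functional_bounded[OF \<Phi>]) blast
  show ?thesis
  proof (rule invariant_avg[where C=C, OF _ _ _ _ F])
    show "\<Phi> (\<lambda>x. F x + G x) = \<Phi> F + \<Phi> G" if "F \<in> C0" "G \<in> C0" for F G
      by (rule radon_functional_add[OF \<Phi> that[THEN C0_bounded_borel]])
    show "\<Phi> (fscale c F) = c * \<Phi> F" if "F \<in> C0" for c F
      by (rule radon_functional_fscale[OF \<Phi> C0_bounded_borel[OF that]])
    show "cmod (\<Phi> F) \<le> C * B" if "F \<in> C0" "\<And>x. norm (F x) \<le> B" for F B
      by (rule C[OF C0_bounded_borel[OF that(1)] that(2)])
    show "\<Phi> (twist act U F) = \<Phi> F" if "F \<in> C0" "U \<in> unitaries" for F U
      using inv C0_bounded_borel[OF that(1)] that(2) by (simp add: invariant_def)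
  qed
qed

lemma invariant_radon_unique:
  assumes \<Phi>: "radon_functional \<Phi>" "invariant \<Phi>" and \<Psi>: "radon_functional \<Psi>" "invariant \<Psi>"
    and eq: "\<And>f. f \<in> Cstar act \<Longrightarrow> \<Phi> f = \<Psi> f" and F: "F \<in> bounded_borel"
  shows "\<Phi> F = \<Psi> F"
proof -
  have "(\<lambda>F. \<Phi> F - \<Psi> F) F = 0"
  proof (rule radon_functional_eq_0[OF lc radon_functional_diff[OF \<Phi>(1) \<Psi>(1)] _ F])
    fix G :: "'x \<Rightarrow> complex^'n^'n" assume G: "G \<in> C0"
    show "\<Phi> G - \<Psi> G = 0"
      using invariant_radon_avg[OF \<Phi> G] invariant_radon_avg[OF \<Psi> G] eq[OF avg_Cstar[OF G]] by simp
  qed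
  then show ?thesis by simp
qed

text \<open>On \<open>C0\<close> the functional assembled from the entries is
  \<open>\<Lambda>\<close> composed with \<open>avg\<close>, which ignores twists. Regularity then
  carries this invariance over to Borel functions.\<close>

lemma invariant_radon_exists:
  assumes add: "\<And>f g. f \<in> Cstar act \<Longrightarrow> g \<in> Cstar act \<Longrightarrow> \<Lambda> (\<lambda>x. f x + g x) = \<Lambda> f + (\<Lambda> g :: complex)"
    and scale: "\<And>c f. f \<in> Cstar act \<Longrightarrow> \<Lambda> (fscale c f) = c * \<Lambda> f"
    and bound: "\<And>f B. f \<in> Cstar act \<Longrightarrow> (\<And>x. norm (f x) \<le> B) \<Longrightarrow> 0 \<le> B \<Longrightarrow> cmod (\<Lambda> f) \<le> C * B"
    and C: "0 \<le> C"
  shows "\<exists>\<Phi>. radon_functional \<Phi> \<and> invariant \<Phi> \<and> (\<forall>f\<in>Cstar act. \<Phi> f = \<Lambda> f)"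
proof -
  define L where "L j k g = \<Lambda> (avg act (\<lambda>x. munit j k (g x)))" for j k and g :: "'x \<Rightarrow> complex"
  have mC: "(\<lambda>x. munit j k (g x)) \<in> C0" if "g \<in> C0" for j k g by (rule C0_linear[OF that bounded_linear_munit])
  have "\<exists>\<Lambda>' N. dominated \<Lambda>' N \<and> (\<forall>g\<in>C0. \<Lambda>' g = L j k g)" for j k
  proof (rule riesz_C0[OF lc _ _ _ C])
    show "L j k (\<lambda>x. f x + g x) = L j k f + L j k g" if "f \<in> C0" "g \<in> C0" for f g
      unfolding L_def munit_add avg_add[OF mC[OF that(1)] mC[OF that(2)]]
      by (rule add[OF avg_Cstar[OF mC[OF that(1)]] avg_Cstar[OF mC[OF that(2)]]])
    show "L j k (\<lambda>x. c * f x) = c * L j k f" if "f \<in> C0" for c f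
    proof -
      have "(\<lambda>x. munit j k (c * f x)) = fscale c (\<lambda>x. munit j k (f x))" by (simp add: fscale_eq cscale_munit)
      then show ?thesis unfolding L_def using scale[OF avg_Cstar[OF mC[OF that]]] avg_fscale[OF mC[OF that]] by simp
    qed
    show "cmod (L j k f) \<le> C * B" if "f \<in> C0" "\<And>x. cmod (f x) \<le> B" "0 \<le> B" for f B
      unfolding L_def
      by (rule bound[OF avg_Cstar[OF mC[OF that(1)]] norm_avg_le[OF mC[OF that(1)]] that(3)]) (simp add: norm_munit that(2))
  qed
  then obtain M N where M: "\<And>j k. dominated (M j k) (N j k)" "\<And>j k g. g \<in> C0 \<Longrightarrow> M j k g = L j k g" by metis
  define \<Phi> where "\<Phi> F = (\<Sum>j\<in>UNIV. \<Sum>k\<in>UNIV. M j k (\<lambda>x. F x $ j $ k))" for F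
  have \<Phi>: "radon_functional \<Phi>"
    unfolding \<Phi>_def by (intro radon_functional_sum_functionals radon_functional_of_entry[OF M(1)]) auto
  \<comment> \<open>Finite additivity of \<open>\<Lambda>\<close> after \<open>avg\<close>; it is
    applied once to rows and once to columns.\<close>
  have avgsum: "\<Lambda> (avg act (\<lambda>x. \<Sum>i\<in>I. F i x)) = (\<Sum>i\<in>I. \<Lambda> (avg act (F i))) \<and> (\<lambda>x. \<Sum>i\<in>I. F i x) \<in> C0"
    if "finite I" "\<And>i. i \<in> I \<Longrightarrow> F i \<in> C0" for I :: "'n set" and F :: "'n \<Rightarrow> 'x \<Rightarrow> complex^'n^'n"
    using that
  proof (induction I)
    case empty
    have "\<Lambda> (avg act (\<lambda>x. 0 + 0)) = \<Lambda> (avg act (\<lambda>x. 0)) + \<Lambda> (avg act (\<lambda>x. 0))"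
      unfolding avg_add[OF C0_zero C0_zero] by (rule add) (rule avg_Cstar[OF C0_zero])+
    then show ?case by (simp add: C0_zero)
  next
    case (insert i I)
    then have I: "(\<lambda>x. \<Sum>i\<in>I. F i x) \<in> C0" "\<Lambda> (avg act (\<lambda>x. \<Sum>i\<in>I. F i x)) = (\<Sum>i\<in>I. \<Lambda> (avg act (F i)))"
      and i: "F i \<in> C0" by auto
    have "\<Lambda> (avg act (\<lambda>x. F i x + (\<Sum>i\<in>I. F i x))) = \<Lambda> (avg act (F i)) + \<Lambda> (avg act (\<lambda>x. \<Sum>i\<in>I. F i x))"
      unfolding avg_add[OF i I(1)] by (rule add[OF avg_Cstar[OF i] avg_Cstar[OF I(1)]])
    then show ?case using insert.hyps I C0_add[OF i I(1)] by simp
  qed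
  have \<Phi>C: "\<Phi> F = \<Lambda> (avg act F)" if F: "F \<in> C0" for F
  proof -
    have e: "(\<lambda>x. F x $ j $ k) \<in> C0" for j k by (rule C0_linear[OF F bounded_linear_nth_nth])
    have "\<Lambda> (avg act F) = \<Lambda> (avg act (\<lambda>x. \<Sum>j\<in>UNIV. \<Sum>k\<in>UNIV. munit j k (F x $ j $ k)))"
      by (simp add: matrix_eq_sum_munit)
    also have "\<dots> = (\<Sum>j\<in>UNIV. \<Lambda> (avg act (\<lambda>x. \<Sum>k\<in>UNIV. munit j k (F x $ j $ k))))"
    proof (rule avgsum[THEN conjunct1])
      show "(\<lambda>x. \<Sum>k\<in>UNIV. munit j k (F x $ j $ k)) \<in> C0" for j
        by (rule avgsum[THEN conjunct2]) (auto intro: mC e)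
    qed simp
    also have "\<dots> = (\<Sum>j\<in>UNIV. \<Sum>k\<in>UNIV. \<Lambda> (avg act (\<lambda>x. munit j k (F x $ j $ k))))"
      by (intro sum.cong refl avgsum[THEN conjunct1] mC e) auto
    also have "\<dots> = \<Phi> F" unfolding \<Phi>_def M(2)[OF e] L_def ..
    finally show ?thesis by simp
  qed
  have "invariant \<Phi>"
    unfolding invariant_def
  proof (intro ballI)
    fix U :: "complex^'n^'n" and F :: "'x \<Rightarrow> complex^'n^'n" assume U: "U \<in> unitaries" and F: "F \<in> bounded_borel"
    have "(\<lambda>F. \<Phi> (twist act U F) - \<Phi> F) F = 0"
      by (rule radon_functional_eq_0[OF lc radon_functional_diff[OF radon_functional_twist[OF \<Phi> U] \<Phi>] _ F])
         (simp add: \<Phi>C twist_C0 U avg_twist)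
    then show "\<Phi> (twist act U F) = \<Phi> F" by simp
  qed
  moreover have "\<Phi> f = \<Lambda> f" if "f \<in> Cstar act" for f
    using \<Phi>C[of f] avg_id[OF that] that by (simp add: Cstar_iff)
  ultimately show ?thesis using \<Phi> by blast
qed

end

section \<open>Bounded operators on a Hilbert space\<close>

locale hilbert =
  fixes sc :: "complex \<Rightarrow> 'h::ab_group_add \<Rightarrow> 'h" and ip :: "'h \<Rightarrow> 'h \<Rightarrow> complex"
  assumes hilbert_space: "hilbert_space sc ip"
begin

abbreviation hn :: "'h \<Rightarrow> real" where "hn \<equiv> hnorm ip"

lemmas hilbert_axioms = hilbert_space[unfolded hilbert_space_def]

lemmas sc_add_right = hilbert_axioms[THEN conjunct1, rule_format]
  and sc_add_left = hilbert_axioms[THEN conjunct2, THEN conjunct1, rule_format]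
  and sc_one [simp] = hilbert_axioms[THEN conjunct2, THEN conjunct2, THEN conjunct2, THEN conjunct1, rule_format]
  and ip_add_left = hilbert_axioms[THEN conjunct2, THEN conjunct2, THEN conjunct2, THEN conjunct2, THEN conjunct1, rule_format]
  and ip_sc_left = hilbert_axioms[THEN conjunct2, THEN conjunct2, THEN conjunct2, THEN conjunct2, THEN conjunct2, THEN conjunct1, rule_format]
  and ip_sym = hilbert_axioms[THEN conjunct2, THEN conjunct2, THEN conjunct2, THEN conjunct2, THEN conjunct2, THEN conjunct2, THEN conjunct1, rule_format]
  and ip_self_Im = hilbert_axioms[THEN conjunct2, THEN conjunct2, THEN conjunct2, THEN conjunct2, THEN conjunct2, THEN conjunct2, THEN conjunct2, THEN conjunct1, THEN spec, THEN conjunct1]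
  and ip_self_Re = hilbert_axioms[THEN conjunct2, THEN conjunct2, THEN conjunct2, THEN conjunct2, THEN conjunct2, THEN conjunct2, THEN conjunct2, THEN conjunct1, THEN spec, THEN conjunct2]
  and ip_self_eq_0 = hilbert_axioms[THEN conjunct2, THEN conjunct2, THEN conjunct2, THEN conjunct2, THEN conjunct2, THEN conjunct2, THEN conjunct2, THEN conjunct2, THEN conjunct1, rule_format]

lemma hilbert_complete:
  fixes s :: "nat \<Rightarrow> 'h"
  assumes "\<And>e. 0 < e \<Longrightarrow> \<exists>N. \<forall>m\<ge>N. \<forall>k\<ge>N. hn (s m - s k) < e"
  shows "\<exists>l. \<forall>e>0. \<exists>N. \<forall>k\<ge>N. hn (s k - l) < e"
proof -
  have "\<forall>s::nat \<Rightarrow> 'h. (\<forall>e>0. \<exists>N. \<forall>m\<ge>N. \<forall>k\<ge>N. hn (s m - s k) < e) \<longrightarrow>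
        (\<exists>l. \<forall>e>0. \<exists>N. \<forall>k\<ge>N. hn (s k - l) < e)"
    using hilbert_axioms by (elim conjE)
  then show ?thesis using assms by simp
qed

lemma sc_zero_left [simp]: "sc 0 x = 0"
  using sc_add_left[of 0 0 x] by simp

lemma sc_zero_right [simp]: "sc a 0 = 0"
  using sc_add_right[of a 0 0] by simp

lemma sc_minus_one: "sc (- 1) x = - x"
  using sc_add_left[of 1 "- 1" x] by (simp add: eq_neg_iff_add_eq_0 add.commute)

lemma ip_zero_left [simp]: "ip 0 y = 0"
  using ip_add_left[of 0 0 y] by simp

lemma ip_zero_right [simp]: "ip y 0 = 0"
  using ip_sym[of y 0] by simp

lemma ip_add_right: "ip z (x + y) = ip z x + ip z y"
  using ip_sym[of z "x + y"] ip_sym[of z x] ip_sym[of z y] by (simp add: ip_add_left)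

lemma ip_sc_right: "ip y (sc a x) = cnj a * ip y x"
  using ip_sym[of y "sc a x"] ip_sym[of y x] by (simp add: ip_sc_left)

lemma ip_minus_left: "ip (- x) y = - ip x y"
  using ip_sc_left[of "- 1" x y] by (simp add: sc_minus_one)

lemma ip_minus_right: "ip y (- x) = - ip y x"
  using ip_sc_right[of y "- 1" x] by (simp add: sc_minus_one)

lemma ip_diff_left: "ip (x - y) z = ip x z - ip y z"
  using ip_add_left[of x "- y" z] by (simp add: ip_minus_left)

lemma hn_sq: "(hn x)\<^sup>2 = Re (ip x x)"
  by (simp add: hnorm_def ip_self_Re)

lemma ip_self: "ip x x = complex_of_real ((hn x)\<^sup>2)"
  unfolding hn_sq by (simp add: complex_eq_iff ip_self_Im)

lemma hn_nonneg [simp]: "0 \<le> hn x"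
  by (simp add: hnorm_def ip_self_Re)

lemma hn_zero [simp]: "hn 0 = 0"
  by (simp add: hnorm_def)

lemma hn_eq_0: "hn x = 0 \<Longrightarrow> x = 0"
  using ip_self[of x] ip_self_eq_0 by simp

lemma hn_sc: "hn (sc c x) = cmod c * hn x"
proof -
  have "(hn (sc c x))\<^sup>2 = Re ((c * cnj c) * ip x x)" by (simp add: hn_sq ip_sc_left ip_sc_right mult_ac)
  also have "\<dots> = (cmod c * hn x)\<^sup>2"
    unfolding ip_self complex_norm_square[symmetric] by (simp add: power_mult_distrib)
  finally show ?thesis by simp
qed

lemma hn_minus [simp]: "hn (- x) = hn x"
  using hn_sc[of "- 1" x] by (simp add: sc_minus_one)

lemma hn_diff_commute: "hn (x - y) = hn (y - x)"
  using hn_minus[of "x - y"] by simp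

lemma ip_eqI: "(\<And>w. ip a w = ip b w) \<Longrightarrow> a = b"
  using ip_self_eq_0[of "a - b"] by (simp add: ip_diff_left)

lemma hn_add_sq: "(hn (x + y))\<^sup>2 = (hn x)\<^sup>2 + 2 * Re (ip x y) + (hn y)\<^sup>2"
  using ip_sym[of y x] by (simp add: hn_sq ip_add_left ip_add_right)

lemma hn_diff_sq: "(hn (x - y))\<^sup>2 = (hn x)\<^sup>2 - 2 * Re (ip x y) + (hn y)\<^sup>2"
  using hn_add_sq[of x "- y"] by (simp add: ip_minus_right)

lemma Re_ip_le: "Re (ip x y) \<le> hn x * hn y"
proof (cases "hn y = 0")
  case True
  then show ?thesis using hn_eq_0[of y] by simp
next
  case False
  \<comment> \<open>The minimiser of the norm of \<open>x - t y\<close> over real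
    \<open>t\<close>.\<close>
  define t where "t = Re (ip x y) / (hn y)\<^sup>2"
  have "0 \<le> (hn (x - sc (complex_of_real t) y))\<^sup>2" by simp
  also have "\<dots> = (hn x)\<^sup>2 - 2 * t * Re (ip x y) + t\<^sup>2 * (hn y)\<^sup>2"
    by (simp add: hn_diff_sq ip_sc_right hn_sc power_mult_distrib)
  also have "\<dots> = (hn x)\<^sup>2 - (Re (ip x y))\<^sup>2 / (hn y)\<^sup>2"
    using False by (simp add: t_def power2_eq_square)
  finally have "(Re (ip x y))\<^sup>2 \<le> (hn x * hn y)\<^sup>2"
    using False by (simp add: field_simps power_mult_distrib)
  then show ?thesis by (meson abs_le_D1 abs_le_square_iff hn_nonneg mult_nonneg_nonneg power2_le_imp_le)
qed

lemma cauchy_schwarz: "cmod (ip x y) \<le> hn x * hn y"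
proof (cases "ip x y = 0")
  case False
  \<comment> \<open>The scalar of modulus 1 that rotates \<open>ip x y\<close> onto the positive
    half-line.\<close>
  define c where "c = cnj (ip x y) / cmod (ip x y)"
  have "ip (sc c x) y = complex_of_real (cmod (ip x y))"
    using False complex_norm_square[of "ip x y"]
    by (simp add: c_def ip_sc_left mult.commute[of "cnj _"] power2_eq_square divide_eq_eq)
  then have "cmod (ip x y) \<le> hn (sc c x) * hn y" using Re_ip_le[of "sc c x" y] by simp
  also have "hn (sc c x) = hn x" using False by (simp add: hn_sc c_def norm_divide)
  finally show ?thesis .
qed simp

lemma hn_triangle: "hn (x + y) \<le> hn x + hn y"
proof (rule power2_le_imp_le)
  show "(hn (x + y))\<^sup>2 \<le> (hn x + hn y)\<^sup>2"
    using Re_ip_le[of x y] by (simp add: hn_add_sq power2_sum)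
qed simp

lemma hn_le_of_ip:
  assumes "\<And>w. cmod (ip x w) \<le> C * hn w" and "0 \<le> C" shows "hn x \<le> C"
proof (cases "hn x = 0")
  case False
  have "cmod (ip x x) = (hn x)\<^sup>2" unfolding ip_self norm_of_real by simp
  then have "(hn x)\<^sup>2 \<le> C * hn x" using assms(1)[of x] by simp
  then show ?thesis using False hn_nonneg[of x] by (simp add: power2_eq_square)
qed (use assms in simp)

section \<open>Representation of functionals and forms, uniform boundedness\<close>

lemma quadratic_nonneg_imp_0:
  fixes a b :: real
  assumes "\<And>t. 0 \<le> 2 * t * a + t\<^sup>2 * b" and b: "0 \<le> b"
  shows "a = 0"
proof (rule ccontr)
  assume a: "a \<noteq> 0"
  \<comment> \<open>With \<open>t = - a * s\<close> the expression becomes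
    \<open>a\<^sup>2 * s * (s * b - 2)\<close>, negative because
    \<open>s * b \<le> 1\<close>.\<close>
  define s where "s = 1 / (b + 1)"
  have s: "0 < s" "s * b \<le> 1" using b by (simp_all add: s_def)
  have "0 \<le> 2 * (- a * s) * a + (- a * s)\<^sup>2 * b" by (rule assms(1))
  also have "\<dots> = (a\<^sup>2 * s) * (s * b - 2)" by (simp add: power2_eq_square algebra_simps)
  also have "\<dots> < 0" using a s by (intro mult_pos_neg) auto
  finally show False by simp
qed

text \<open>The representing vector minimises \<open>x \<mapsto> \<parallel>x\<parallel>\<^sup>2 - 2 Re (\<phi> x)\<close>; the parallelogram law makes minimising
  sequences Cauchy.\<close>
lemma riesz_frechet:
  assumes add: "\<And>x y. \<phi> (x + y) = \<phi> x + (\<phi> y :: complex)" and scale: "\<And>c x. \<phi> (sc c x) = c * \<phi> x"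
    and bound: "\<And>x. cmod (\<phi> x) \<le> K * hn x"
  shows "\<exists>z. \<forall>w. \<phi> w = ip w z"
proof -
  define J where "J x = (hn x)\<^sup>2 - 2 * Re (\<phi> x)" for x
  have lower: "- K\<^sup>2 \<le> J x" for x
  proof -
    have "Re (\<phi> x) \<le> hn x * K" using bound[of x] complex_Re_le_cmod[of "\<phi> x"] by (simp add: mult.commute)
    moreover have "0 \<le> (hn x - K)\<^sup>2" by simp
    ultimately show ?thesis by (simp add: J_def power2_diff)
  qed
  define m where "m = Inf (range J)"
  have bdd: "bdd_below (range J)" using lower by (intro bdd_belowI2)
  have mle: "m \<le> J x" for x unfolding m_def by (rule cInf_lower[OF _ bdd]) simp
  have "\<exists>x. J x < m + 1 / real (Suc n)" for n
  proof (rule ccontr)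
    assume "\<not> ?thesis"
    then have "m + 1 / real (Suc n) \<le> Inf (range J)" by (intro cInf_greatest) (auto simp: not_less)
    then show False by (simp add: m_def)
  qed
  then obtain s where s: "\<And>n. J (s n) < m + 1 / real (Suc n)" by metis
  \<comment> \<open>The parallelogram law. The linear parts cancel, since \<open>\<phi>\<close> at
    the midpoint is the mean of its values.\<close>
  have J2: "(hn (x - y))\<^sup>2 = 2 * J x + 2 * J y - 4 * J (sc (1/2) (x + y))" for x y
  proof -
    have "4 * (hn (sc (1/2) (x + y)))\<^sup>2 = (hn (x + y))\<^sup>2" by (simp add: hn_sc power_divide)
    moreover have "Re (\<phi> (sc (1/2) (x + y))) = (Re (\<phi> x) + Re (\<phi> y)) / 2"
      by (simp add: scale add)
    ultimately show ?thesis using hn_add_sq[of x y] hn_diff_sq[of x y] by (simp add: J_def)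
  qed
  have cauchy: "(hn (s p - s k))\<^sup>2 \<le> 2 / real (Suc p) + 2 / real (Suc k)" for p k
  proof -
    have "2 * J (s p) + 2 * J (s k) - 4 * J (sc (1/2) (s p + s k)) \<le> 2 * (1 / real (Suc p)) + 2 * (1 / real (Suc k))"
      using s[of p] s[of k] mle[of "sc (1/2) (s p + s k)"] by linarith
    then show ?thesis unfolding J2 by simp
  qed
  have "\<exists>N. \<forall>p\<ge>N. \<forall>k\<ge>N. hn (s p - s k) < e" if e: "0 < e" for e
  proof -
    obtain N where N: "4 / e\<^sup>2 < real N" using reals_Archimedean2 by blast
    have "hn (s p - s k) < e" if "p \<ge> N" "k \<ge> N" for p k
    proof (rule power2_less_imp_less)
      have half: "2 / real (Suc n) < e\<^sup>2 / 2" if "n \<ge> N" for n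
      proof -
        have "4 / e\<^sup>2 < real (Suc n)" using N that by simp
        then show ?thesis using e by (simp add: field_simps)
      qed
      then show "(hn (s p - s k))\<^sup>2 < e\<^sup>2" 
        using cauchy[of p k] half[OF that(1)] half[OF that(2)] by linarith
    qed (use e in simp)
    then show ?thesis by blast
  qed
  then obtain z where z: "\<forall>e>0. \<exists>N. \<forall>k\<ge>N. hn (s k - z) < e"
    using hilbert_complete[of s] by blast
  have re: "Re (\<phi> w) = Re (ip w z)" for w
  proof -
    \<comment> \<open>Minimality is used along the minimising sequence: \<open>J\<close> at
      \<open>s k + t w\<close> is at least \<open>m\<close>, and the inequality passes to the limit
      \<open>z\<close>.\<close>
    have "0 \<le> 2 * t * (Re (ip w z) - Re (\<phi> w)) + t\<^sup>2 * (hn w)\<^sup>2" for t :: real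
    proof (rule field_le_epsilon)
      fix e :: real assume e: "0 < e"
      \<comment> \<open>Replacing \<open>s k\<close> by \<open>z\<close> costs at most
        \<open>2 * \<bar>t\<bar> * d * hn w\<close>, which this choice keeps below
        \<open>e/2\<close>. The summand 1 covers the case that \<open>t\<close> or
        \<open>hn w\<close> is 0.\<close>
      define d where "d = e / (2 * (2 * \<bar>t\<bar> * hn w + 1))"
      have d: "0 < d" using e by (simp add: d_def add_nonneg_pos)
      obtain N where N: "\<And>k. k \<ge> N \<Longrightarrow> hn (s k - z) < d" using z d by blast
      obtain k1 where k1: "2 / e < real k1" using reals_Archimedean2 by blast
      define k where "k = max k1 N"
      have k: "k \<ge> N" "2 / e < real k" using k1 by (simp_all add: k_def)
      have "m \<le> J (s k + sc (complex_of_real t) w)" by (rule mle)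
      also have "\<dots> = J (s k) + 2 * t * (Re (ip (s k) w) - Re (\<phi> w)) + t\<^sup>2 * (hn w)\<^sup>2"
        by (simp add: J_def hn_add_sq add scale ip_sc_right hn_sc power_mult_distrib algebra_simps)
      finally have "0 \<le> 1 / real (Suc k) + 2 * t * (Re (ip (s k) w) - Re (\<phi> w)) + t\<^sup>2 * (hn w)\<^sup>2"
        using s[of k] by simp
      moreover have "1 / real (Suc k) \<le> e / 2" using k e by (simp add: field_simps)
      moreover have "2 * t * (Re (ip (s k) w) - Re (ip w z)) \<le> e / 2"
      proof -
        have "Re (ip (s k) w) - Re (ip w z) = Re (ip (s k - z) w)" using ip_sym[of w z] by (simp add: ip_diff_left)
        then have "\<bar>Re (ip (s k) w) - Re (ip w z)\<bar> \<le> d * hn w"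
          using abs_Re_le_cmod[of "ip (s k - z) w"] cauchy_schwarz[of "s k - z" w] mult_right_mono[OF less_imp_le[OF N[OF k(1)]], of "hn w"]
          by simp
        then have "2 * \<bar>t\<bar> * \<bar>Re (ip (s k) w) - Re (ip w z)\<bar> \<le> 2 * \<bar>t\<bar> * (d * hn w)"
          by (intro mult_left_mono) auto
        moreover have "2 * t * (Re (ip (s k) w) - Re (ip w z)) \<le> 2 * \<bar>t\<bar> * \<bar>Re (ip (s k) w) - Re (ip w z)\<bar>"
          by (rule order_trans[OF abs_ge_self]) (simp add: abs_mult)
        ultimately have "2 * t * (Re (ip (s k) w) - Re (ip w z)) \<le> 2 * \<bar>t\<bar> * (d * hn w)" by linarith
        also have "\<dots> \<le> (2 * \<bar>t\<bar> * hn w + 1) * d" using d by (simp add: algebra_simps)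
        also have "\<dots> = e / 2"
        proof -
          have "0 \<le> 2 * \<bar>t\<bar> * hn w" by (intro mult_nonneg_nonneg) auto
          then have "2 * \<bar>t\<bar> * hn w + 1 \<noteq> 0" by linarith
          moreover have "q * (e / (2 * q)) = e / 2" if "q \<noteq> 0" for q :: real using that by simp
          ultimately show ?thesis unfolding d_def by blast
        qed
        finally show ?thesis .
      qed
      ultimately show "0 \<le> 2 * t * (Re (ip w z) - Re (\<phi> w)) + t\<^sup>2 * (hn w)\<^sup>2 + e"
        by (simp add: right_diff_distrib)
    qed
    then have "Re (ip w z) - Re (\<phi> w) = 0" by (rule quadratic_nonneg_imp_0) simp
    then show ?thesis by simp
  qed
  have "\<phi> w = ip w z" for w
  proof (rule complex_eqI)
    \<comment> \<open>The imaginary part at \<open>w\<close> is the real part at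
      \<open>- \<i>\<close> times \<open>w\<close>.\<close>
    show "Im (\<phi> w) = Im (ip w z)" using re[of "sc (- \<i>) w"] by (simp add: scale ip_sc_left)
  qed (rule re)
  then show ?thesis by blast
qed

text \<open>For fixed \<open>x\<close> the conjugate of \<open>B x\<close> is a bounded linear
  functional of the second argument, and \<open>T x\<close> is the vector representing it.\<close>

lemma form_operator:
  assumes "\<And>x y w. B (x + y) w = B x w + (B y w :: complex)" "\<And>c x w. B (sc c x) w = c * B x w"
    and "\<And>x y w. B w (x + y) = B w x + B w y" "\<And>c x w. B w (sc c x) = cnj c * B w x"
    and bound: "\<And>x w. cmod (B x w) \<le> K * hn x * hn w"
  shows "\<exists>T. bop sc ip T \<and> (\<forall>x w. ip (T x) w = B x w)"
proof -
  have "\<exists>z. \<forall>w. cnj (B x w) = ip w z" for x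
    by (rule riesz_frechet[where K="K * hn x"]) (use assms in auto)
  then obtain T where T: "\<And>x w. cnj (B x w) = ip w (T x)" by metis
  have ip: "ip (T x) w = B x w" for x w using ip_sym[of "T x" w] T[of x w] by (metis complex_cnj_cnj)
  have "hn (T x) \<le> \<bar>K\<bar> * hn x" for x
  proof (rule hn_le_of_ip)
    fix w
    have "cmod (ip (T x) w) \<le> K * hn x * hn w" unfolding ip by (rule bound)
    also have "\<dots> \<le> \<bar>K\<bar> * hn x * hn w" by (intro mult_right_mono) auto
    finally show "cmod (ip (T x) w) \<le> \<bar>K\<bar> * hn x * hn w" .
  qed simp
  moreover have "T (x + y) = T x + T y" for x y by (rule ip_eqI) (simp add: ip ip_add_left assms)
  moreover have "T (sc c x) = sc c (T x)" for c x by (rule ip_eqI) (simp add: ip ip_sc_left assms)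
  ultimately show ?thesis using ip unfolding bop_def by blast
qed

lemma bopD: "bop sc ip T \<Longrightarrow> T (x + y) = T x + T y" "bop sc ip T \<Longrightarrow> T (sc c x) = sc c (T x)"
  by (auto simp: bop_def)

text \<open>Sokal's proof: at stage \<open>n\<close> add or subtract a vector of norm at most \<open>3^-n\<close> that almost realises the
  norm of the \<open>n\<close>-th seminorm.\<close>
lemma banach_steinhaus:
  fixes p :: "'i \<Rightarrow> 'h \<Rightarrow> real"
  assumes tri: "\<And>i x y. i \<in> I \<Longrightarrow> p i (x + y) \<le> p i x + p i y"
    and scale: "\<And>i c x. i \<in> I \<Longrightarrow> p i (sc c x) = cmod c * p i x"
    and bdd: "\<And>i. i \<in> I \<Longrightarrow> \<exists>K. \<forall>x. p i x \<le> K * hn x"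
    and pw: "\<And>x. \<exists>C. \<forall>i\<in>I. p i x \<le> C"
  shows "\<exists>C\<ge>0. \<forall>i\<in>I. \<forall>x. p i x \<le> C * hn x"
proof (rule ccontr)
  assume unb: "\<not> ?thesis"
  define N where "N i = (SUP x\<in>{x. hn x \<le> 1}. p i x)" for i
  have up: "p i x \<le> N i" if i: "i \<in> I" and x: "hn x \<le> 1" for i x
  proof -
    obtain K where K: "\<And>x. p i x \<le> K * hn x" using bdd[OF i] by blast
    have "bdd_above (p i ` {x. hn x \<le> 1})"
    proof (rule bdd_aboveI2[where M="\<bar>K\<bar>"])
      fix x assume "x \<in> {x. hn x \<le> 1}"
      then have "\<bar>K\<bar> * hn x \<le> \<bar>K\<bar>" by (simp add: mult_left_le)
      moreover have "K * hn x \<le> \<bar>K\<bar> * hn x" by (intro mult_right_mono) auto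
      ultimately show "p i x \<le> \<bar>K\<bar>" using K[of x] by linarith
    qed
    then show ?thesis unfolding N_def using x by (intro cSUP_upper) auto
  qed
  have scaled: "p i x \<le> N i * hn x" if i: "i \<in> I" for i x
  proof (cases "hn x = 0")
    case True
    then have "x = 0" by (rule hn_eq_0)
    then show ?thesis using scale[OF i, of 0 0] by simp
  next
    case False
    then have "p i (sc (complex_of_real (1 / hn x)) x) \<le> N i" by (intro up[OF i]) (simp add: hn_sc norm_divide)
    moreover have "hn x > 0" using False hn_nonneg[of x] by linarith
    ultimately show ?thesis by (simp add: scale[OF i] norm_divide field_simps)
  qed
  have p0: "p i 0 = 0" if "i \<in> I" for i using scale[OF that, of 0 0] by simp
  have N0: "0 \<le> N i" if "i \<in> I" for i using up[OF that, of 0] p0[OF that] by simp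
  have neg: "p i (- x) = p i x" if "i \<in> I" for i x using scale[OF that, of "-1" x] by (simp add: sc_minus_one)
  \<comment> \<open>The growth \<open>4 ^ n\<close> has to beat the decay \<open>(1/3) ^ n\<close>
    of the steps, and the fraction \<open>3/4\<close> has to exceed the \<open>1/2\<close> that all
    later steps together can destroy.\<close>
  have "\<exists>i y. i \<in> I \<and> 4 ^ n < N i \<and> hn y \<le> 1 \<and> (3/4) * N i < p i y" for n :: nat
  proof -
    have "\<exists>i\<in>I. 4 ^ n < N i"
    proof (rule ccontr)
      assume "\<not> ?thesis"
      then have "p i x \<le> 4 ^ n * hn x" if "i \<in> I" for i x
        using scaled[OF that, of x] that mult_right_mono[of "N i" "4^n" "hn x"] by force
      then show False using unb by (meson zero_le_power zero_le_numeral)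
    qed
    then obtain i where i: "i \<in> I" "4 ^ n < N i" by blast
    have "0 < N i" using i(2) by (rule less_trans[rotated]) simp
    have "\<exists>y. hn y \<le> 1 \<and> (3/4) * N i < p i y"
    proof (rule ccontr)
      assume "\<not> ?thesis"
      then have "N i \<le> (3/4) * N i" unfolding N_def
        by (intro cSUP_least) (auto simp: not_less N_def intro: exI[of _ 0])
      then show False using \<open>0 < N i\<close> by simp
    qed
    then show ?thesis using i by blast
  qed
  then obtain i u where iu: "\<And>n. i n \<in> I" "\<And>n. 4 ^ n < N (i n)" "\<And>n. hn (u n) \<le> 1" "\<And>n. (3/4) * N (i n) < p (i n) (u n)"
    by metis
  define y where "y n = sc (complex_of_real ((1/3) ^ n)) (u n)" for n
  have cm: "cmod (complex_of_real ((1/3) ^ n)) = (1/3) ^ n" for n by (simp only: norm_of_real) simp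
  have hy: "hn (y n) \<le> (1/3) ^ n" for n
    unfolding y_def hn_sc cm using iu(3)[of n] by (simp add: mult_left_le)
  have py: "(1/3) ^ n * ((3/4) * N (i n)) \<le> p (i n) (y n)" for n
    unfolding y_def scale[OF iu(1)] cm using iu(4)[of n] by (intro mult_left_mono) auto
  define x where "x = rec_nat 0 (\<lambda>n a. if p (i n) (y n) \<le> p (i n) (a + y n) then a + y n else a - y n)"
  have xS: "x (Suc n) = (if p (i n) (y n) \<le> p (i n) (x n + y n) then x n + y n else x n - y n)" for n
    by (simp add: x_def)
  \<comment> \<open>One of the two signs works because
    \<open>2 * p y \<le> p (x + y) + p (x - y)\<close>.\<close>
  have px: "p (i n) (y n) \<le> p (i n) (x (Suc n))" for n
  proof (cases "p (i n) (y n) \<le> p (i n) (x n + y n)")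
    case False
    have "p (i n) ((x n + y n) + - (x n - y n)) \<le> p (i n) (x n + y n) + p (i n) (- (x n - y n))" by (rule tri[OF iu(1)])
    moreover have "(x n + y n) + - (x n - y n) = sc 2 (y n)"
      using sc_add_left[of 1 1 "y n"] by simp
    ultimately have "2 * p (i n) (y n) \<le> p (i n) (x n + y n) + p (i n) (x n - y n)"
      using scale[OF iu(1)[of n], of 2 "y n"] neg[OF iu(1)[of n], of "x n - y n"] by simp
    then show ?thesis using False by (simp add: xS)
  qed (simp add: xS)
  have step: "hn (x (Suc n) - x n) \<le> (1/3) ^ n" for n using hy[of n] by (simp add: xS)
  have far: "hn (x (n + k) - x n) \<le> (3/2) * (1/3) ^ n - (3/2) * (1/3) ^ (n + k)" for n k
  proof (induction k)
    case (Suc k)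
    have "hn (x (n + Suc k) - x n) = hn ((x (Suc (n + k)) - x (n + k)) + (x (n + k) - x n))" by simp
    also have "\<dots> \<le> (1/3) ^ (n + k) + ((3/2) * (1/3) ^ n - (3/2) * (1/3) ^ (n + k))"
      using hn_triangle[of "x (Suc (n + k)) - x (n + k)" "x (n + k) - x n"] step[of "n + k"] Suc by linarith
    also have "\<dots> = (3/2) * (1/3) ^ n - (3/2) * (1/3) ^ (n + Suc k)" by simp
    finally show ?case .
  qed simp
  have far': "hn (x m - x n) \<le> (3/2) * (1/3) ^ n" if nm: "n \<le> m" for m n
  proof -
    obtain k where k: "m = n + k" using nm le_Suc_ex by blast
    have "0 \<le> (3/2) * (1/3::real) ^ (n + k)" by simp
    then show ?thesis using far[of n k] unfolding k by linarith
  qed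
  have small: "\<exists>M. (1/3::real) ^ M < e" if "0 < e" for e :: real
    using real_arch_pow_inv[OF that, of "1/3"] by auto
  have "\<exists>M. \<forall>m\<ge>M. \<forall>k\<ge>M. hn (x m - x k) < e" if e: "0 < e" for e
  proof -
    obtain M where M: "(1/3::real) ^ M < e / 3" using small[of "e/3"] e by auto
    have "hn (x m - x k) < e" if "m \<ge> M" "k \<ge> M" for m k
    proof -
      have "hn (x m - x k) = hn ((x m - x M) + - (x k - x M))" by simp
      also have "\<dots> \<le> hn (x m - x M) + hn (x k - x M)" using hn_triangle[of "x m - x M" "- (x k - x M)"] hn_diff_commute[of "x k" "x M"] by simp
      also have "\<dots> < e" using far'[OF that(1)] far'[OF that(2)] M by linarith
      finally show ?thesis .
    qed
    then show ?thesis by blast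
  qed
  then obtain z where z: "\<forall>e>0. \<exists>M. \<forall>k\<ge>M. hn (x k - z) < e"
    using hilbert_complete[of x] by blast
  \<comment> \<open>The steps after stage \<open>n\<close> sum to at most
    \<open>(3/2) * (1/3) ^ Suc n\<close>, which is this bound.\<close>
  have zn: "hn (z - x (Suc n)) \<le> (1/2) * (1/3) ^ n" for n
  proof (rule field_le_epsilon)
    fix e :: real assume "0 < e"
    then obtain M where M: "\<And>k. k \<ge> M \<Longrightarrow> hn (x k - z) < e" using z by blast
    define k where "k = max M (Suc n)"
    have "hn (z - x (Suc n)) = hn (- (x k - z) + (x k - x (Suc n)))" by simp
    also have "\<dots> \<le> hn (x k - z) + hn (x k - x (Suc n))" using hn_triangle[of "- (x k - z)" "x k - x (Suc n)"] hn_diff_commute[of "x k" z] by simp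
    also have "\<dots> \<le> e + (3/2) * (1/3) ^ Suc n"
      using M[of k] far'[of "Suc n" k] by (simp add: k_def add_mono less_imp_le)
    finally show "hn (z - x (Suc n)) \<le> (1/2) * (1/3) ^ n + e" by simp
  qed
  \<comment> \<open>\<open>3/4 - 1/2 = 1/4\<close> remains as a fraction of
    \<open>(1/3) ^ n * N (i n)\<close>, and that product exceeds \<open>(4/3) ^ n\<close>. The
    family is thus unbounded at the single vector \<open>z\<close>.\<close>
  have big: "(1/4) * (4/3) ^ n \<le> p (i n) z" for n
  proof -
    let ?i = "i n"
    have "p ?i (z + - (z - x (Suc n))) \<le> p ?i z + p ?i (- (z - x (Suc n)))" by (rule tri[OF iu(1)])
    then have "p ?i (x (Suc n)) \<le> p ?i z + p ?i (z - x (Suc n))" 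
      unfolding neg[OF iu(1)[of n], of "z - x (Suc n)"] by simp
    moreover have "p ?i (z - x (Suc n)) \<le> N ?i * ((1/2) * (1/3) ^ n)"
      by (rule order_trans[OF scaled[OF iu(1)] mult_left_mono[OF zn N0[OF iu(1)]]])
    ultimately have "(1/3) ^ n * ((3/4) * N ?i) \<le> p ?i z + N ?i * ((1/2) * (1/3) ^ n)"
      using px[of n] py[of n] by linarith
    then have "(1/4) * ((1/3) ^ n * N ?i) \<le> p ?i z" by (simp add: algebra_simps)
    moreover have "(1/3) ^ n * 4 ^ n \<le> (1/3) ^ n * N ?i" using iu(2)[of n] by (intro mult_left_mono) auto
    moreover have "(1/3::real) ^ n * 4 ^ n = (4/3) ^ n" by (simp add: power_mult_distrib[symmetric])
    ultimately show ?thesis by linarith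
  qed
  obtain C where C: "\<And>i. i \<in> I \<Longrightarrow> p i z \<le> C" using pw by blast
  obtain n where "4 * C < (4/3::real) ^ n" using real_arch_pow[of "4/3" "4 * C"] by auto
  then show False using big[of n] C[OF iu(1)[of n]] by linarith
qed

text \<open>Uniform boundedness is applied twice: for fixed \<open>x\<close> to the seminorms in
  \<open>w\<close>, which bounds \<open>hn (T i x)\<close> over \<open>i\<close>, and then to these
  norms as seminorms in \<open>x\<close>.\<close>

lemma operators_uniformly_bounded:
  assumes T: "\<And>i. i \<in> I \<Longrightarrow> bop sc ip (T i)"
    and pw: "\<And>x w. \<exists>C. \<forall>i\<in>I. cmod (ip (T i x) w) \<le> C"
  shows "\<exists>C\<ge>0. \<forall>i\<in>I. \<forall>x w. cmod (ip (T i x) w) \<le> C * hn x * hn w"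
proof -
  have 1: "\<exists>C. \<forall>i\<in>I. hn (T i x) \<le> C" for x
  proof -
    have "\<exists>C\<ge>0. \<forall>i\<in>I. \<forall>w. cmod (ip (T i x) w) \<le> C * hn w"
    proof (rule banach_steinhaus)
      show "cmod (ip (T i x) (w + v)) \<le> cmod (ip (T i x) w) + cmod (ip (T i x) v)" for i w v
        by (simp add: ip_add_right norm_triangle_ineq)
      show "\<exists>K. \<forall>w. cmod (ip (T i x) w) \<le> K * hn w" for i using cauchy_schwarz by blast
    qed (use pw in \<open>auto simp: ip_sc_right norm_mult\<close>)
    then show ?thesis using hn_le_of_ip by blast
  qed
  have "\<exists>C\<ge>0. \<forall>i\<in>I. \<forall>x. hn (T i x) \<le> C * hn x"
  proof (rule banach_steinhaus)
    fix i assume i: "i \<in> I"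
    show "hn (T i (x + y)) \<le> hn (T i x) + hn (T i y)" for x y by (simp add: bopD[OF T[OF i]] hn_triangle)
    show "hn (T i (sc c x)) = cmod c * hn (T i x)" for c x by (simp add: bopD[OF T[OF i]] hn_sc)
    show "\<exists>K. \<forall>x. hn (T i x) \<le> K * hn x" using T[OF i] by (auto simp: bop_def)
  qed (rule 1)
  then obtain C where C: "0 \<le> C" "\<And>i x. i \<in> I \<Longrightarrow> hn (T i x) \<le> C * hn x" by blast
  have "cmod (ip (T i x) w) \<le> C * hn x * hn w" if "i \<in> I" for i x w
    using cauchy_schwarz[of "T i x" w] mult_right_mono[OF C(2)[OF that, of x], of "hn w"] by simp
  then show ?thesis using C(1) by blast
qed

end

section \<open>Representations and spectral measures\<close>

lemma equivariant_add: "equivariant act f \<Longrightarrow> equivariant act g \<Longrightarrow> equivariant act (\<lambda>x. f x + g x)"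
  by (simp add: equivariant_def mm.add_left mm.add_right)

lemma equivariant_fscale: "equivariant act f \<Longrightarrow> equivariant act (fscale c f)"
  by (simp add: equivariant_def fscale_eq cscale_mult)

lemma equivariant_fmult:
  "equivariant act f \<Longrightarrow> equivariant act g \<Longrightarrow> equivariant act (fmult f g)"
  by (simp add: equivariant_def fmult_def conj_unitary_mult)

lemma equivariant_fadj: "equivariant act f \<Longrightarrow> equivariant act (fadj f)"
  by (simp add: equivariant_def fadj_def cadj_mult matrix_mul_assoc)

lemma Cstar_add: "f \<in> Cstar act \<Longrightarrow> g \<in> Cstar act \<Longrightarrow> (\<lambda>x. f x + g x) \<in> Cstar act"
  by (simp add: Cstar_iff C0_add equivariant_add)

lemma Cstar_fscale: "f \<in> Cstar act \<Longrightarrow> fscale c f \<in> Cstar act"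
  by (simp add: Cstar_iff equivariant_fscale) (simp add: fscale_eq C0_linear[OF _ bounded_linear_cscale])

lemma Cstar_fadj: "f \<in> Cstar act \<Longrightarrow> fadj f \<in> Cstar act"
  by (simp add: Cstar_iff equivariant_fadj) (simp add: fadj_def C0_linear[OF _ bounded_linear_cadj])

lemma Cstar_fmult:
  assumes f: "f \<in> Cstar act" and g: "g \<in> Cstar act" shows "fmult f g \<in> Cstar act"
proof -
  have fg: "f \<in> C0" "g \<in> C0" using f g by (simp_all add: Cstar_iff)
  obtain B where B: "\<And>x. norm (g x) \<le> B" using bounded_borelE[OF C0_bounded_borel[OF fg(2)]] by metis
  have "fmult f g \<in> C0"
  proof (rule C0_dominated[OF fg(1), where K=B])
    show "continuous_on UNIV (fmult f g)"
      unfolding fmult_def by (intro continuous_intros C0_continuous fg)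
    show "norm (fmult f g x) \<le> B * norm (f x)" for x
      using norm_matrix_mult_mono[OF order_refl B, of "f x" x] by (simp add: fmult_def mult.commute)
  qed
  then show ?thesis using f g by (simp add: Cstar_iff equivariant_fmult)
qed

lemma Cstar_BCstar: "f \<in> Cstar act \<Longrightarrow> f \<in> BCstar act"
  by (simp add: Cstar_iff BCstar_iff C0_bounded_borel)

lemma fadj_fadj: "fadj (fadj f) = f"
  by (simp add: fadj_def)

text \<open>Takes the place of continuous functional calculus: pointwise \<open>isr\<close> stays in
  the algebra because it is small where \<open>a\<close> is small and commutes with unitary
  conjugation.\<close>

lemma isr_Cstar:
  fixes act :: "complex^'n::finite^'n \<Rightarrow> 'x::topological_space \<Rightarrow> 'x"
  assumes a: "a \<in> Cstar act" and le: "\<And>x. norm (a x) \<le> 1/8"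
  shows "(\<lambda>x. isr (a x)) \<in> Cstar act"
proof -
  have cont: "continuous_on UNIV (\<lambda>x. isr (a x))"
    using a le by (intro continuous_on_compose2[OF continuous_on_isr]) (auto simp: Cstar_iff C0_continuous)
  have "a \<in> C0" using a by (simp add: Cstar_iff)
  then have "(\<lambda>x. isr (a x)) \<in> C0"
    by (rule C0_dominated[OF _ cont norm_isr_le[OF le]])
  moreover have "equivariant act (\<lambda>x. isr (a x))"
    unfolding equivariant_def
  proof (intro ballI allI)
    fix U :: "complex^'n^'n" and x assume U: "U \<in> unitaries"
    have "a (act U x) = U ** a x ** cadj U" using a U by (simp add: Cstar_iff equivariant_def)
    then show "isr (a (act U x)) = U ** isr (a x) ** cadj U" by (simp only: isr_conj_unitary[OF le U])
  qed
  ultimately show ?thesis by (simp add: Cstar_iff)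
qed

section \<open>Automatic continuity of representations\<close>

locale nspace_rep = nspace act + hilbert sc ip
  for act :: "complex^'n::finite^'n \<Rightarrow> 'x::t2_space \<Rightarrow> 'x"
    and sc :: "complex \<Rightarrow> 'h::ab_group_add \<Rightarrow> 'h" and ip :: "'h \<Rightarrow> 'h \<Rightarrow> complex" +
  fixes \<pi> :: "('x \<Rightarrow> complex^'n^'n) \<Rightarrow> 'h \<Rightarrow> 'h"
  assumes star_rep: "star_rep sc ip (Cstar act) \<pi>"
begin

lemma rep_bop: "f \<in> Cstar act \<Longrightarrow> bop sc ip (\<pi> f)"
  using star_rep by (simp add: star_rep_def)

lemma rep_add: "f \<in> Cstar act \<Longrightarrow> g \<in> Cstar act \<Longrightarrow> \<pi> (\<lambda>x. f x + g x) h = \<pi> f h + \<pi> g h"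
  using star_rep by (simp add: star_rep_def)

lemma rep_fscale: "f \<in> Cstar act \<Longrightarrow> \<pi> (fscale c f) h = sc c (\<pi> f h)"
  using star_rep by (simp add: star_rep_def)

lemma rep_fmult: "f \<in> Cstar act \<Longrightarrow> g \<in> Cstar act \<Longrightarrow> \<pi> (fmult f g) h = \<pi> f (\<pi> g h)"
  using star_rep by (simp add: star_rep_def)

lemma rep_adj: "f \<in> Cstar act \<Longrightarrow> ip (\<pi> f h) w = ip h (\<pi> (fadj f) w)"
  using star_rep by (simp add: star_rep_def is_adj_def)

text \<open>With \<open>r = isr a\<close> the operator \<open>1 + \<pi> r\<close> is self-adjoint and has the right inverse
  \<open>(1 - \<pi> a)(1 + \<pi> r)\<close>, so \<open>1 - \<pi> a\<close> is positive.\<close>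
lemma rep_le_one:
  assumes a: "a \<in> Cstar act" and sa: "fadj a = a" and le: "\<And>x. norm (a x) \<le> 1/8"
  shows "Re (ip (\<pi> a h) h) \<le> (hn h)\<^sup>2"
proof -
  define r where "r = (\<lambda>x. isr (a x))"
  have r: "r \<in> Cstar act" unfolding r_def by (rule isr_Cstar[OF a le])
  have "cadj (isr (a x)) = isr (a x)" for x
    using sa by (intro cadj_isr le) (simp add: fadj_def fun_eq_iff)
  then have rsa: "fadj r = r" by (simp add: fadj_def r_def)
  define ra where "ra = fmult r a"
  define ar where "ar = fmult a r"
  define rar where "rar = fmult ra r"
  define rr where "rr = fmult r r"
  have C: "ra \<in> Cstar act" "ar \<in> Cstar act" "rar \<in> Cstar act" "rr \<in> Cstar act"
    unfolding ra_def ar_def rar_def rr_def by (intro Cstar_fmult a r)+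
  \<comment> \<open>The fixed-point equation of \<open>isr\<close> without any unit matrix. Arranged
    in this way it consists of sums and products of elements of the algebra, which
    \<open>\<pi>\<close> respects.\<close>
  have "(\<lambda>x. (r x + r x) + rr x) = (\<lambda>x. (a x + ra x) + (ar x + rar x))"
  proof
    fix x
    show "(r x + r x) + rr x = (a x + ra x) + (ar x + rar x)"
      using isr_eq[OF le[of x]] by (simp add: r_def rr_def ra_def ar_def rar_def fmult_def scaleR_2 algebra_simps)
  qed
  then have "\<pi> (\<lambda>x. (r x + r x) + rr x) u = \<pi> (\<lambda>x. (a x + ra x) + (ar x + rar x)) u" for u by (simp only:)
  then have "\<pi> r u + \<pi> r u + \<pi> rr u = \<pi> a u + \<pi> ra u + (\<pi> ar u + \<pi> rar u)" for u
    unfolding rep_add[OF Cstar_add[OF r r] C(4)] rep_add[OF r r] rep_add[OF a C(1)] rep_add[OF C(2,3)]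
      rep_add[OF Cstar_add[OF a C(1)] Cstar_add[OF C(2,3)]] .
  then have rel: "\<pi> r u + \<pi> r u + \<pi> r (\<pi> r u) = \<pi> a u + \<pi> r (\<pi> a u) + (\<pi> a (\<pi> r u) + \<pi> r (\<pi> a (\<pi> r u)))" for u
    by (simp add: rr_def ra_def ar_def rar_def rep_fmult Cstar_fmult a r)
  define R where "R u = u + \<pi> r u" for u
  define S where "S u = u - \<pi> a u" for u
  have add: "\<pi> r (u + v) = \<pi> r u + \<pi> r v" "\<pi> a (u + v) = \<pi> a u + \<pi> a v" for u v
    using rep_bop[OF r] rep_bop[OF a] by (simp_all add: bop_def)
  have minus: "\<pi> r (- u) = - \<pi> r u" for u
    using bopD(2)[OF rep_bop[OF r], of "- 1" u] by (simp add: sc_minus_one)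
  have diff: "\<pi> r (u - v) = \<pi> r u - \<pi> r v" for u v
    using add(1)[of u "- v"] minus[of v] by simp
  have RSR: "R (S (R u)) = u" for u
  proof -
    have "R (S (R u)) = u + ((\<pi> r u + \<pi> r u + \<pi> r (\<pi> r u)) -
       (\<pi> a u + \<pi> r (\<pi> a u) + (\<pi> a (\<pi> r u) + \<pi> r (\<pi> a (\<pi> r u)))))"
      by (simp add: R_def S_def add diff algebra_simps)
    then show ?thesis unfolding rel by simp
  qed
  have Radj: "ip (R u) v = ip u (R v)" for u v
    using rep_adj[OF r, of u v] by (simp add: R_def ip_add_left ip_add_right rsa)
  \<comment> \<open>Writing \<open>h\<close> as \<open>R k\<close> turns the quadratic form of
    \<open>S\<close> at \<open>h\<close> into \<open>ip k k\<close>.\<close>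
  define k where "k = S (R h)"
  have h: "h = R k" using RSR[of h] by (simp add: k_def)
  have "ip (S h) h = ip (S (R k)) (R k)" using h by simp
  also have "\<dots> = ip (R (S (R k))) k" by (simp add: Radj)
  also have "\<dots> = ip k k" by (simp add: RSR)
  finally have "0 \<le> Re (ip (S h) h)" using ip_self_Re by simp
  then show ?thesis by (simp add: S_def ip_diff_left hn_sq)
qed

text \<open>The previous lemma is applied to \<open>c\<close> times \<open>fmult (fadj f) f\<close>,
  with \<open>c\<close> scaling it to norm at most \<open>1/8\<close>. This gives
  \<open>(hn (\<pi> f h))\<^sup>2 \<le> 8 * (t * hn h)\<^sup>2\<close>, and 8 is rounded up to 9,
  the square of 3.\<close>

lemma rep_bound_pos:
  assumes f: "f \<in> Cstar act" and le: "\<And>x. norm (f x) \<le> t" and t: "0 < t"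
  shows "hn (\<pi> f h) \<le> 3 * t * hn h"
proof -
  define c where "c = 1 / (8 * t\<^sup>2)"
  have c: "0 < c" using t by (simp add: c_def)
  define a where "a = fscale (complex_of_real c) (fmult (fadj f) f)"
  have ff: "fmult (fadj f) f \<in> Cstar act" by (intro Cstar_fmult Cstar_fadj f)
  have a: "a \<in> Cstar act" unfolding a_def by (rule Cstar_fscale[OF ff])
  have "fadj (fmult (fadj f) f) = fmult (fadj f) f" by (simp add: fadj_def fmult_def cadj_mult)
  then have sa: "fadj a = a" by (simp add: a_def fadj_fscale)
  have na: "norm (a x) \<le> 1/8" for x
  proof -
    have "norm (fmult (fadj f) f x) \<le> t * t"
      unfolding fmult_def fadj_def by (intro norm_matrix_mult_mono) (simp_all add: le)
    then have "norm (a x) \<le> c * (t * t)"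
      using c unfolding a_def fscale_eq norm_cscale norm_of_real by (simp add: mult_left_mono)
    then show ?thesis using t by (simp add: c_def power2_eq_square)
  qed
  have "ip (\<pi> a h) h = complex_of_real c * ip (\<pi> (fadj f) (\<pi> f h)) h"
    by (simp add: a_def rep_fscale ff rep_fmult Cstar_fadj f ip_sc_left)
  also have "ip (\<pi> (fadj f) (\<pi> f h)) h = ip (\<pi> f h) (\<pi> f h)"
    using rep_adj[OF Cstar_fadj[OF f]] by (simp add: fadj_fadj)
  finally have "Re (ip (\<pi> a h) h) = c * (hn (\<pi> f h))\<^sup>2" by (simp add: hn_sq)
  then have "c * (hn (\<pi> f h))\<^sup>2 \<le> (hn h)\<^sup>2" using rep_le_one[OF a sa na, of h] by simp
  then have "(hn (\<pi> f h))\<^sup>2 \<le> 8 * (t * hn h)\<^sup>2"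
    using t by (simp add: c_def field_simps power_mult_distrib)
  also have "\<dots> \<le> (3 * t * hn h)\<^sup>2" by (simp add: power_mult_distrib)
  finally have "(hn (\<pi> f h))\<^sup>2 \<le> (3 * t * hn h)\<^sup>2" .
  then show ?thesis by (rule power2_le_imp_le) (use t in simp)
qed

text \<open>Adds the case \<open>B = 0\<close>, where the scaling above is impossible, by perturbing
  the bound.\<close>

lemma rep_bound:
  assumes f: "f \<in> Cstar act" and le: "\<And>x. norm (f x) \<le> B" and B: "0 \<le> B"
  shows "hn (\<pi> f h) \<le> 3 * B * hn h"
proof (rule field_le_epsilon)
  fix e :: real assume e: "0 < e"
  define d where "d = e / (3 * (hn h + 1))"
  have q: "0 < hn h + 1" using hn_nonneg[of h] by linarith
  have d: "0 < d" using e q by (simp add: d_def)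
  have "hn (\<pi> f h) \<le> 3 * (B + d) * hn h"
  proof (rule rep_bound_pos[OF f])
    show "norm (f x) \<le> B + d" for x using le[of x] d by linarith
  qed (use d B in simp)
  also have "\<dots> = 3 * B * hn h + 3 * d * hn h" by (simp add: algebra_simps)
  also have "3 * d * hn h \<le> 3 * d * (hn h + 1)" using d by (intro mult_left_mono) auto
  also have "3 * d * (hn h + 1) = e"
  proof -
    have "3 * (e / (3 * s)) * s = e" if "0 < s" for s :: real using that by simp
    then show ?thesis unfolding d_def using q by blast
  qed
  finally show "hn (\<pi> f h) \<le> 3 * B * hn h + e" by simp
qed

lemma rep_form_bound:
  assumes f: "f \<in> Cstar act" and le: "\<And>x. norm (f x) \<le> B" and B: "0 \<le> B"
  shows "cmod (ip (\<pi> f h) w) \<le> (3 * hn h * hn w) * B"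
  using cauchy_schwarz[of "\<pi> f h" w] mult_right_mono[OF rep_bound[OF assms, of h], of "hn w"]
  by (simp add: mult_ac)

text \<open>The matrix coefficient of \<open>\<pi>\<close> at \<open>h\<close> and \<open>w\<close>,
  extended to all bounded Borel functions, equivariant or not. The choices for different pairs are
  made independently.\<close>

definition rext :: "'h \<Rightarrow> 'h \<Rightarrow> ('x \<Rightarrow> complex^'n^'n) \<Rightarrow> complex" where
  "rext h w = (SOME \<Phi>. radon_functional \<Phi> \<and> invariant \<Phi> \<and> (\<forall>f\<in>Cstar act. \<Phi> f = ip (\<pi> f h) w))"

lemma rext: "radon_functional (rext h w)" "invariant (rext h w)" "f \<in> Cstar act \<Longrightarrow> rext h w f = ip (\<pi> f h) w"
proof -
  have "\<exists>\<Phi>. radon_functional \<Phi> \<and> invariant \<Phi> \<and> (\<forall>f\<in>Cstar act. \<Phi> f = ip (\<pi> f h) w)"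
  proof (rule invariant_radon_exists)
    show "ip (\<pi> (\<lambda>x. f x + g x) h) w = ip (\<pi> f h) w + ip (\<pi> g h) w" if "f \<in> Cstar act" "g \<in> Cstar act" for f g
      by (simp add: rep_add[OF that] ip_add_left)
    show "ip (\<pi> (fscale c f) h) w = c * ip (\<pi> f h) w" if "f \<in> Cstar act" for c f
      by (simp add: rep_fscale[OF that] ip_sc_left)
    show "cmod (ip (\<pi> f h) w) \<le> (3 * hn h * hn w) * B"
      if "f \<in> Cstar act" "\<And>x. norm (f x) \<le> B" "0 \<le> B" for f B by (rule rep_form_bound[OF that])
  qed simp
  from someI_ex[OF this] show "radon_functional (rext h w)" "invariant (rext h w)" "f \<in> Cstar act \<Longrightarrow> rext h w f = ip (\<pi> f h) w"
    unfolding rext_def by auto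
qed

lemma rext_unique:
  assumes "radon_functional \<Phi>" "invariant \<Phi>" "\<And>f. f \<in> Cstar act \<Longrightarrow> \<Phi> f = ip (\<pi> f h) w" "F \<in> bounded_borel"
  shows "rext h w F = \<Phi> F"
  by (rule invariant_radon_unique[OF rext(1,2) assms(1,2) _ assms(4)]) (simp add: rext(3) assms(3))

lemma radon_functional_cmult:
  fixes \<Phi> :: "('x \<Rightarrow> complex^'n^'n) \<Rightarrow> complex"
  assumes "radon_functional \<Phi>" shows "radon_functional (\<lambda>F. c * \<Phi> F)"
proof -
  obtain N where N: "radon N" "\<And>F. F \<in> bounded_borel \<Longrightarrow> cmod (\<Phi> F) \<le> (\<integral>x. norm (F x) \<partial>N)"
    by (rule radon_functionalE[OF assms]) blast
  show ?thesis
  proof (rule radon_functionalI[OF _ _ radon_scale_measure[OF N(1) norm_ge_zero[of c]]])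
    fix F :: "'x \<Rightarrow> complex^'n^'n" assume F: "F \<in> bounded_borel"
    have nF: "(\<lambda>x. norm (F x)) \<in> borel_measurable N"
      using bounded_borel_measurable[OF bounded_borel_cmod[OF F]] N(1) by (simp add: radon_def cong: measurable_cong_sets)
    show "cmod (c * \<Phi> F) \<le> (\<integral>x. norm (F x) \<partial>scale_measure (ennreal (cmod c)) N)"
      unfolding integral_scale_measure_nonneg[OF nF norm_ge_zero norm_ge_zero] norm_mult
      by (intro mult_left_mono N(2) F) simp
  qed (simp_all add: radon_functional_add[OF assms] radon_functional_fscale[OF assms] distrib_left)
qed

end

text \<open>Off the Borel sets the operators of \<open>spec\<close> below are arbitrary choices, so
  agreement on Borel sets has to be enough.\<close>

lemma complex_measure_cong:
  assumes "complex_measure \<mu>" "\<And>A. A \<in> sets borel \<Longrightarrow> \<nu> A = \<mu> A"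
  shows "complex_measure \<nu>"
  unfolding complex_measure_def
proof (intro conjI allI impI)
  show "\<nu> {} = 0" using assms by (simp add: complex_measure_def)
  fix A :: "nat \<Rightarrow> 'a set" assume A: "range A \<subseteq> sets borel" "disjoint_family A"
  then have "(\<lambda>i. \<mu> (A i)) sums \<mu> (\<Union>i. A i)" using assms(1) by (simp add: complex_measure_def)
  moreover have "\<nu> (A i) = \<mu> (A i)" for i using A(1) by (intro assms(2)) auto
  moreover have "\<nu> (\<Union>i. A i) = \<mu> (\<Union>i. A i)" using A(1) by (intro assms(2)) auto
  ultimately show "(\<lambda>i. \<nu> (A i)) sums \<nu> (\<Union>i. A i)" by simp
qed

text \<open>Jordan parts are not additive in the measure, so the identity is obtained from
  uniqueness and not from the definition of \<open>cint\<close>.\<close>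

lemma cint_add:
  assumes "complex_measure \<mu>" "complex_measure \<nu>" "complex_measure \<rho>"
    and "\<And>A. A \<in> sets borel \<Longrightarrow> \<rho> A = \<mu> A + \<nu> A" and g: "g \<in> bounded_borel"
  shows "cint \<rho> g = cint \<mu> g + cint \<nu> g"
proof (rule cint_unique[OF assms(3) _ _ _ g])
  show "linear_on_bb (\<lambda>g. cint \<mu> g + cint \<nu> g)"
    using linear_cint[OF assms(1)] linear_cint[OF assms(2)] by (simp add: linear_on_bb_def algebra_simps)
  show "cmod (cint \<mu> f + cint \<nu> f) \<le> (measure (jordan_sum \<mu>) UNIV + measure (jordan_sum \<nu>) UNIV) * B"
    if "f \<in> bounded_borel" "\<And>x. cmod (f x) \<le> B" for f B
    using cmod_cint_bound[OF assms(1) that] cmod_cint_bound[OF assms(2) that] norm_triangle_ineq[of "cint \<mu> f" "cint \<nu> f"]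
    by (simp add: distrib_right)
qed (simp add: assms cint_indicator)

lemma cint_cmult:
  assumes "complex_measure \<mu>" "complex_measure \<rho>"
    and "\<And>A. A \<in> sets borel \<Longrightarrow> \<rho> A = c * \<mu> A" and g: "g \<in> bounded_borel"
  shows "cint \<rho> g = c * cint \<mu> g"
proof (rule cint_unique[OF assms(2) _ _ _ g])
  show "linear_on_bb (\<lambda>g. c * cint \<mu> g)"
    using linear_cint[OF assms(1)] by (simp add: linear_on_bb_def algebra_simps)
  show "cmod (c * cint \<mu> f) \<le> (cmod c * measure (jordan_sum \<mu>) UNIV) * B"
    if "f \<in> bounded_borel" "\<And>x. cmod (f x) \<le> B" for f B
    using mult_left_mono[OF cmod_cint_bound[OF assms(1) that], of "cmod c"] by (simp add: norm_mult mult.assoc)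
qed (simp add: assms cint_indicator)

context hilbert
begin

lemma opint_eqI:
  assumes "bop sc ip T"
    and "\<And>h w. ip (T h) w = (\<Sum>j\<in>UNIV. \<Sum>k\<in>UNIV. cint (\<lambda>A. ip (E A k j h) w) (\<lambda>x. f x $ j $ k))"
  shows "opint sc ip E f = T"
  unfolding opint_def
proof (rule the_equality)
  fix S assume S: "bop sc ip S \<and> (\<forall>h w. ip (S h) w = (\<Sum>j\<in>UNIV. \<Sum>k\<in>UNIV. cint (\<lambda>A. ip (E A k j h) w) (\<lambda>x. f x $ j $ k)))"
  show "S = T"
  proof
    fix h show "S h = T h" by (rule ip_eqI) (simp add: S assms(2))
  qed
qed (use assms in auto)

lemma ip_sum_left: "ip (\<Sum>i\<in>I. f i) w = (\<Sum>i\<in>I. ip (f i) w)"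
  by (induction I rule: infinite_finite_induct) (simp_all add: ip_add_left)

end

section \<open>Integrals against operator-valued n-measures\<close>

locale nspace_hilbert = nspace act + hilbert sc ip
  for act :: "complex^'n::finite^'n \<Rightarrow> 'x::t2_space \<Rightarrow> 'x"
    and sc :: "complex \<Rightarrow> 'h::ab_group_add \<Rightarrow> 'h" and ip :: "'h \<Rightarrow> 'h \<Rightarrow> complex"
begin

text \<open>The uniform boundedness principle turns weak countable additivity into a bound on the form
  \<open>(h, w) \<mapsto> \<langle>(\<integral> f dE) h, w\<rangle>\<close>, so that \<open>opint\<close> is not a junk value.\<close>
lemma opint:
  fixes f :: "'x \<Rightarrow> complex^'n^'n"
  assumes E: "op_n_measure act sc ip E" and f: "f \<in> bounded_borel"
  shows "bop sc ip (opint sc ip E f)"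
    "ip (opint sc ip E f h) w = (\<Sum>j\<in>UNIV. \<Sum>k\<in>UNIV. cint (\<lambda>A. ip (E A k j h) w) (\<lambda>x. f x $ j $ k))"
proof -
  have bopE: "bop sc ip (E A j k)" if "A \<in> sets borel" for A j k
    using E that by (simp add: op_n_measure_def)
  have cmE: "complex_measure (\<lambda>A. ip (E A j k h) w)" for j k h w
    using E by (simp add: op_n_measure_def)
  have fe: "(\<lambda>x. f x $ j $ k) \<in> bounded_borel" for j k
    by (rule bounded_borel_linear[OF f bounded_linear_nth_nth])
  obtain B where B: "\<And>x. norm (f x) \<le> B" "0 < B" by (rule bounded_borelE[OF f]) blast
  define S where "S h w = (\<Sum>j\<in>UNIV. \<Sum>k\<in>UNIV. cint (\<lambda>A. ip (E A k j h) w) (\<lambda>x. f x $ j $ k))" for h w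
  \<comment> \<open>For fixed indices the operators \<open>E A k j\<close>, with \<open>A\<close>
    ranging over the Borel sets, are weakly bounded: a complex measure is bounded by the mass of its
    Jordan sum.\<close>
  have ex: "\<exists>C\<ge>0. \<forall>A\<in>sets borel. \<forall>h w. cmod (ip (E A k j h) w) \<le> C * hn h * hn w" for j k
  proof (rule operators_uniformly_bounded[OF bopE])
    fix h w
    interpret finite_measure "jordan_sum (\<lambda>A. ip (E A k j h) w)" by (rule finite_jordan_sum[OF cmE])
    have "cmod (ip (E A k j h) w) \<le> measure (jordan_sum (\<lambda>A. ip (E A k j h) w)) UNIV" if "A \<in> sets borel" for A
      using order_trans[OF cmod_le_jordan_sum[OF cmE that] bounded_measure[of A]] by simp
    then show "\<exists>C. \<forall>A\<in>sets borel. cmod (ip (E A k j h) w) \<le> C" by blast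
  qed
  define C where "C j k = (SOME C. 0 \<le> C \<and> (\<forall>A\<in>sets borel. \<forall>h w. cmod (ip (E A k j h) w) \<le> C * hn h * hn w))" for j k
  have C: "cmod (ip (E A k j h) w) \<le> C j k * hn h * hn w" if "A \<in> sets borel" for j k A h w
    using someI_ex[OF ex[of k j]] that unfolding C_def by blast
  \<comment> \<open>The uniform bound holds on every Borel set, so the mass of the Jordan sum is at
    most 4 times as large.\<close>
  have b: "cmod (cint (\<lambda>A. ip (E A k j h) w) (\<lambda>x. f x $ j $ k)) \<le> (4 * (C j k * hn h * hn w)) * B" for j k h w
  proof -
    have "cmod (cint (\<lambda>A. ip (E A k j h) w) (\<lambda>x. f x $ j $ k)) \<le> measure (jordan_sum (\<lambda>A. ip (E A k j h) w)) UNIV * B"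
      by (rule cmod_cint_bound[OF cmE fe]) (rule order_trans[OF cmod_nth_nth_le B(1)])
    also have "\<dots> \<le> (4 * (C j k * hn h * hn w)) * B"
      using B(2) by (intro mult_right_mono measure_jordan_sum_le[OF cmE] C) auto
    finally show ?thesis .
  qed
  have "\<exists>T. bop sc ip T \<and> (\<forall>h w. ip (T h) w = S h w)"
  proof (rule form_operator[where K="\<Sum>j\<in>UNIV. \<Sum>k\<in>UNIV. 4 * C j k * B"])
    have "cint (\<lambda>A. ip (E A k j (x + y)) w) (\<lambda>x. f x $ j $ k) =
       cint (\<lambda>A. ip (E A k j x) w) (\<lambda>x. f x $ j $ k) + cint (\<lambda>A. ip (E A k j y) w) (\<lambda>x. f x $ j $ k)" for j k x y w
      by (rule cint_add[OF cmE cmE cmE _ fe]) (simp add: bopD[OF bopE] ip_add_left)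
    then show "S (x + y) w = S x w + S y w" for x y w by (simp add: S_def sum.distrib)
    have "cint (\<lambda>A. ip (E A k j (sc c x)) w) (\<lambda>x. f x $ j $ k) =
       c * cint (\<lambda>A. ip (E A k j x) w) (\<lambda>x. f x $ j $ k)" for j k x c w
      by (rule cint_cmult[OF cmE cmE _ fe]) (simp add: bopD[OF bopE] ip_sc_left)
    then show "S (sc c x) w = c * S x w" for c x w by (simp add: S_def sum_distrib_left)
    have "cint (\<lambda>A. ip (E A k j w) (x + y)) (\<lambda>x. f x $ j $ k) =
       cint (\<lambda>A. ip (E A k j w) x) (\<lambda>x. f x $ j $ k) + cint (\<lambda>A. ip (E A k j w) y) (\<lambda>x. f x $ j $ k)" for j k x y w
      by (rule cint_add[OF cmE cmE cmE _ fe]) (simp add: ip_add_right)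
    then show "S w (x + y) = S w x + S w y" for x y w by (simp add: S_def sum.distrib)
    have "cint (\<lambda>A. ip (E A k j w) (sc c x)) (\<lambda>x. f x $ j $ k) =
       cnj c * cint (\<lambda>A. ip (E A k j w) x) (\<lambda>x. f x $ j $ k)" for j k x c w
      by (rule cint_cmult[OF cmE cmE _ fe]) (simp add: ip_sc_right)
    then show "S w (sc c x) = cnj c * S w x" for c x w by (simp add: S_def sum_distrib_left)
    show "cmod (S x w) \<le> (\<Sum>j\<in>UNIV. \<Sum>k\<in>UNIV. 4 * C j k * B) * hn x * hn w" for x w
    proof -
      have "cmod (S x w) \<le> (\<Sum>j\<in>UNIV. \<Sum>k\<in>UNIV. (4 * (C j k * hn x * hn w)) * B)"
        unfolding S_def by (intro sum_norm_le b)
      also have "\<dots> = (\<Sum>j\<in>UNIV. \<Sum>k\<in>UNIV. 4 * C j k * B) * hn x * hn w"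
        by (simp add: sum_distrib_right sum_distrib_left mult_ac)
      finally show ?thesis .
    qed
  qed
  then obtain T where T: "bop sc ip T" "\<And>h w. ip (T h) w = S h w" by blast
  have "opint sc ip E f = T" by (rule opint_eqI[OF T(1)]) (simp add: T(2) S_def)
  then show "bop sc ip (opint sc ip E f)"
    "ip (opint sc ip E f h) w = (\<Sum>j\<in>UNIV. \<Sum>k\<in>UNIV. cint (\<lambda>A. ip (E A k j h) w) (\<lambda>x. f x $ j $ k))"
    using T by (simp_all add: S_def)
qed

text \<open>Expands a twisted matrix unit into matrix units. The coefficients are those of
  \<open>opconj\<close> with the indices swapped, because \<open>munit j k\<close> is paired with
  the operator entry \<open>k j\<close>; \<open>ip_opconj\<close> puts the other side into the same
  shape.\<close>

lemma twist_munit_indicator: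
  assumes \<Phi>: "radon_functional \<Phi>" and U: "U \<in> unitaries" and B: "B \<in> sets borel"
  shows "\<Phi> (twist act U (\<lambda>x. munit j k (indicator (act U ` B) x))) =
    (\<Sum>m\<in>UNIV. \<Sum>l\<in>UNIV. (cnj (U $ j $ m) * U $ k $ l) * \<Phi> (\<lambda>x. munit m l (indicator B x)))"
proof -
  let ?F = "twist act U (\<lambda>x. munit j k (indicator (act U ` B) x))"
  have ind: "indicator (act U ` B) (act U x) = (indicator B x :: complex)" for x
    using act_cadj(1)[OF U] by (auto simp: indicator_def act_image[OF U])
  have entry: "?F x $ m $ l = (cnj (U $ j $ m) * U $ k $ l) * indicator B x" for x m l
  proof -
    have "?F x $ m $ l = (\<Sum>b\<in>UNIV. (\<Sum>a\<in>UNIV. cnj (U $ a $ m) * (if a = j \<and> b = k then indicator B x else 0)) * U $ b $ l)"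
      by (simp add: twist_def ind matrix_matrix_mult_def munit_nth)
    also have "\<dots> = (\<Sum>b\<in>UNIV. (if b = k then cnj (U $ j $ m) * indicator B x else 0) * U $ b $ l)"
    proof (intro sum.cong refl arg_cong2[where f="(*)"])
      fix b
      have "(\<Sum>a\<in>UNIV. cnj (U $ a $ m) * (if a = j \<and> b = k then indicator B x else 0)) =
         (\<Sum>a\<in>UNIV. if a = j then (if b = k then cnj (U $ j $ m) * indicator B x else 0) else 0)"
        by (intro sum.cong refl) auto
      then show "(\<Sum>a\<in>UNIV. cnj (U $ a $ m) * (if a = j \<and> b = k then indicator B x else 0)) =
         (if b = k then cnj (U $ j $ m) * indicator B x else 0)" by simp
    qed
    also have "\<dots> = (\<Sum>b\<in>UNIV. if b = k then cnj (U $ j $ m) * indicator B x * U $ k $ l else 0)"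
      by (intro sum.cong refl) auto
    finally show ?thesis by (simp add: mult_ac)
  qed
  have bb: "(\<lambda>x. munit m l (indicator B x)) \<in> bounded_borel" for m l by (rule bounded_borel_munit_indicator[OF B])
  have "?F \<in> bounded_borel"
    by (intro twist_bounded_borel bounded_borel_munit_indicator act_image_borel U B)
  then have "\<Phi> ?F = (\<Sum>m\<in>UNIV. \<Sum>l\<in>UNIV. \<Phi> (\<lambda>x. munit m l (?F x $ m $ l)))"
    by (rule radon_functional_decomp[OF \<Phi>])
  also have "\<dots> = (\<Sum>m\<in>UNIV. \<Sum>l\<in>UNIV. \<Phi> (fscale (cnj (U $ j $ m) * U $ k $ l) (\<lambda>x. munit m l (indicator B x))))"
    by (simp only: entry fscale_eq cscale_munit)
  also have "\<dots> = (\<Sum>m\<in>UNIV. \<Sum>l\<in>UNIV. (cnj (U $ j $ m) * U $ k $ l) * \<Phi> (\<lambda>x. munit m l (indicator B x)))"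
    by (simp only: radon_functional_fscale[OF \<Phi> bb])
  finally show ?thesis .
qed

lemma ip_opconj:
  "ip (opconj sc U M k j h) w = (\<Sum>m\<in>UNIV. \<Sum>l\<in>UNIV. (cnj (U $ j $ m) * U $ k $ l) * ip (M l m h) w)"
  unfolding opconj_def ip_sum_left ip_sc_left by (subst sum.swap) (simp add: mult.commute)

text \<open>The weak form of \<open>opint\<close>, used for all bounded Borel functions and not only
  the equivariant ones. The crossed indices \<open>k j\<close> and \<open>j k\<close> make it a
  trace pairing.\<close>

definition wint :: "('x set \<Rightarrow> 'n \<Rightarrow> 'n \<Rightarrow> 'h \<Rightarrow> 'h) \<Rightarrow> 'h \<Rightarrow> 'h \<Rightarrow> ('x \<Rightarrow> complex^'n^'n) \<Rightarrow> complex" where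
  "wint E h w F = (\<Sum>j\<in>UNIV. \<Sum>k\<in>UNIV. cint (\<lambda>A. ip (E A k j h) w) (\<lambda>x. F x $ j $ k))"

text \<open>A Radon functional is determined by matrix units times indicators, and there invariance
  is the equivariance of \<open>E\<close>.\<close>

lemma wint:
  assumes E: "regular_op_n_measure act sc ip E"
  shows "radon_functional (wint E h w)" "invariant (wint E h w)"
    "A \<in> sets borel \<Longrightarrow> wint E h w (\<lambda>x. munit j k (indicator A x)) = ip (E A k j h) w"
proof -
  have cmE: "complex_measure (\<lambda>A. ip (E A j k h) w)" and regE: "regular_cm (\<lambda>A. ip (E A j k h) w)" for j k h w
    using E by (simp_all add: regular_op_n_measure_def op_n_measure_def)
  have equivE: "E (act U ` A) = opconj sc U (E A)" if "U \<in> unitaries" "A \<in> sets borel" for U A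
    using E that by (simp add: regular_op_n_measure_def op_n_measure_def)
  show r: "radon_functional (wint E h w)"
    unfolding wint_def
    by (intro radon_functional_sum_functionals radon_functional_of_entry[OF regular_cm_dominated[OF cmE regE]]) auto
  have z: "cint (\<lambda>A. ip (E A k j h) w) (\<lambda>x. 0) = 0" for j k
  proof -
    have "(\<lambda>x :: 'x. 0 :: complex) = indicator {}" by auto
    then show ?thesis using cint_indicator[OF cmE, of "{}" k j h w] cmE[of k j h w] by (simp add: complex_measure_def)
  qed
  show m: "wint E h w (\<lambda>x. munit j k (indicator A x)) = ip (E A k j h) w" if A: "A \<in> sets borel" for A j k
  proof -
    have "wint E h w (\<lambda>x. munit j k (indicator A x)) =
      (\<Sum>a\<in>UNIV. \<Sum>b\<in>UNIV. if b = k then (if a = j then ip (E A k j h) w else 0) else 0)"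
      unfolding wint_def
    proof (intro sum.cong refl)
      fix a b
      show "cint (\<lambda>A. ip (E A b a h) w) (\<lambda>x. munit j k (indicator A x) $ a $ b) =
         (if b = k then (if a = j then ip (E A k j h) w else 0) else 0)"
        using cint_indicator[OF cmE A] by (auto simp: munit_nth z)
    qed
    then show ?thesis by simp
  qed
  show "invariant (wint E h w)"
    unfolding invariant_def
  proof (intro ballI)
    fix U :: "complex^'n^'n" and F :: "'x \<Rightarrow> complex^'n^'n" assume U: "U \<in> unitaries" and F: "F \<in> bounded_borel"
    have "(\<lambda>F. wint E h w (twist act U F) - wint E h w F) F = 0"
    proof (rule radon_functional_eq_0_indicator[OF radon_functional_diff[OF radon_functional_twist[OF r U] r] F])
      fix A :: "'x set" and j k assume A: "A \<in> sets borel"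
      define B where "B = act (cadj U) ` A"
      have B: "B \<in> sets borel" unfolding B_def by (rule act_image_borel[OF unitaries_cadj[OF U] A])
      have AB: "A = act U ` B" unfolding B_def image_image by (simp add: act_cadj[OF U])
      have "wint E h w (twist act U (\<lambda>x. munit j k (indicator A x))) = ip (opconj sc U (E B) k j h) w"
        unfolding AB twist_munit_indicator[OF r U B] ip_opconj m[OF B] ..
      also have "\<dots> = wint E h w (\<lambda>x. munit j k (indicator A x))"
        unfolding m[OF A] using equivE[OF U B] AB by simp
      finally show "wint E h w (twist act U (\<lambda>x. munit j k (indicator A x))) - wint E h w (\<lambda>x. munit j k (indicator A x)) = 0"
        by simp
    qed
    then show "wint E h w (twist act U F) = wint E h w F" by simp
  qed
qed

end

section \<open>The spectral n-measure of a representation\<close>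

sublocale nspace_rep \<subseteq> nspace_hilbert ..

context nspace_rep
begin

lemma invariantD: "invariant \<Phi> \<Longrightarrow> U \<in> unitaries \<Longrightarrow> F \<in> bounded_borel \<Longrightarrow> \<Phi> (twist act U F) = \<Phi> F"
  by (simp add: invariant_def)

lemma invariant_plus: "invariant \<Phi> \<Longrightarrow> invariant \<Psi> \<Longrightarrow> invariant (\<lambda>F. \<Phi> F + \<Psi> F)"
  by (simp add: invariant_def)

lemma rext_add_left:
  assumes F: "F \<in> bounded_borel" shows "rext (h + k) w F = rext h w F + rext k w F"
  by (rule rext_unique[OF radon_functional_plus[OF rext(1) rext(1)] invariant_plus[OF rext(2) rext(2)] _ F])
     (simp add: rext(3) bopD[OF rep_bop] ip_add_left)

lemma rext_add_right:
  assumes F: "F \<in> bounded_borel" shows "rext w (h + k) F = rext w h F + rext w k F"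
  by (rule rext_unique[OF radon_functional_plus[OF rext(1) rext(1)] invariant_plus[OF rext(2) rext(2)] _ F])
     (simp add: rext(3) ip_add_right)

lemma rext_sc_left:
  assumes F: "F \<in> bounded_borel" shows "rext (sc c h) w F = c * rext h w F"
  using rext(2)[of h w]
  by (intro rext_unique[OF radon_functional_cmult[OF rext(1)] _ _ F])
     (simp_all add: invariant_def rext(3) bopD[OF rep_bop] ip_sc_left)

lemma rext_sc_right:
  assumes F: "F \<in> bounded_borel" shows "rext w (sc c h) F = cnj c * rext w h F"
  using rext(2)[of w h]
  by (intro rext_unique[OF radon_functional_cmult[OF rext(1)] _ _ F])
     (simp_all add: invariant_def rext(3) ip_sc_right)

text \<open>To define an operator the bound must be linear in \<open>hn h\<close> and
  \<open>hn w\<close>. Domination gives no control in these vectors; the bound is therefore taken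
  from \<open>\<pi>\<close> at averages of functions in \<open>C0\<close> and then passed to
  indicators.\<close>

lemma rext_indicator_bound:
  assumes A: "A \<in> sets borel"
  shows "cmod (rext h w (\<lambda>x. munit j k (indicator A x))) \<le> 3 * hn h * hn w"
proof -
  obtain N where N: "dominated (\<lambda>g. rext h w (\<lambda>x. munit j k (g x))) N"
    by (rule radon_functional_entry[OF rext(1)]) blast
  show ?thesis
  proof (rule dominated_indicator_bound[OF lc N A])
    fix u :: "'x \<Rightarrow> complex" assume u: "u \<in> C0" "\<And>x. cmod (u x) \<le> 1"
    have m: "(\<lambda>x. munit j k (u x)) \<in> C0" by (rule C0_linear[OF u(1) bounded_linear_munit])
    have "rext h w (\<lambda>x. munit j k (u x)) = rext h w (avg act (\<lambda>x. munit j k (u x)))"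
      by (rule invariant_radon_avg[OF rext(1,2) m, symmetric])
    also have "\<dots> = ip (\<pi> (avg act (\<lambda>x. munit j k (u x))) h) w" by (rule rext(3)[OF avg_Cstar[OF m]])
    also have "cmod \<dots> \<le> (3 * hn h * hn w) * 1"
      by (rule rep_form_bound[OF avg_Cstar[OF m] norm_avg_le[OF m]]) (simp_all add: norm_munit u(2))
    finally show "cmod (rext h w (\<lambda>x. munit j k (u x))) \<le> 3 * hn h * hn w" by simp
  qed
qed

text \<open>The swap of \<open>j\<close> and \<open>k\<close> matches the trace pairing in
  \<open>opint\<close>.\<close>

definition spec :: "'x set \<Rightarrow> 'n \<Rightarrow> 'n \<Rightarrow> 'h \<Rightarrow> 'h" where
  "spec A j k = (SOME T. bop sc ip T \<and> (\<forall>h w. ip (T h) w = rext h w (\<lambda>x. munit k j (indicator A x))))"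

lemma spec:
  assumes A: "A \<in> sets borel"
  shows "bop sc ip (spec A j k)" "ip (spec A j k h) w = rext h w (\<lambda>x. munit k j (indicator A x))"
proof -
  note m = bounded_borel_munit_indicator[OF A]
  have "\<exists>T. bop sc ip T \<and> (\<forall>h w. ip (T h) w = rext h w (\<lambda>x. munit k j (indicator A x)))"
    by (rule form_operator[OF rext_add_left[OF m] rext_sc_left[OF m] rext_add_right[OF m] rext_sc_right[OF m] rext_indicator_bound[OF A]])
  from someI_ex[OF this] show "bop sc ip (spec A j k)" "ip (spec A j k h) w = rext h w (\<lambda>x. munit k j (indicator A x))"
    unfolding spec_def by auto
qed

lemma spec_regular: "regular_op_n_measure act sc ip spec"
proof -
  have d: "\<exists>N. dominated (\<lambda>g. rext h w (\<lambda>x. munit k j (g x))) N" for h w j k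
    by (rule radon_functional_entry[OF rext(1)]) blast
  have cm: "complex_measure (\<lambda>A. ip (spec A j k h) w)" for j k h w
  proof -
    obtain N where N: "dominated (\<lambda>g. rext h w (\<lambda>x. munit k j (g x))) N" using d by blast
    show ?thesis by (rule complex_measure_cong[OF dominated_complex_measure[OF N]]) (rule spec(2))
  qed
  have "regular_cm (\<lambda>A. ip (spec A j k h) w)" for j k h w
  proof -
    obtain N where N: "dominated (\<lambda>g. rext h w (\<lambda>x. munit k j (g x))) N" using d by blast
    show ?thesis
      by (rule radon_imp_regular_cm[OF cm dominatedD(2)[OF N]]) (simp add: spec(2) dominated_indicator[OF N])
  qed
  moreover have "spec (act U ` A) = opconj sc U (spec A)" if U: "U \<in> unitaries" and A: "A \<in> sets borel" for U A
  proof (intro ext)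
    fix k j h
    note UA = act_image_borel[OF U A]
    show "spec (act U ` A) k j h = opconj sc U (spec A) k j h"
    proof (rule ip_eqI)
      fix w
      have "ip (spec (act U ` A) k j h) w = rext h w (twist act U (\<lambda>x. munit j k (indicator (act U ` A) x)))"
        unfolding spec(2)[OF UA]
        by (rule invariantD[OF rext(2) U bounded_borel_munit_indicator[OF UA], symmetric])
      also have "\<dots> = ip (opconj sc U (spec A) k j h) w"
        unfolding twist_munit_indicator[OF rext(1) U A] ip_opconj spec(2)[OF A] ..
      finally show "ip (spec (act U ` A) k j h) w = ip (opconj sc U (spec A) k j h) w" .
    qed
  qed
  ultimately show ?thesis
    using spec(1) cm by (simp add: regular_op_n_measure_def op_n_measure_def)
qed

lemma op_n_measure_spec: "op_n_measure act sc ip spec"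
  using spec_regular by (simp add: regular_op_n_measure_def)

lemma wint_eq_ext:
  assumes E: "regular_op_n_measure act sc ip E" and eq: "\<And>f. f \<in> Cstar act \<Longrightarrow> \<pi> f = opint sc ip E f"
    and F: "F \<in> bounded_borel"
  shows "wint E h w F = rext h w F"
proof (rule rext_unique[OF wint(1,2)[OF E] _ F, symmetric])
  fix f assume f: "f \<in> Cstar act"
  have "f \<in> bounded_borel" using f by (simp add: Cstar_iff C0_bounded_borel)
  moreover have "op_n_measure act sc ip E" using E by (simp add: regular_op_n_measure_def)
  ultimately show "wint E h w f = ip (\<pi> f h) w"
    unfolding eq[OF f] wint_def by (simp only: opint(2))
qed

text \<open>Both sides are Radon functionals with the same values on matrix units times indicators.
  From here on statements about \<open>opint\<close> become statements about
  \<open>rext\<close>.\<close>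

lemma ip_opint_spec:
  assumes F: "F \<in> bounded_borel" shows "ip (opint sc ip spec F h) w = rext h w F"
proof -
  have "(\<lambda>F. wint spec h w F - rext h w F) F = 0"
    by (rule radon_functional_eq_0_indicator[OF radon_functional_diff[OF wint(1)[OF spec_regular] rext(1)] F])
       (simp add: wint(3)[OF spec_regular] spec(2))
  then have "wint spec h w F = rext h w F" by simp
  then show ?thesis unfolding opint(2)[OF op_n_measure_spec F] wint_def .
qed

lemma opint_spec_Cstar:
  assumes f: "f \<in> Cstar act" shows "opint sc ip spec f = \<pi> f"
proof
  fix h
  have "f \<in> bounded_borel" using f by (simp add: Cstar_iff C0_bounded_borel)
  then show "opint sc ip spec f h = \<pi> f h" by (intro ip_eqI) (simp add: ip_opint_spec rext(3) f)
qed

lemma twist_fadj: "twist act U (fadj F) = fadj (twist act U F)"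
  by (simp add: twist_def fadj_def cadj_mult matrix_mul_assoc)

lemma rext_fadj:
  assumes F: "F \<in> bounded_borel" shows "rext h w F = cnj (rext w h (fadj F))"
proof (rule rext_unique[OF radon_functional_adj[OF rext(1)] _ _ F])
  show "invariant (\<lambda>F. cnj (rext w h (fadj F)))"
    unfolding invariant_def twist_fadj[symmetric]
    by (intro ballI arg_cong[where f=cnj] invariantD[OF rext(2)] fadj_bounded_borel)
  fix f assume f: "f \<in> Cstar act"
  show "cnj (rext w h (fadj f)) = ip (\<pi> f h) w"
    using rep_adj[OF f, of h w] ip_sym[of h "\<pi> (fadj f) w"] by (simp add: rext(3) Cstar_fadj f)
qed

lemma opint_spec_adj:
  assumes f: "f \<in> bounded_borel" shows "is_adj ip (opint sc ip spec f) (opint sc ip spec (fadj f))"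
  unfolding is_adj_def
proof (intro allI)
  fix x y
  have "ip x (opint sc ip spec (fadj f) y) = cnj (ip (opint sc ip spec (fadj f) y) x)" by (rule ip_sym)
  also have "\<dots> = cnj (rext y x (fadj f))" by (simp add: ip_opint_spec fadj_bounded_borel f)
  also have "\<dots> = rext x y f" by (rule rext_fadj[OF f, symmetric])
  finally show "ip (opint sc ip spec f x) y = ip x (opint sc ip spec (fadj f) y)"
    by (simp add: ip_opint_spec f)
qed

lemma twist_fmult:
  assumes "U \<in> unitaries" shows "twist act U (fmult F G) = fmult (twist act U F) (twist act U G)"
proof
  fix x
  show "twist act U (fmult F G) x = fmult (twist act U F) (twist act U G) x"
    using conj_unitary_mult[OF unitaries_cadj[OF assms], of "F (act U x)" "G (act U x)"]
    by (simp add: twist_def fmult_def)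
qed

text \<open>Twists fix an equivariant \<open>g\<close>, so multiplication by \<open>g\<close>
  commutes with them. The equivariance of the factors enters multiplicativity at this point.\<close>

lemma invariant_fmult:
  assumes \<Phi>: "invariant \<Phi>" and g: "g \<in> BCstar act"
  shows "invariant (\<lambda>F. \<Phi> (fmult F g))" "invariant (\<lambda>F. \<Phi> (fmult g F))"
proof -
  have gb: "g \<in> bounded_borel" and ge: "\<And>U. U \<in> unitaries \<Longrightarrow> twist act U g = g"
    using g by (auto simp: BCstar_iff twist_equivariant)
  have 1: "fmult (twist act U F) g = twist act U (fmult F g)" "fmult g (twist act U F) = twist act U (fmult g F)"
    if "U \<in> unitaries" for U F
    by (simp_all add: twist_fmult[OF that] ge[OF that])
  show "invariant (\<lambda>F. \<Phi> (fmult F g))" "invariant (\<lambda>F. \<Phi> (fmult g F))"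
    using \<Phi> by (auto simp: invariant_def 1 fmult_bounded_borel gb)
qed

lemma rext_fmult_Cstar:
  assumes g: "g \<in> Cstar act" and F: "F \<in> bounded_borel"
  shows "rext h w (fmult F g) = rext (\<pi> g h) w F"
proof -
  have gb: "g \<in> bounded_borel" using g by (simp add: Cstar_iff C0_bounded_borel)
  show ?thesis
    by (rule rext_unique[OF radon_functional_mult_right[OF rext(1) gb] invariant_fmult(1)[OF rext(2) Cstar_BCstar[OF g]] _ F, symmetric])
       (simp add: rext(3) Cstar_fmult g rep_fmult)
qed

text \<open>First extend \<open>\<pi> (f g) = \<pi> f \<circ> \<pi> g\<close> to Borel \<open>f\<close> with \<open>g\<close> continuous, then, moving \<open>f\<close> to the other
  side by taking adjoints, to Borel \<open>g\<close>.\<close>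
lemma opint_spec_mult:
  assumes f: "f \<in> BCstar act" and g: "g \<in> BCstar act"
  shows "opint sc ip spec (fmult f g) = opint sc ip spec f \<circ> opint sc ip spec g"
proof
  fix h
  have fb: "f \<in> bounded_borel" and gb: "g \<in> bounded_borel" using f g by (simp_all add: BCstar_iff)
  show "opint sc ip spec (fmult f g) h = (opint sc ip spec f \<circ> opint sc ip spec g) h"
  proof (rule ip_eqI)
    fix w
    \<comment> \<open>With the integral of \<open>f\<close> moved to the second slot, both sides are
      invariant Radon functionals of \<open>g\<close>, so the identity needs checking on
      \<open>Cstar act\<close> only.\<close>
    have "rext h (opint sc ip spec (fadj f) w) g = rext h w (fmult f g)"
    proof (rule rext_unique[OF radon_functional_mult_left[OF rext(1) fb] invariant_fmult(2)[OF rext(2) f] _ gb])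
      fix c assume c: "c \<in> Cstar act"
      have "rext h w (fmult f c) = ip (opint sc ip spec f (\<pi> c h)) w"
        by (simp add: rext_fmult_Cstar[OF c fb] ip_opint_spec[OF fb])
      also have "\<dots> = ip (\<pi> c h) (opint sc ip spec (fadj f) w)"
        using opint_spec_adj[OF fb] by (simp add: is_adj_def)
      finally show "rext h w (fmult f c) = ip (\<pi> c h) (opint sc ip spec (fadj f) w)" .
    qed
    then have "ip (opint sc ip spec (fmult f g) h) w = ip (opint sc ip spec g h) (opint sc ip spec (fadj f) w)"
      by (simp add: ip_opint_spec fmult_bounded_borel fb gb)
    also have "\<dots> = ip (opint sc ip spec f (opint sc ip spec g h)) w"
      using opint_spec_adj[OF fb] by (simp add: is_adj_def)
    finally show "ip (opint sc ip spec (fmult f g) h) w = ip ((opint sc ip spec f \<circ> opint sc ip spec g) h) w" by simp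
  qed
qed

lemma spectral_spec: "spectral_n_measure act sc ip spec"
  using spec_regular opint_spec_adj opint_spec_mult by (simp add: spectral_n_measure_def BCstar_iff)

lemma spec_unique:
  assumes E: "spectral_n_measure act sc ip E" and eq: "\<And>f. f \<in> Cstar act \<Longrightarrow> \<pi> f = opint sc ip E f"
    and A: "A \<in> sets borel"
  shows "E A = spec A"
proof (intro ext)
  fix j k h
  have r: "regular_op_n_measure act sc ip E" using E by (simp add: spectral_n_measure_def)
  show "E A j k h = spec A j k h"
  proof (rule ip_eqI)
    fix w
    show "ip (E A j k h) w = ip (spec A j k h) w"
      using wint_eq_ext[OF r eq bounded_borel_munit_indicator[OF A], of h w k j] wint(3)[OF r A, of h w k j]
      by (simp add: spec(2)[OF A])
  qed
qed

lemma star_rep_opint_spec: "star_rep sc ip (BCstar act) (opint sc ip spec)"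
  unfolding star_rep_def
proof (intro conjI ballI allI)
  fix f g c assume f: "f \<in> BCstar act"
  have fb: "f \<in> bounded_borel" using f by (simp add: BCstar_iff)
  show "bop sc ip (opint sc ip spec f)" by (rule opint(1)[OF op_n_measure_spec fb])
  show "is_adj ip (opint sc ip spec f) (opint sc ip spec (fadj f))" by (rule opint_spec_adj[OF fb])
  show "opint sc ip spec (fscale c f) = (\<lambda>h. sc c (opint sc ip spec f h))"
  proof
    fix h show "opint sc ip spec (fscale c f) h = sc c (opint sc ip spec f h)"
      by (rule ip_eqI) (simp add: ip_opint_spec fscale_bounded_borel fb ip_sc_left radon_functional_fscale[OF rext(1)])
  qed
  assume g: "g \<in> BCstar act"
  have gb: "g \<in> bounded_borel" using g by (simp add: BCstar_iff)
  show "opint sc ip spec (fmult f g) = opint sc ip spec f \<circ> opint sc ip spec g" by (rule opint_spec_mult[OF f g])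
  show "opint sc ip spec (\<lambda>x. f x + g x) = (\<lambda>h. opint sc ip spec f h + opint sc ip spec g h)"
  proof
    fix h show "opint sc ip spec (\<lambda>x. f x + g x) h = opint sc ip spec f h + opint sc ip spec g h"
      by (rule ip_eqI) (simp add: ip_opint_spec bounded_borel_add fb gb ip_add_left radon_functional_add[OF rext(1)])
  qed
qed

end

theorem theorem4p6:
  fixes act :: "complex^'n::finite^'n \<Rightarrow> 'x::t2_space \<Rightarrow> 'x"
    and sc :: "complex \<Rightarrow> 'h::ab_group_add \<Rightarrow> 'h"
    and ip :: "'h \<Rightarrow> 'h \<Rightarrow> complex"
    and \<pi> :: "('x \<Rightarrow> complex^'n^'n) \<Rightarrow> 'h \<Rightarrow> 'h"
  assumes "n_space act"
    and "hilbert_space sc ip"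
    and "star_rep sc ip (Cstar act) \<pi>"
  shows "(\<exists>E. spectral_n_measure act sc ip E \<and> (\<forall>f\<in>Cstar act. \<pi> f = opint sc ip E f) \<and>
            (\<forall>E'. spectral_n_measure act sc ip E' \<and> (\<forall>f\<in>Cstar act. \<pi> f = opint sc ip E' f)
                  \<longrightarrow> (\<forall>A\<in>sets borel. E' A = E A)))
       \<and> (\<exists>\<rho>. star_rep sc ip (BCstar act) \<rho> \<and> (\<forall>f\<in>Cstar act. \<rho> f = \<pi> f))"
proof -
  interpret nspace_rep act sc ip \<pi>
    using assms by (simp add: nspace_rep_def nspace_def hilbert_def nspace_rep_axioms_def)
  show ?thesis
  proof (intro conjI exI[where x=spec] exI[where x="opint sc ip spec"] allI impI ballI)
    show "spectral_n_measure act sc ip spec" by (rule spectral_spec)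
    show "\<pi> f = opint sc ip spec f" if "f \<in> Cstar act" for f by (rule opint_spec_Cstar[OF that, symmetric])
    show "E' A = spec A"
      if "spectral_n_measure act sc ip E' \<and> (\<forall>f\<in>Cstar act. \<pi> f = opint sc ip E' f)" "A \<in> sets borel" for E' A
      using that by (intro spec_unique) auto
    show "star_rep sc ip (BCstar act) (opint sc ip spec)" by (rule star_rep_opint_spec)
    show "opint sc ip spec f = \<pi> f" if "f \<in> Cstar act" for f by (rule opint_spec_Cstar[OF that])
  qed
qed

end
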